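(* Let $m>d/2$, let $\Omega\subset\mathbb{R}^d$ be a bounded scalable Lipschitz domain, let $\lambda$ be a functional of scaling order $s$ that is continuous on $W_2^m(\Omega)$, and let $X=\{x_1,\dots,x_M\}\subset\Omega$ be a finite set of distinct points. For $0<h\le1$ let $a^*(h)\in\mathbb{R}^M$ be the $W_2^m(\mathbb{R}^d)$-optimal approximation weights for $\lambda$ on $hX$. Assume that $X$ allows a unique scalable stencil for $\lambda$, with weights $\hat a\in\mathbb{R}^M$, that is exact on polynomials of order $q$. Then there is a constant $C$ such that, for all sufficiently small $h>0$, $$\|a^*(h)h^s-\hat a\|_\infty\le C h^{m-q+1-d/2}\quad\text{if } m-d/2<q,$$ and $$\|a^*(h)h^s-\hat a\|_\infty\le C h\quad\text{if } m-d/2\ge q.$$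
   Context: A domain $\Omega\subset\mathbb{R}^d$ is scalable if it contains the origin as an interior point and $h\Omega\subseteq\Omega$ for all $0\le h\le1$. $W_2^m$ denotes the usual $L_2$-based Sobolev space of order $m$; $W_2^m(\mathbb{R}^d)$ carries the Hilbert space norm whose reproducing kernel is (up to a positive constant) $K_{m-d/2}(\|x-y\|_2)\|x-y\|_2^{m-d/2}$ with the modified Bessel function $K_\nu$ of the second kind. Functionals on $W_2^m(\Omega)$ act on functions on $\mathbb{R}^d$ (including polynomials) by restriction to $\Omega$. A functional $\lambda$ has scaling order $s$ if $\lambda(u(h\,\cdot))=h^s\lambda(u)$ for all $u$ in its domain and $0<h\le1$. For $b\in\mathbb{R}^M$ and $0<h\le1$ put $\lambda_{b,hX}(u)=\sum_{j=1}^M b_ju(hx_j)$. The optimal weights $a^*(h)$ are the (unique) minimizer of $\|\lambda-\lambda_{b,hX}\|_{W_2^m(\mathbb{R}^d)^*}$ over all $b\in\mathbb{R}^M$. The scalable stencil with weights $\hat a$ on $X$ consists of the approximations $\lambda_{\hat ah^{-s},hX}$, $0<h\le1$. It is exact on polynomials of order $q$ if $\lambda(p)=\sum_{j=1}^M\hat a_jp(x_j)$ for all real $d$-variate polynomials $p$ of total degree less than $q$; uniqueness means that $\hat a$ is the only weight vector in $\mathbb{R}^M$ with this property. *)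

theory Defs
  imports "HOL-Probability.Probability"
begin

section \<open>The Sobolev spaces\<close>

text \<open>
  For m > d/2 the elements of \<open>W\<^sub>2\<^sup>m(\<real>\<^sup>d)\<close> are continuous functions, and a function is
  identified with its continuous representative: u belongs to the space iff it is the Fourier
  integral of a spectral density g with
  \<open>\<integral> (1 + |\<omega>|\<^sup>2)\<^sup>m |g(\<omega>)|\<^sup>2 d\<omega> < \<infinity>\<close>, and the square root of this integral is the norm of u.
  (Up to a constant, g is the Fourier transform of u; the condition makes g Lebesgue integrable.)
  The order m may be any real number above d/2.
\<close>

definition sobolev_weight :: "real \<Rightarrow> real^'d \<Rightarrow> real" where
  "sobolev_weight m w = (1 + (norm w)\<^sup>2) powr m"

definition spectral_density :: "real \<Rightarrow> (real^'d \<Rightarrow> real) \<Rightarrow> (real^'d \<Rightarrow> complex) \<Rightarrow> bool" where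
  "spectral_density m u g \<longleftrightarrow>
     g \<in> borel_measurable lborel \<and>
     integrable lborel (\<lambda>w. sobolev_weight m w * (cmod (g w))\<^sup>2) \<and>
     (\<forall>x. complex_of_real (u x) = (LINT w|lborel. g w * cis (w \<bullet> x)))"

definition sobolev_space :: "real \<Rightarrow> (real^'d \<Rightarrow> real) set" where
  "sobolev_space m = {u. \<exists>g. spectral_density m u g}"

text \<open>
  The density of u is unique almost everywhere (injectivity of the Fourier transform on integrable
  functions), so the infimum below is taken over a single value.
\<close>

definition sobolev_norm :: "real \<Rightarrow> (real^'d \<Rightarrow> real) \<Rightarrow> real" where
  "sobolev_norm m u =
     Inf {sqrt (LINT w|lborel. sobolev_weight m w * (cmod (g w))\<^sup>2) |g. spectral_density m u g}"

text \<open>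
  \<open>W\<^sub>2\<^sup>m(\<Omega>)\<close> consists of the restrictions to \<open>\<Omega>\<close> of the elements of \<open>W\<^sub>2\<^sup>m(\<real>\<^sup>d)\<close> and carries the
  quotient norm; on a bounded Lipschitz domain this is the intrinsically defined space up to
  equivalence of norms.  Its elements are represented by functions on \<open>\<real>\<^sup>d\<close> whose values outside of
  \<open>\<Omega>\<close> are irrelevant, so a functional on \<open>W\<^sub>2\<^sup>m(\<Omega>)\<close> acts on functions on \<open>\<real>\<^sup>d\<close> by restriction.
\<close>

definition sobolev_space_on :: "real \<Rightarrow> (real^'d) set \<Rightarrow> (real^'d \<Rightarrow> real) set" where
  "sobolev_space_on m \<Omega> = {u. \<exists>v\<in>sobolev_space m. \<forall>x\<in>\<Omega>. v x = u x}"

definition sobolev_norm_on :: "real \<Rightarrow> (real^'d) set \<Rightarrow> (real^'d \<Rightarrow> real) \<Rightarrow> real" where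
  "sobolev_norm_on m \<Omega> u = Inf {sobolev_norm m v |v. v \<in> sobolev_space m \<and> (\<forall>x\<in>\<Omega>. v x = u x)}"

definition sobolev_functional :: "real \<Rightarrow> (real^'d) set \<Rightarrow> ((real^'d \<Rightarrow> real) \<Rightarrow> real) \<Rightarrow> bool" where
  "sobolev_functional m \<Omega> L \<longleftrightarrow>
     (\<forall>u\<in>sobolev_space_on m \<Omega>. \<forall>v\<in>sobolev_space_on m \<Omega>. \<forall>a b.
        L (\<lambda>x. a * u x + b * v x) = a * L u + b * L v) \<and>
     (\<exists>B. \<forall>u\<in>sobolev_space_on m \<Omega>. \<bar>L u\<bar> \<le> B * sobolev_norm_on m \<Omega> u)"

text \<open>Norm of a continuous linear functional on \<open>W\<^sub>2\<^sup>m(\<real>\<^sup>d)\<close>.\<close>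

definition sobolev_dual_norm :: "real \<Rightarrow> ((real^'d \<Rightarrow> real) \<Rightarrow> real) \<Rightarrow> real" where
  "sobolev_dual_norm m L = Sup {\<bar>L u\<bar> |u. u \<in> sobolev_space m \<and> sobolev_norm m u \<le> 1}"


section \<open>Domains, functionals and stencils\<close>

definition scalable :: "(real^'d) set \<Rightarrow> bool" where
  "scalable \<Omega> \<longleftrightarrow> 0 \<in> interior \<Omega> \<and> (\<forall>h\<in>{0..1}. (\<lambda>x. h *\<^sub>R x) ` \<Omega> \<subseteq> \<Omega>)"

text \<open>
  Near each boundary point the domain is the part strictly above the graph of a Lipschitz function,
  in Cartesian coordinates whose last axis points in the direction e; the remaining coordinates
  form the hyperplane orthogonal to e.
\<close>

definition lipschitz_domain :: "(real^'d) set \<Rightarrow> bool" where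
  "lipschitz_domain \<Omega> \<longleftrightarrow> open \<Omega> \<and> connected \<Omega> \<and> \<Omega> \<noteq> {} \<and>
     (\<forall>z\<in>frontier \<Omega>. \<exists>r>0. \<exists>e \<phi> K. norm e = 1 \<and> K-lipschitz_on {v. v \<bullet> e = 0} \<phi> \<and>
        \<Omega> \<inter> ball z r = {x \<in> ball z r. \<phi> (x - (x \<bullet> e) *\<^sub>R e) < x \<bullet> e})"

definition scaling_order :: "real \<Rightarrow> (real^'d) set \<Rightarrow> ((real^'d \<Rightarrow> real) \<Rightarrow> real) \<Rightarrow> real \<Rightarrow> bool" where
  "scaling_order m \<Omega> L s \<longleftrightarrow>
     (\<forall>u\<in>sobolev_space_on m \<Omega>. \<forall>h\<in>{0<..1}. L (\<lambda>x. u (h *\<^sub>R x)) = h powr s * L u)"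

definition nodal_functional ::
    "real^'n \<Rightarrow> real \<Rightarrow> ('n \<Rightarrow> real^'d) \<Rightarrow> (real^'d \<Rightarrow> real) \<Rightarrow> real" where
  "nodal_functional b h x u = (\<Sum>j\<in>UNIV. b $ j * u (h *\<^sub>R x j))"

definition optimal_weights ::
    "real \<Rightarrow> ((real^'d \<Rightarrow> real) \<Rightarrow> real) \<Rightarrow> real \<Rightarrow> ('n \<Rightarrow> real^'d) \<Rightarrow> real^'n \<Rightarrow> bool" where
  "optimal_weights m L h x a \<longleftrightarrow>
     is_arg_min (\<lambda>b. sobolev_dual_norm m (\<lambda>u. L u - nodal_functional b h x u)) (\<lambda>b. True) a"

text \<open>Real polynomials of total degree less than q; \<open>\<alpha>\<close> ranges over multi-indices.\<close>

definition polynomials_of_order :: "nat \<Rightarrow> (real^'d \<Rightarrow> real) set" where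
  "polynomials_of_order q =
     {p. \<exists>A c. finite A \<and> (\<forall>\<alpha>\<in>A. (\<Sum>i\<in>UNIV. \<alpha> i) < q) \<and>
               p = (\<lambda>x. \<Sum>\<alpha>\<in>A. c \<alpha> * (\<Prod>i\<in>UNIV. (x $ i) ^ \<alpha> i))}"

definition stencil_exact ::
    "((real^'d \<Rightarrow> real) \<Rightarrow> real) \<Rightarrow> ('n \<Rightarrow> real^'d) \<Rightarrow> real^'n \<Rightarrow> nat \<Rightarrow> bool" where
  "stencil_exact L x a q \<longleftrightarrow> (\<forall>p\<in>polynomials_of_order q. L p = (\<Sum>j\<in>UNIV. a $ j * p (x j)))"


section \<open>The reproducing kernel of the Sobolev norm\<close>

text \<open>
  This section confirms that, up to a positive constant, the Hilbert space norm defined above is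
  the one whose reproducing kernel is \<open>K\<^sub>\<nu>(|x - y|) |x - y|\<^sup>\<nu>\<close> with \<open>\<nu> = m - d/2\<close>, where
  \<open>K\<^sub>\<nu>\<close> is the modified Bessel function of the second kind, given by its integral representation
  on the positive half line.
\<close>

definition bessel_K :: "real \<Rightarrow> real \<Rightarrow> real" where
  "bessel_K \<nu> z = (LINT t:{0<..}|lborel. exp (- z * cosh t) * cosh (\<nu> * t))"

text \<open>
  The radial kernel profile \<open>r\<^sup>\<nu> K\<^sub>\<nu>(r)\<close>, extended continuously to r = 0.
\<close>

definition matern :: "real \<Rightarrow> real \<Rightarrow> real" where
  "matern \<nu> r = (if r = 0 then 2 powr (\<nu> - 1) * Gamma \<nu> else r powr \<nu> * bessel_K \<nu> r)"

lemma gaussian_fourier_1: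
  fixes t y :: real
  assumes t: "t > 0"
  shows "has_bochner_integral lborel (\<lambda>w. complex_of_real (exp (- t * w\<^sup>2)) * cis (w * y))
           (complex_of_real (sqrt (pi / t) * exp (- y\<^sup>2 / (4 * t))))"
proof -
  define c where "c = sqrt (2 * t)"
  have c: "c > 0" "c\<^sup>2 = 2 * t" using t by (auto simp: c_def)
  interpret N: real_distribution std_normal_distribution by (rule real_dist_normal_dist)
  have nz: "\<And>u::real. sqrt (2 * pi) * (u / sqrt (2 * pi)) = u" by simp
  have 1: "integrable std_normal_distribution (\<lambda>x. iexp ((y / c) * x))"
    by (rule N.integrable_const_bound[of _ 1]) auto
  have "integrable lborel (\<lambda>x. std_normal_density x *\<^sub>R iexp ((y / c) * x))"
    using 1 by (subst (asm) integrable_density) (auto simp: normal_density_nonneg)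
  moreover have "(LINT x|lborel. std_normal_density x *\<^sub>R iexp ((y / c) * x)) = complex_of_real (exp (- ((y/c)\<^sup>2) / 2))"
    using fun_cong[OF char_std_normal_distribution, of "y / c"] unfolding char_def
    by (subst (asm) integral_density) (auto simp: normal_density_nonneg)
  ultimately have 2: "has_bochner_integral lborel (\<lambda>x. std_normal_density x *\<^sub>R iexp ((y / c) * x))
      (complex_of_real (exp (- ((y/c)\<^sup>2) / 2)))"
    by (simp add: has_bochner_integral_iff)
  have 3: "has_bochner_integral lborel (\<lambda>x. std_normal_density (0 + c * x) *\<^sub>R iexp ((y / c) * (0 + c * x)))
      (complex_of_real (exp (- ((y/c)\<^sup>2) / 2)) /\<^sub>R \<bar>c\<bar>)"
    using 2 c by (subst (asm) lborel_has_bochner_integral_real_affine_iff[of c _ _ 0]) auto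
  have 4: "has_bochner_integral lborel (\<lambda>x. sqrt (2*pi) *\<^sub>R (std_normal_density (0 + c * x) *\<^sub>R iexp ((y / c) * (0 + c * x))))
      (sqrt (2*pi) *\<^sub>R (complex_of_real (exp (- ((y/c)\<^sup>2) / 2)) /\<^sub>R \<bar>c\<bar>))"
    by (rule has_bochner_integral_scaleR_right) (use 3 in simp)
  have e1: "sqrt (2*pi) *\<^sub>R (std_normal_density (0 + c * x) *\<^sub>R iexp ((y / c) * (0 + c * x)))
       = complex_of_real (exp (- t * x\<^sup>2)) * cis (x * y)" for x
    using c by (simp add: std_normal_density_def power_mult_distrib scaleR_conv_of_real cis_conv_exp mult_ac
        nz flip: of_real_mult)
  have "sqrt (2*pi) / c = sqrt (pi / t)"
    using t unfolding c_def real_sqrt_divide[symmetric] by simp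
  moreover have "(y/c)\<^sup>2 / 2 = y\<^sup>2 / (4 * t)" using c by (simp add: power_divide)
  ultimately have e2: "sqrt (2*pi) *\<^sub>R (complex_of_real (exp (- ((y/c)\<^sup>2) / 2)) /\<^sub>R \<bar>c\<bar>) = complex_of_real (sqrt (pi / t) * exp (- y\<^sup>2 / (4 * t)))"
    using c by (simp add: scaleR_conv_of_real field_simps flip: of_real_mult of_real_divide)
  show ?thesis using 4 unfolding e1 e2 .
qed

lemma prod_cis: "finite A \<Longrightarrow> (\<Prod>a\<in>A. cis (f a)) = cis (\<Sum>a\<in>A. f a)"
  by (induction A rule: finite_induct) (auto simp: cis_mult)

lemma has_bochner_integral_lborel_prod:
  fixes f :: "'a::euclidean_space \<Rightarrow> real \<Rightarrow> complex"
  assumes "\<And>b. b \<in> Basis \<Longrightarrow> has_bochner_integral lborel (f b) (v b)"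
  shows "has_bochner_integral lborel (\<lambda>x::'a. \<Prod>b\<in>Basis. f b (x \<bullet> b)) (\<Prod>b\<in>Basis. v b)"
proof -
  interpret product_sigma_finite "\<lambda>b::'a. lborel :: real measure" ..
  let ?T = "\<lambda>f. \<Sum>b\<in>(Basis::'a set). f b *\<^sub>R b"
  let ?P = "\<Pi>\<^sub>M b\<in>(Basis::'a set). (lborel :: real measure)"
  have f: "integrable lborel (f b)" "integral\<^sup>L lborel (f b) = v b" if "b \<in> Basis" for b
    using assms[OF that] by (auto simp: has_bochner_integral_iff)
  have T[measurable]: "?T \<in> measurable ?P borel" by measurable
  have [measurable]: "f b \<in> borel_measurable borel" if "b \<in> Basis" for b
    using f(1)[OF that] by (simp add: borel_measurable_integrable)
  have M: "(\<lambda>x::'a. \<Prod>b\<in>Basis. f b (x \<bullet> b)) \<in> borel_measurable borel" by measurable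
  have eq: "(\<Prod>b\<in>Basis. f b (?T g \<bullet> b)) = (\<Prod>b\<in>Basis. f b (g b))" for g
    by (intro prod.cong refl) (simp add: inner_sum_left_Basis)
  have I: "integrable ?P (\<lambda>g. \<Prod>b\<in>Basis. f b (g b))"
    using f by (intro product_integrable_prod) auto
  have "integrable (lborel :: 'a measure) (\<lambda>x::'a. \<Prod>b\<in>Basis. f b (x \<bullet> b))"
    using I by (subst lborel_eq) (simp add: integrable_distr_eq[OF T M] eq)
  moreover have "integral\<^sup>L (lborel :: 'a measure) (\<lambda>x::'a. \<Prod>b\<in>Basis. f b (x \<bullet> b)) = (\<Prod>b\<in>Basis. v b)"
    using f by (subst lborel_eq) (simp add: integral_distr[OF T M] eq product_integral_prod)
  ultimately show ?thesis by (simp add: has_bochner_integral_iff)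
qed

lemma gaussian_fourier:
  fixes x :: "real^'d" and t :: real
  assumes t: "t > 0"
  shows "has_bochner_integral lborel (\<lambda>w. complex_of_real (exp (- t * (norm w)\<^sup>2)) * cis (w \<bullet> x))
           (complex_of_real ((pi / t) powr (CARD('d) / 2) * exp (- (norm x)\<^sup>2 / (4 * t))))"
proof -
  have nrm: "(norm w)\<^sup>2 = (\<Sum>b\<in>Basis. (w \<bullet> b)\<^sup>2)" for w :: "real^'d"
    unfolding power2_norm_eq_inner by (subst euclidean_inner) (simp add: power2_eq_square)
  have inn: "w \<bullet> x = (\<Sum>b\<in>Basis. (w \<bullet> b) * (x \<bullet> b))" for w :: "real^'d"
    by (rule euclidean_inner)
  have l: "(\<Prod>b\<in>Basis. complex_of_real (exp (- t * (w \<bullet> b)\<^sup>2)) * cis ((w \<bullet> b) * (x \<bullet> b)))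
      = complex_of_real (exp (- t * (norm w)\<^sup>2)) * cis (w \<bullet> x)" for w :: "real^'d"
    by (simp add: prod.distrib prod_cis inn nrm sum_distrib_left exp_sum flip: of_real_prod sum_negf)
  have pw: "sqrt (pi / t) ^ CARD('d) = (pi / t) powr (CARD('d) / 2)"
    using t by (simp add: powr_half_sqrt[symmetric] powr_powr flip: powr_realpow)
  have r: "(\<Prod>b\<in>Basis. complex_of_real (sqrt (pi / t) * exp (- (x \<bullet> b)\<^sup>2 / (4 * t)))) 
     = complex_of_real ((pi / t) powr (CARD('d) / 2) * exp (- (norm x)\<^sup>2 / (4 * t)))"
    unfolding of_real_prod[symmetric] prod.distrib
    by (simp add: pw nrm sum_divide_distrib exp_sum flip: sum_negf)
  show ?thesis
    using has_bochner_integral_lborel_prod[OF gaussian_fourier_1[OF t], of "\<lambda>b. x \<bullet> b"]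
    unfolding l r .
qed

lemma gamma_integral_scaled:
  fixes z a :: real
  assumes "z > 0" "a > 0"
  shows "has_bochner_integral lborel (\<lambda>t. indicator {0<..} t * (t powr (z - 1) * exp (- a * t)))
           (Gamma z / a powr z)"
proof -
  have g: "has_bochner_integral lborel (\<lambda>t. indicator {0..} t * (t powr (z - 1) / exp t)) (Gamma z)"
  proof (rule has_bochner_integral_nn_integral)
    show "(\<integral>\<^sup>+ t. ennreal (indicator {0..} t * (t powr (z - 1) / exp t)) \<partial>lborel) = ennreal (Gamma z)"
      using Gamma_conv_nn_integral_real[OF assms(1)] by simp
  qed (use assms in \<open>auto intro!: less_imp_le[OF Gamma_real_pos]\<close>)
  have "has_bochner_integral lborel (\<lambda>t. indicator {0..} (0 + a * t) * ((0 + a * t) powr (z - 1) / exp (0 + a * t))) (Gamma z /\<^sub>R \<bar>a\<bar>)"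
    using g assms by (subst (asm) lborel_has_bochner_integral_real_affine_iff[of a _ _ 0]) auto
  hence "has_bochner_integral lborel (\<lambda>t. a powr (1 - z) * (indicator {0..} (0 + a * t) * ((0 + a * t) powr (z - 1) / exp (0 + a * t))))
      (a powr (1 - z) * (Gamma z /\<^sub>R \<bar>a\<bar>))"
    by (intro has_bochner_integral_mult_right) auto
  also have "(\<lambda>t. a powr (1 - z) * (indicator {0..} (0 + a * t) * ((0 + a * t) powr (z - 1) / exp (0 + a * t))))
     = (\<lambda>t. indicator {0<..} t * (t powr (z - 1) * exp (- a * t)))"
  proof
    fix t :: real
    have "a powr (1 - z) * (a powr (z - 1) * u) = u" for u
      using assms by (simp add: mult.assoc[symmetric] powr_add[symmetric])
    thus "a powr (1 - z) * (indicator {0..} (0 + a * t) * ((0 + a * t) powr (z - 1) / exp (0 + a * t)))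
     = indicator {0<..} t * (t powr (z - 1) * exp (- a * t))"
      using assms by (cases "t = 0")
        (auto simp: indicator_def powr_mult exp_minus field_simps zero_le_mult_iff)
  qed
  also have "a powr (1 - z) * (Gamma z /\<^sub>R \<bar>a\<bar>) = Gamma z / a powr z"
    using assms by (simp add: powr_diff field_simps)
  finally show ?thesis .
qed

lemma bessel_K_integral:
  fixes \<nu> r :: real
  assumes r: "r > 0"
    and int: "integrable lborel (\<lambda>t. indicator {0<..} t * (t powr (\<nu> - 1) * exp (- t - r\<^sup>2 / (4 * t))))"
  shows "(LINT t|lborel. indicator {0<..} t * (t powr (\<nu> - 1) * exp (- t - r\<^sup>2 / (4 * t))))
           = 2 powr (1 - \<nu>) * (r powr \<nu> * bessel_K \<nu> r)"
proof -
  define F where "F = (\<lambda>t. t powr (\<nu> - 1) * exp (- t - r\<^sup>2 / (4 * t)))"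
  define G where "G = (\<lambda>s. (r/2) powr \<nu> * (exp (\<nu> * s) * exp (- r * cosh s)))"
  define I where "I = (LINT t|lborel. indicator {0<..} t * F t)"
  have F_int: "set_integrable lborel {0<..} F" using int by (simp add: F_def set_integrable_def)
  have F_int': "F absolutely_integrable_on {0<..}" "integral {0<..} F = I"
  proof -
    show 1: "F absolutely_integrable_on {0<..}"
      using F_int unfolding set_integrable_def
      by (subst integrable_completion) (auto simp: borel_measurable_integrable)
    have "I = set_lebesgue_integral lborel {0<..} F" by (simp add: I_def set_lebesgue_integral_def)
    thus "integral {0<..} F = I"
      using set_borel_integral_eq_integral(2)[OF F_int] by simp
  qed
  have img: "range (\<lambda>s. (r/2) * exp s) = {0<..}"
  proof safe
    fix t :: real assume "t > 0"
    hence "t = (r/2) * exp (ln (t / (r/2)))" using r by (simp add: exp_ln)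
    thus "t \<in> range (\<lambda>s. (r/2) * exp s)" by blast
  qed (use r in auto)
  have G_eq: "\<bar>(r/2) * exp s\<bar> * F ((r/2) * exp s) = G s" for s
  proof -
    have "\<bar>(r/2) * exp s\<bar> * ((r/2) * exp s) powr (\<nu> - 1) = ((r/2) * exp s) powr \<nu>"
      using r by (simp add: powr_diff)
    also have "\<dots> = (r/2) powr \<nu> * exp (\<nu> * s)"
      using r by (simp only: powr_mult) (simp add: powr_def mult.commute)
    finally have 1: "\<bar>(r/2) * exp s\<bar> * ((r/2) * exp s) powr (\<nu> - 1) = (r/2) powr \<nu> * exp (\<nu> * s)" .
    have 2: "- ((r/2) * exp s) - r\<^sup>2 / (4 * ((r/2) * exp s)) = - r * cosh s"
      using r by (simp add: cosh_def exp_minus field_simps power2_eq_square)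
    have "\<bar>(r/2) * exp s\<bar> * F ((r/2) * exp s) = (r/2) powr \<nu> * exp (\<nu> * s) * exp (- r * cosh s)"
      unfolding F_def 2 1[symmetric] by (simp only: mult.assoc)
    thus ?thesis by (simp only: G_def mult.assoc)
  qed
  have "(\<lambda>s. \<bar>(r/2) * exp s\<bar> * F ((r/2) * exp s)) absolutely_integrable_on UNIV \<and>
      integral UNIV (\<lambda>s. \<bar>(r/2) * exp s\<bar> * F ((r/2) * exp s)) = I
      \<longleftrightarrow> F absolutely_integrable_on (range (\<lambda>s. (r/2) * exp s)) \<and> integral (range (\<lambda>s. (r/2) * exp s)) F = I"
    by (rule has_absolute_integral_change_of_variables_1'[where g' = "\<lambda>s. (r/2) * exp s"])
       (use r in \<open>auto intro!: derivative_eq_intros injI\<close>)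
  hence G: "G absolutely_integrable_on UNIV" "integral UNIV G = I"
    using F_int' unfolding G_eq img by auto
  have [measurable]: "G \<in> borel_measurable borel" 
    unfolding G_def cosh_def by measurable
  have Gi: "integrable lborel G"
    using G(1) unfolding set_integrable_def by (subst (asm) integrable_completion) auto
  have GI: "(LINT s|lborel. G s) = I"
    using G(2) integral_lborel[OF Gi] by simp
  have Gm: "integrable lborel (\<lambda>s. G (- s))"
    using lborel_integrable_real_affine_iff[of "-1" G 0] Gi by simp
  have ip: "integrable lborel (\<lambda>s. indicator {0<..} s * G s)"
    by (rule Bochner_Integration.integrable_bound[OF Gi]) (auto simp: indicator_def)
  have im: "integrable lborel (\<lambda>s. indicator {0<..} s * G (- s))"
    by (rule Bochner_Integration.integrable_bound[OF Gm]) (auto simp: indicator_def)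
  have im': "integrable lborel (\<lambda>s. indicator {..<0} s * G s)"
    by (rule Bochner_Integration.integrable_bound[OF Gi]) (auto simp: indicator_def)
  have "I = (LINT s|lborel. indicator {0<..} s * G s + indicator {..<0} s * G s)"
    unfolding GI[symmetric]
    by (rule integral_cong_AE) (use AE_lborel_singleton[of "0::real"] in \<open>auto elim!: eventually_mono simp: indicator_def\<close>)
  also have "\<dots> = (LINT s|lborel. indicator {0<..} s * G s) + (LINT s|lborel. indicator {..<0} s * G s)"
    using ip im' by simp
  also have "(LINT s|lborel. indicator {..<0} s * G s) = (LINT s|lborel. indicator {0<..} s * G (- s))"
    by (subst lborel_integral_real_affine[of "-1" _ 0]) (auto simp: indicator_def intro!: Bochner_Integration.integral_cong)
  also have "(LINT s|lborel. indicator {0<..} s * G s) + (LINT s|lborel. indicator {0<..} s * G (- s))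
     = (LINT s|lborel. indicator {0<..} s * G s + indicator {0<..} s * G (- s))"
    using ip im by simp
  also have "\<dots> = (LINT s|lborel. (2 * (r/2) powr \<nu>) * (indicator {0<..} s * (exp (- r * cosh s) * cosh (\<nu> * s))))"
    by (intro Bochner_Integration.integral_cong refl)
       (simp add: G_def cosh_def algebra_simps indicator_def)
  also have "\<dots> = (2 * (r/2) powr \<nu>) * bessel_K \<nu> r"
    by (simp add: bessel_K_def set_lebesgue_integral_def)
  also have "2 * (r/2) powr \<nu> = 2 powr (1 - \<nu>) * r powr \<nu>"
    using r by (simp add: powr_divide powr_diff mult_ac)
  finally show ?thesis by (simp add: I_def F_def mult_ac)
qed

lemma matern_integral:
  fixes m :: real and x :: "real^'d"
  assumes m: "m > real CARD('d) / 2"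
  defines "\<nu> \<equiv> m - real CARD('d) / 2"
  shows "has_bochner_integral lborel (\<lambda>w. complex_of_real (sobolev_weight (- m) w) * cis (w \<bullet> x))
     (complex_of_real (2 powr (1 - \<nu>) * pi powr (real CARD('d) / 2) / Gamma m * matern \<nu> (norm x)))"
proof -
  have \<nu>: "\<nu> > 0" and m0: "m > 0" using m by (auto simp: \<nu>_def intro: le_less_trans[rotated])
  define d where "d = real CARD('d) / 2"
  define H where "H = (\<lambda>(t::real) (w::real^'d). 
     complex_of_real (indicator {0<..} t * (t powr (m - 1) * exp (- t))) * 
     (complex_of_real (exp (- t * (norm w)\<^sup>2)) * cis (w \<bullet> x)))"
  define R where "R = (\<lambda>t::real. indicator {0<..} t * (t powr (\<nu> - 1) * exp (- t - (norm x)\<^sup>2 / (4 * t))))"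
  have cism: "(\<lambda>w::real^'d. cis (w \<bullet> x)) \<in> borel_measurable borel"
    by (intro borel_measurable_continuous_onI continuous_intros)
  have Hm: "case_prod H \<in> borel_measurable (lborel \<Otimes>\<^sub>M lborel)"
    unfolding H_def using cism by measurable
  have inner: "has_bochner_integral lborel (H t) (complex_of_real (pi powr d * R t))" for t
  proof (cases "t > 0")
    case True
    have p: "t powr (m - 1) * (pi / t) powr d = pi powr d * t powr (\<nu> - 1)"
      proof -
      have "\<nu> - 1 = (m - 1) - d" by (simp add: \<nu>_def d_def)
      thus ?thesis using True by (simp add: powr_divide powr_diff mult_ac)
    qed
    have "t powr (m - 1) * exp (- t) * ((pi / t) powr d * exp (- (norm x)\<^sup>2 / (4 * t))) = 
       (t powr (m - 1) * (pi / t) powr d) * exp (- t - (norm x)\<^sup>2 / (4 * t))"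
      by (simp add: exp_diff exp_minus field_simps)
    hence e: "complex_of_real (t powr (m - 1) * exp (- t)) * complex_of_real ((pi / t) powr d * exp (- (norm x)\<^sup>2 / (4 * t)))
        = complex_of_real (pi powr d * R t)"
      unfolding of_real_mult[symmetric] p using True by (simp add: R_def)
    show ?thesis
      using has_bochner_integral_mult_right[OF gaussian_fourier[OF True, of x], of "complex_of_real (t powr (m - 1) * exp (- t))"] True
      unfolding d_def[symmetric] e by (simp add: H_def)
  next
    case False
    thus ?thesis by (simp add: H_def R_def has_bochner_integral_zero)
  qed
  have inner0: "(LINT w|lborel. norm (H t w)) = pi powr d * (indicator {0<..} t * (t powr (\<nu> - 1) * exp (- 1 * t)))" for t
  proof (cases "t > 0")
    case True
    have "integrable lborel (\<lambda>w::real^'d. complex_of_real (exp (- t * (norm w)\<^sup>2)))"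
      "(LINT w|(lborel :: (real^'d) measure). complex_of_real (exp (- t * (norm w)\<^sup>2))) = complex_of_real ((pi / t) powr d)"
      using gaussian_fourier[OF True, of "0 :: real^'d"] by (auto simp: has_bochner_integral_iff d_def)
    hence g: "(LINT w|(lborel :: (real^'d) measure). exp (- t * (norm w)\<^sup>2)) = (pi / t) powr d"
      by (simp only: integral_complex_of_real of_real_eq_iff)
    have "(LINT w|lborel. norm (H t w)) = (LINT w|(lborel :: (real^'d) measure). (t powr (m - 1) * exp (- t)) * exp (- t * (norm w)\<^sup>2))"
      using True by (intro Bochner_Integration.integral_cong) (auto simp: H_def norm_mult)
    also have "\<dots> = (t powr (m - 1) * exp (- t)) * (pi / t) powr d"
      by (simp only: integral_mult_right_zero g)
    also have "\<dots> = pi powr d * (t powr (\<nu> - 1) * exp (- t))"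
    proof -
      have "\<nu> - 1 = (m - 1) - d" by (simp add: \<nu>_def d_def)
      thus ?thesis using True by (simp add: powr_divide powr_diff mult_ac)
    qed
    finally show ?thesis using True by simp
  next
    case False
    thus ?thesis by (simp add: H_def)
  qed
  have HI: "integrable (lborel \<Otimes>\<^sub>M lborel) (case_prod H)"
  proof (rule lborel_pair.Fubini_integrable[OF Hm])
    show "integrable lborel (\<lambda>t. LINT w|lborel. norm (case (t, w) of (t, w) \<Rightarrow> H t w))"
      using gamma_integral_scaled[OF \<nu>, of 1] unfolding prod.case inner0
      by (intro integrable_mult_right) (auto simp: has_bochner_integral_iff)
    show "AE t in lborel. integrable lborel (\<lambda>w. case (t, w) of (t, w) \<Rightarrow> H t w)"
      using inner by (auto simp: has_bochner_integral_iff)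
  qed
  have outer: "(LINT t|lborel. H t w) = complex_of_real (Gamma m) * (complex_of_real (sobolev_weight (- m) w) * cis (w \<bullet> x))" for w
  proof -
    have pos: "1 + (norm w)\<^sup>2 > 0" by (smt (verit) zero_le_power2)
    have "H t w = complex_of_real (indicator {0<..} t * (t powr (m - 1) * exp (- (1 + (norm w)\<^sup>2) * t))) * cis (w \<bullet> x)" for t
    proof -
      have "exp (- (1 + (norm w)\<^sup>2) * t) = exp (- t) * exp (- t * (norm w)\<^sup>2)"
        by (simp add: exp_add[symmetric] algebra_simps)
      thus ?thesis by (simp add: H_def)
    qed
    hence "(LINT t|lborel. H t w) = complex_of_real (Gamma m / (1 + (norm w)\<^sup>2) powr m) * cis (w \<bullet> x)"
      using gamma_integral_scaled[OF m0 pos]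
      by (simp only: integral_mult_left_zero integral_complex_of_real has_bochner_integral_iff)
    thus ?thesis by (simp add: sobolev_weight_def powr_minus divide_inverse)
  qed
  have Gm: "Gamma m > 0" using m0 by (rule Gamma_real_pos)
  have "integrable lborel (\<lambda>w. LINT t|lborel. H t w)"
    using lborel_pair.integrable_snd[OF HI] by simp
  hence 0: "integrable lborel (\<lambda>w. complex_of_real (Gamma m) * (complex_of_real (sobolev_weight (- m) w) * cis (w \<bullet> x)))"
    unfolding outer .
  have "integrable lborel (\<lambda>w. inverse (complex_of_real (Gamma m)) *
          (complex_of_real (Gamma m) * (complex_of_real (sobolev_weight (- m) w) * cis (w \<bullet> x))))"
    by (intro integrable_mult_right 0)
  moreover have "inverse (complex_of_real (Gamma m)) * (complex_of_real (Gamma m) * z) = z" for z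
    using Gm by simp
  ultimately have 1: "integrable lborel (\<lambda>w. complex_of_real (sobolev_weight (- m) w) * cis (w \<bullet> x))"
    by (simp only:)
  have "complex_of_real (Gamma m) * (LINT w|lborel. complex_of_real (sobolev_weight (- m) w) * cis (w \<bullet> x))
       = (LINT w|lborel. LINT t|lborel. H t w)" unfolding outer by simp
  also have "\<dots> = (LINT t|lborel. LINT w|lborel. H t w)" by (rule lborel_pair.Fubini_integral[OF HI])
  also have "\<dots> = (LINT t|lborel. complex_of_real (pi powr d * R t))"
    using inner by (simp add: has_bochner_integral_iff)
  also have "\<dots> = complex_of_real (pi powr d * (LINT t|lborel. R t))" by simp
  also have "(LINT t|lborel. R t) = 2 powr (1 - \<nu>) * matern \<nu> (norm x)"
  proof (cases "x = 0")
    case True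
    have "(LINT t|lborel. R t) = Gamma \<nu>"
      using gamma_integral_scaled[OF \<nu>, of 1] True by (simp add: R_def has_bochner_integral_iff)
    moreover have "2 powr (1 - \<nu>) * 2 powr (\<nu> - 1) = (1::real)" by (simp flip: powr_add)
    ultimately show ?thesis using True by (simp add: matern_def)
  next
    case False
    have "integrable lborel (\<lambda>t. LINT w|lborel. H t w)"
      using lborel_pair.integrable_fst[OF HI] by simp
    hence "integrable lborel (\<lambda>t. complex_of_real (pi powr d * R t))"
      using inner by (simp add: has_bochner_integral_iff)
    hence "integrable lborel R" by (simp add: complex_of_real_integrable_eq del: of_real_mult)
    thus ?thesis using False bessel_K_integral[of "norm x" \<nu>] by (simp add: R_def matern_def)
  qed
  finally have "(LINT w|lborel. complex_of_real (sobolev_weight (- m) w) * cis (w \<bullet> x)) =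
     complex_of_real (2 powr (1 - \<nu>) * pi powr d / Gamma m * matern \<nu> (norm x))"
    using Gm by (simp add: field_simps)
  thus ?thesis using 1 by (simp add: has_bochner_integral_iff d_def)
qed

text \<open>
  The inner product belonging to the norm pairs spectral densities g and k by
  \<open>\<integral> (1 + |\<omega>|\<^sup>2)\<^sup>m g(\<omega>) k(\<omega>)\<^sup>* d\<omega>\<close>, the star denoting complex conjugation.
\<close>

theorem matern_reproducing_kernel:
  fixes m :: real and x :: "real^'d"
  assumes m: "m > real CARD('d) / 2"
  defines "\<nu> \<equiv> m - real CARD('d) / 2"
  defines "c \<equiv> 2 powr (1 - \<nu>) * pi powr (real CARD('d) / 2) / Gamma m"
  defines "k \<equiv> (\<lambda>w. complex_of_real (sobolev_weight (- m) w) * cis (- (w \<bullet> x)))"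
  shows "c > 0"
    and "spectral_density m (\<lambda>y. c * matern \<nu> (norm (y - x))) k"
    and "spectral_density m u g \<Longrightarrow>
           complex_of_real (u x) = (LINT w|lborel. sobolev_weight m w * (g w * cnj (k w)))"
proof -
  have m0: "m > 0" using m by (auto intro: le_less_trans[rotated])
  show c: "c > 0" using Gamma_real_pos[OF m0] by (simp add: c_def)
  have w1: "sobolev_weight m w * sobolev_weight (- m) w = 1" for w :: "real^'d"
  proof -
    have "1 + (norm w)\<^sup>2 > 0" by (smt (verit) zero_le_power2)
    thus ?thesis by (simp add: sobolev_weight_def flip: powr_add)
  qed
  have wm: "(\<lambda>w::real^'d. sobolev_weight (- m) w) \<in> borel_measurable borel"
    unfolding sobolev_weight_def by measurable
  have cism: "(\<lambda>w::real^'d. cis (- (w \<bullet> x))) \<in> borel_measurable borel"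
    by (intro borel_measurable_continuous_onI continuous_intros)
  have pos: "sobolev_weight (- m) w \<ge> 0" for w :: "real^'d" by (simp add: sobolev_weight_def)
  show "spectral_density m (\<lambda>y. c * matern \<nu> (norm (y - x))) k"
    unfolding spectral_density_def
  proof (intro conjI allI)
    show "k \<in> borel_measurable lborel" unfolding k_def using wm cism by measurable
    have "sobolev_weight m w * (cmod (k w))\<^sup>2 = sobolev_weight (- m) w" for w
      using pos[of w] w1[of w] by (simp add: k_def norm_mult power2_eq_square flip: mult.assoc)
    moreover have "integrable lborel (\<lambda>w::real^'d. complex_of_real (sobolev_weight (- m) w))"
      using matern_integral[OF m, of 0] by (simp add: has_bochner_integral_iff)
    ultimately show "integrable lborel (\<lambda>w. sobolev_weight m w * (cmod (k w))\<^sup>2)"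
      by (simp add: complex_of_real_integrable_eq)
  next
    fix y
    have "k w * cis (w \<bullet> y) = complex_of_real (sobolev_weight (- m) w) * cis (w \<bullet> (y - x))" for w
      by (simp add: k_def mult.assoc cis_mult inner_diff_right)
    thus "complex_of_real (c * matern \<nu> (norm (y - x))) = (LINT w|lborel. k w * cis (w \<bullet> y))"
      using matern_integral[OF m, of "y - x"] by (simp add: has_bochner_integral_iff c_def \<nu>_def)
  qed
  have "complex_of_real (sobolev_weight m w) * (g w * cnj (k w)) = g w * cis (w \<bullet> x)" for w
  proof -
    have "complex_of_real (sobolev_weight m w) * complex_of_real (sobolev_weight (- m) w) = 1"
      by (simp add: w1 flip: of_real_mult)
    thus ?thesis by (simp add: k_def cis_cnj mult_ac)
  qed
  thus "complex_of_real (u x) = (LINT w|lborel. sobolev_weight m w * (g w * cnj (k w)))"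
    if "spectral_density m u g"
    using that by (simp only: spectral_density_def)
qed

end

theory Submission
  imports Defs
begin

text \<open>
  Put \<open>\<nu> = m - d/2\<close>, \<open>c = h powr s *\<^sub>R a h - a_hat\<close>, and let u be the representer of the nodal
  functional with weights c on hX, so that its energy \<open>N\<^sup>2\<close> is \<open>\<Sum>j. c $ j * u (h x\<^sub>j)\<close>.
  Optimality of \<open>a h\<close> makes the optimal error functional vanish at u; together with the scaling of
  L this gives \<open>N\<^sup>2 = L v - \<Sum>j. a_hat $ j * v x\<^sub>j\<close> for \<open>v = u (h \<cdot>)\<close>.

  The right-hand side is the error of the exact stencil.  Split v into frequencies below and above 1.
  The high part has norm at most a multiple of \<open>h powr \<nu> * N\<close>.  On the low part, homogeneity forces L
  to see a single homogeneous Taylor part, and exactness on polynomials of order q leaves the bound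
  \<open>\<integral> |g(w)| (h |w|)\<^sup>q dw\<close> over \<open>|w| \<le> 1/h\<close>, where g is the density of u.  If \<open>\<nu> < q\<close>, this is
  estimated by the Cauchy-Schwarz inequality; if \<open>\<nu> \<ge> q\<close>, by
  \<open>|g(w)| \<le> C N (1 + |w|\<^sup>2) powr ((q - 1) / 2 - m)\<close>, which avoids a logarithm in the borderline
  case \<open>\<nu> = q\<close>.  Hence N is at most a multiple of \<open>h powr min \<nu> q\<close>.

  Testing with cut-off monomials bounds the moments of c of degree below q by a multiple of
  \<open>h powr (1 - q) * N\<close>, and by uniqueness of the stencil these moments control c.
\<close>

section \<open>Functions with bounded directional derivatives\<close>

text \<open>The functional \<open>L\<close> is known only through its continuity on the Sobolev
  space over \<Omega>. Each function it is applied to, polynomials and Taylor remainders included,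
  therefore needs an extension to the whole space whose norm is controlled; finitely many bounded
  derivatives provide one, by cutting off and inverting the Fourier transform. A second obstacle is
  that the norm of the error functional is a supremum with no maximiser at hand, so its minimality
  is turned into orthogonality by perturbing test functions.

  The exponent (q - 1) / 2 has its origin in the exponential sum over the nodes, expanded to order
  q. A term of degree l < q is c tested against the power of a linear form and costs |w|^l; the
  remainder costs |c| (h |w|)^q, and the loss h^(1-q) in the bound on |c| together with h |w| \<le>
  1 leaves |w|^(q-1). Multiplication by (h |w|)^q then produces the weight of order -(m - q + 1/2),
  which is integrable for \<nu> \<ge> q.\<close>

text \<open>Iterated partial derivatives up to order n are kept existential, so that no derivative
  operator has to be carried along. One bound M serves all of them. It is asked only on S because
  monomials and ridge functions are unbounded on the whole space; continuity is asked everywhere so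
  that products with a cut-off stay continuous and hence integrable.\<close>

primrec smooth_bdd :: "nat \<Rightarrow> 'a::euclidean_space set \<Rightarrow> real \<Rightarrow> ('a \<Rightarrow> real) \<Rightarrow> bool" where
  "smooth_bdd 0 S M f \<longleftrightarrow> continuous_on UNIV f \<and> (\<forall>x\<in>S. \<bar>f x\<bar> \<le> M)"
| "smooth_bdd (Suc n) S M f \<longleftrightarrow> continuous_on UNIV f \<and> (\<forall>x\<in>S. \<bar>f x\<bar> \<le> M) \<and>
     (\<forall>b\<in>Basis. \<exists>f'. (\<forall>x. ((\<lambda>t. f (x + t *\<^sub>R b)) has_real_derivative f' x) (at 0)) \<and> smooth_bdd n S M f')"

lemma smooth_bdd_bound: "smooth_bdd n S M f \<Longrightarrow> x \<in> S \<Longrightarrow> \<bar>f x\<bar> \<le> M"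
  by (cases n) auto

lemma smooth_bdd_continuous: "smooth_bdd n S M f \<Longrightarrow> continuous_on UNIV f"
  by (cases n) auto

lemma smooth_bdd_mono: "smooth_bdd n S M f \<Longrightarrow> M \<le> M' \<Longrightarrow> smooth_bdd n S M' f"
  by (induction n arbitrary: f) (simp, force, simp, force)

lemma smooth_bdd_Suc: "smooth_bdd (Suc n) S M f \<Longrightarrow> smooth_bdd n S M f"
proof (induction n arbitrary: f)
  case (Suc n)
  show ?case unfolding smooth_bdd.simps(2)[of n]
  proof (intro conjI ballI)
    fix b :: 'a assume b: "b \<in> Basis"
    then obtain f' where "\<forall>x. ((\<lambda>t. f (x + t *\<^sub>R b)) has_real_derivative f' x) (at 0)" "smooth_bdd (Suc n) S M f'"
      using Suc.prems by (subst (asm) smooth_bdd.simps(2)) blast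
    with Suc.IH show "\<exists>f'. (\<forall>x. ((\<lambda>t. f (x + t *\<^sub>R b)) has_real_derivative f' x) (at 0)) \<and> smooth_bdd n S M f'"
      by blast
  qed (use Suc.prems smooth_bdd_bound smooth_bdd_continuous in blast)+
qed simp

lemma smooth_bdd_le: "smooth_bdd n S M f \<Longrightarrow> k \<le> n \<Longrightarrow> smooth_bdd k S M f"
  by (induction n) (auto simp: le_Suc_eq dest: smooth_bdd_Suc simp del: smooth_bdd.simps(2))

lemma smooth_bdd_SucI:
  assumes "continuous_on UNIV f" "\<And>x. x \<in> S \<Longrightarrow> \<bar>f x\<bar> \<le> M"
    and "\<And>b x. b \<in> Basis \<Longrightarrow> ((\<lambda>t. f (x + t *\<^sub>R b)) has_real_derivative D b x) (at 0)"
    and "\<And>b. b \<in> Basis \<Longrightarrow> smooth_bdd n S M (D b)"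
  shows "smooth_bdd (Suc n) S M f"
  using assms by (auto intro!: exI[of _ "D _"])

lemma smooth_bdd_SucE:
  assumes "smooth_bdd (Suc n) S M f"
  obtains D where "continuous_on UNIV f" "\<And>x. x \<in> S \<Longrightarrow> \<bar>f x\<bar> \<le> M"
    and "\<And>b x. b \<in> Basis \<Longrightarrow> ((\<lambda>t. f (x + t *\<^sub>R b)) has_real_derivative D b x) (at 0)"
    and "\<And>b. b \<in> Basis \<Longrightarrow> smooth_bdd n S M (D b)"
proof -
  have "\<exists>D. \<forall>b\<in>Basis. (\<forall>x. ((\<lambda>t. f (x + t *\<^sub>R b)) has_real_derivative D b x) (at 0)) \<and> smooth_bdd n S M (D b)"
    using assms by (subst bchoice_iff[symmetric]) auto
  then show ?thesis using that assms by auto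
qed

lemma smooth_bdd_const: "\<bar>c\<bar> \<le> M \<Longrightarrow> smooth_bdd n S M (\<lambda>_. c)"
proof (induction n arbitrary: c)
  case (Suc n)
  show ?case
    by (rule smooth_bdd_SucI[where D="\<lambda>_ _. 0"]) (use Suc.prems Suc.IH[of 0] in simp_all)
qed auto

lemma smooth_bdd_add:
  "smooth_bdd n S M f \<Longrightarrow> smooth_bdd n S M' g \<Longrightarrow> smooth_bdd n S (M + M') (\<lambda>x. f x + g x)"
proof (induction n arbitrary: f g)
  case 0
  then show ?case by (fastforce intro!: continuous_intros)
next
  case (Suc n)
  obtain D E where D: "\<And>b x. b \<in> Basis \<Longrightarrow> ((\<lambda>t. f (x + t *\<^sub>R b)) has_real_derivative D b x) (at 0)"
      "\<And>b. b \<in> Basis \<Longrightarrow> smooth_bdd n S M (D b)"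
    and E: "\<And>b x. b \<in> Basis \<Longrightarrow> ((\<lambda>t. g (x + t *\<^sub>R b)) has_real_derivative E b x) (at 0)"
      "\<And>b. b \<in> Basis \<Longrightarrow> smooth_bdd n S M' (E b)"
    by (metis Suc.prems smooth_bdd_SucE)
  show ?case
  proof (rule smooth_bdd_SucI[where D="\<lambda>b x. D b x + E b x"])
    show "continuous_on UNIV (\<lambda>x. f x + g x)"
      using Suc.prems[THEN smooth_bdd_continuous] by (intro continuous_intros)
    show "\<bar>f x + g x\<bar> \<le> M + M'" if "x \<in> S" for x
      using Suc.prems[THEN smooth_bdd_bound, OF that] by linarith
    show "((\<lambda>t. f (x + t *\<^sub>R b) + g (x + t *\<^sub>R b)) has_real_derivative D b x + E b x) (at 0)"
      if "b \<in> Basis" for b x by (rule DERIV_add[OF D(1) E(1)]) fact+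
    show "smooth_bdd n S (M + M') (\<lambda>x. D b x + E b x)" if "b \<in> Basis" for b
      by (rule Suc.IH[OF D(2) E(2)]) fact+
  qed
qed

text \<open>The factor \<open>2 ^ n\<close> counts Leibniz terms: each differentiation replaces a
  product by a sum of two products, and \<open>smooth_bdd_add\<close> adds their bounds.\<close>

lemma smooth_bdd_mult:
  assumes "0 \<le> M" "0 \<le> M'"
  shows "smooth_bdd n S M f \<Longrightarrow> smooth_bdd n S M' g \<Longrightarrow> smooth_bdd n S (2 ^ n * (M * M')) (\<lambda>x. f x * g x)"
proof (induction n arbitrary: f g)
  case 0
  then show ?case using assms by (auto intro!: continuous_intros mult_mono simp: abs_mult)
next
  case (Suc n)
  obtain D E where D: "\<And>b x. b \<in> Basis \<Longrightarrow> ((\<lambda>t. f (x + t *\<^sub>R b)) has_real_derivative D b x) (at 0)"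
      "\<And>b. b \<in> Basis \<Longrightarrow> smooth_bdd n S M (D b)"
    and E: "\<And>b x. b \<in> Basis \<Longrightarrow> ((\<lambda>t. g (x + t *\<^sub>R b)) has_real_derivative E b x) (at 0)"
      "\<And>b. b \<in> Basis \<Longrightarrow> smooth_bdd n S M' (E b)"
    using smooth_bdd_SucE[OF Suc.prems(1)] smooth_bdd_SucE[OF Suc.prems(2)] by metis
  have f: "smooth_bdd n S M f" and g: "smooth_bdd n S M' g"
    using Suc.prems by (auto dest: smooth_bdd_Suc simp del: smooth_bdd.simps)
  show ?case
  proof (rule smooth_bdd_SucI[where D="\<lambda>b x. D b x * g x + f x * E b x"])
    show "continuous_on UNIV (\<lambda>x. f x * g x)"
      using Suc.prems[THEN smooth_bdd_continuous] by (intro continuous_intros)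
    show "\<bar>f x * g x\<bar> \<le> 2 ^ Suc n * (M * M')" if "x \<in> S" for x
    proof -
      have "\<bar>f x * g x\<bar> \<le> 1 * (M * M')"
        using Suc.prems[THEN smooth_bdd_bound, OF that] assms by (auto simp: abs_mult intro!: mult_mono)
      also have "\<dots> \<le> 2 ^ Suc n * (M * M')"
        using assms by (intro mult_right_mono one_le_power) auto
      finally show ?thesis .
    qed
    show "((\<lambda>t. f (x + t *\<^sub>R b) * g (x + t *\<^sub>R b)) has_real_derivative D b x * g x + f x * E b x) (at 0)"
      if "b \<in> Basis" for b x
      by (rule DERIV_cong[OF DERIV_mult[OF D(1)[OF that, of x] E(1)[OF that, of x]]]) simp
    show "smooth_bdd n S (2 ^ Suc n * (M * M')) (\<lambda>x. D b x * g x + f x * E b x)" if "b \<in> Basis" for b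
      using smooth_bdd_add[OF Suc.IH[OF D(2)[OF that] g] Suc.IH[OF f E(2)[OF that]]]
      by (simp add: mult_ac)
  qed
qed

text \<open>The bound A on S belongs to the linear form itself, the bound 1 to its constant
  derivatives; \<open>A + 1\<close> covers both and does not depend on w, so the direction may vary
  freely.\<close>

lemma smooth_bdd_inner: "S \<subseteq> cball 0 A \<Longrightarrow> 0 \<le> A \<Longrightarrow> norm w \<le> 1 \<Longrightarrow> smooth_bdd n S (A + 1) (\<lambda>x. w \<bullet> x)"
proof (cases n)
  case 0
  assume *: "S \<subseteq> cball 0 A" "0 \<le> A" "norm w \<le> 1"
  have "\<bar>w \<bullet> x\<bar> \<le> A + 1" if "x \<in> S" for x
    using Cauchy_Schwarz_ineq2[of w x] * that mult_mono[of "norm w" 1 "norm x" A] by auto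
  then show ?thesis using 0 by (auto intro!: continuous_intros)
next
  case (Suc k)
  assume *: "S \<subseteq> cball 0 A" "0 \<le> A" "norm w \<le> 1"
  have "\<bar>w \<bullet> x\<bar> \<le> A + 1" if "x \<in> S" for x
    using Cauchy_Schwarz_ineq2[of w x] * that mult_mono[of "norm w" 1 "norm x" A] by auto
  moreover have "\<bar>w \<bullet> b\<bar> \<le> A + 1" if "b \<in> Basis" for b
    using Basis_le_norm[OF that, of w] * by auto
  ultimately show ?thesis unfolding Suc
    by (intro smooth_bdd_SucI[where D="\<lambda>b x. w \<bullet> b"] smooth_bdd_const)
      (auto intro!: continuous_intros derivative_eq_intros simp: inner_add_right)
qed

lemma smooth_bdd_scale:
  assumes "smooth_bdd n S M f" shows "smooth_bdd n S (\<bar>c\<bar> * M) (\<lambda>x. c * f x)"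
  using assms
proof (induction n arbitrary: f)
  case 0
  then show ?case by (auto intro!: continuous_intros mult_left_mono simp: abs_mult)
next
  case (Suc n)
  obtain D where D: "\<And>b x. b \<in> Basis \<Longrightarrow> ((\<lambda>t. f (x + t *\<^sub>R b)) has_real_derivative D b x) (at 0)"
      "\<And>b. b \<in> Basis \<Longrightarrow> smooth_bdd n S M (D b)"
    by (metis Suc.prems smooth_bdd_SucE)
  show ?case
  proof (rule smooth_bdd_SucI[where D="\<lambda>b x. c * D b x"])
    show "continuous_on UNIV (\<lambda>x. c * f x)"
      using Suc.prems[THEN smooth_bdd_continuous] by (intro continuous_intros)
    show "\<bar>c * f x\<bar> \<le> \<bar>c\<bar> * M" if "x \<in> S" for x
      using smooth_bdd_bound[OF Suc.prems that] by (simp add: abs_mult mult_left_mono)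
    show "((\<lambda>t. c * f (x + t *\<^sub>R b)) has_real_derivative c * D b x) (at 0)"
      if "b \<in> Basis" for b x by (rule DERIV_cmult[OF D(1)]) fact
    show "smooth_bdd n S (\<bar>c\<bar> * M) (\<lambda>x. c * D b x)" if "b \<in> Basis" for b
      by (rule Suc.IH[OF D(2)]) fact
  qed
qed

lemma smooth_bdd_prod:
  assumes "finite I" "\<And>i. i \<in> I \<Longrightarrow> \<exists>M\<ge>0. smooth_bdd n S M (f i)"
  shows "\<exists>M\<ge>0. smooth_bdd n S M (\<lambda>x. \<Prod>i\<in>I. f i x)"
  using assms
proof (induction I rule: finite_induct)
  case empty
  have "smooth_bdd n S 1 (\<lambda>_. 1)" by (rule smooth_bdd_const) simp
  then show ?case unfolding prod.empty by (metis zero_le_one)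
next
  case (insert i I)
  obtain M where "M \<ge> 0" "smooth_bdd n S M (f i)" using insert.prems[of i] by auto
  moreover obtain M' where "M' \<ge> 0" "smooth_bdd n S M' (\<lambda>x. \<Prod>i\<in>I. f i x)"
    using insert.IH insert.prems by (metis insertI2)
  ultimately have "smooth_bdd n S (2 ^ n * (M * M')) (\<lambda>x. f i x * (\<Prod>i\<in>I. f i x))" "0 \<le> 2 ^ n * (M * M')"
    by (auto intro: smooth_bdd_mult)
  then show ?case unfolding prod.insert[OF insert.hyps] by blast
qed

lemma smooth_bdd_sum:
  assumes "finite I" "\<And>i. i \<in> I \<Longrightarrow> \<exists>M\<ge>0. smooth_bdd n S M (f i)"
  shows "\<exists>M\<ge>0. smooth_bdd n S M (\<lambda>x. \<Sum>i\<in>I. f i x)"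
  using assms
proof (induction I rule: finite_induct)
  case empty
  have "smooth_bdd n S 0 (\<lambda>_. 0)" by (rule smooth_bdd_const) simp
  then show ?case unfolding sum.empty by (metis order_refl)
next
  case (insert i I)
  obtain M where "M \<ge> 0" "smooth_bdd n S M (f i)" using insert.prems[of i] by auto
  moreover obtain M' where "M' \<ge> 0" "smooth_bdd n S M' (\<lambda>x. \<Sum>i\<in>I. f i x)"
    using insert.IH insert.prems by (metis insertI2)
  ultimately have "smooth_bdd n S (M + M') (\<lambda>x. f i x + (\<Sum>i\<in>I. f i x))" "0 \<le> M + M'"
    by (auto intro: smooth_bdd_add)
  then show ?case unfolding sum.insert[OF insert.hyps] by blast
qed

lemma smooth_bdd_power:
  assumes "0 \<le> M" "smooth_bdd n S M f"
  shows "smooth_bdd n S (2 ^ (n * k) * M ^ k) (\<lambda>x. f x ^ k)"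
proof (induction k)
  case 0
  show ?case using smooth_bdd_const[of 1 1 n S] by simp
next
  case (Suc k)
  have eq: "2 ^ (n * Suc k) * M ^ Suc k = 2 ^ n * (M * (2 ^ (n * k) * M ^ k))"
    by (simp add: power_add)
  have "0 \<le> 2 ^ (n * k) * M ^ k" using assms(1) by simp
  then show ?case unfolding eq unfolding power_Suc
    by (rule smooth_bdd_mult[OF assms(1) _ assms(2) Suc])
qed

section \<open>Powers of the positive part and the cut-off function\<close>

lemma DERIV_max_0_power:
  "((\<lambda>z::real. max 0 z ^ Suc (Suc n)) has_real_derivative real (Suc (Suc n)) * max 0 z ^ Suc n) (at z)"
proof -
  consider "z < 0" | "z > 0" | "z = 0" by linarith
  then show ?thesis
  proof cases
    case 1
    have "((\<lambda>z::real. 0) has_real_derivative 0) (at z)" by simp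
    then have "((\<lambda>z::real. max 0 z ^ Suc (Suc n)) has_real_derivative 0) (at z)"
      by (rule has_field_derivative_transform_within_open[of _ _ _ "{..<0}"]) (use 1 in \<open>auto simp: max_def\<close>)
    then show ?thesis using 1 by (simp add: max_def)
  next
    case 2
    have "((\<lambda>z::real. z ^ Suc (Suc n)) has_real_derivative real (Suc (Suc n)) * z ^ Suc n) (at z)"
      using DERIV_pow[of "Suc (Suc n)" z] by (simp del: power_Suc)
    then have "((\<lambda>z::real. max 0 z ^ Suc (Suc n)) has_real_derivative real (Suc (Suc n)) * z ^ Suc n) (at z)"
      by (rule has_field_derivative_transform_within_open[of _ _ _ "{0<..}"]) (use 2 in \<open>auto simp: max_def\<close>)
    then show ?thesis using 2 by (simp add: max_def)
  next
    \<comment> \<open>At the kink the difference quotient is \<open>max 0 h ^ Suc n\<close>, which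
      tends to 0 because the exponent is at least 1.\<close>
    case 3
    have "((\<lambda>h::real. max 0 h ^ Suc n) \<longlongrightarrow> max 0 0 ^ Suc n) (at 0)"
      by (intro tendsto_intros)
    moreover have "(max 0 h ^ Suc (Suc n) - 0) / h = max 0 h ^ Suc n" if "h \<noteq> 0" for h :: real
      using that by (auto simp: max_def)
    ultimately have "((\<lambda>h::real. (max 0 h ^ Suc (Suc n) - 0) / h) \<longlongrightarrow> 0) (at 0)"
      by (subst tendsto_cong[of _ "\<lambda>h. max 0 h ^ Suc n"]) (auto simp: eventually_at_filter simp del: power_Suc)
    then show ?thesis using 3 by (simp add: DERIV_def)
  qed
qed

text \<open>Each differentiation lowers the power of the positive part by one, so that the exponent
  \<open>Suc n\<close> still leaves a continuous function after n of them. This yields bumps of any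
  finite smoothness from polynomials and \<open>max\<close>, with elementary bounds.\<close>

lemma smooth_bdd_max_0_power:
  fixes f :: "'a::euclidean_space \<Rightarrow> real"
  assumes "bounded S" "smooth_bdd n S M f"
  shows "\<exists>M\<ge>0. smooth_bdd n S M (\<lambda>x. max 0 (f x) ^ Suc n)"
  using assms(2)
proof (induction n)
  case 0
  have "\<bar>max 0 (f x)\<bar> \<le> \<bar>M\<bar>" if "x \<in> S" for x using smooth_bdd_bound[OF 0 that] by linarith
  then show ?case using 0 by (auto intro!: exI[of _ "\<bar>M\<bar>"] continuous_intros)
next
  case (Suc n)
  obtain D where c: "continuous_on UNIV f" and D: "\<And>b x. b \<in> Basis \<Longrightarrow> ((\<lambda>t. f (x + t *\<^sub>R b)) has_real_derivative D b x) (at 0)"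
      "\<And>b. b \<in> Basis \<Longrightarrow> smooth_bdd n S M (D b)"
    using Suc.prems by (metis smooth_bdd_SucE)
  obtain K where K: "K \<ge> 0" "smooth_bdd n S K (\<lambda>x. max 0 (f x) ^ Suc n)"
    using Suc.IH[OF smooth_bdd_Suc[OF Suc.prems]] by blast
  define K' where "K' = real (Suc (Suc n)) * (2 ^ n * (K * \<bar>M\<bar>))"
  \<comment> \<open>The first entry bounds the function itself, the second its derivatives of order
    at least 1.\<close>
  define B where "B = max (\<bar>M\<bar> ^ Suc (Suc n)) K'"
  have "smooth_bdd (Suc n) S B (\<lambda>x. max 0 (f x) ^ Suc (Suc n))"
  proof (rule smooth_bdd_SucI[where D="\<lambda>b x. real (Suc (Suc n)) * (max 0 (f x) ^ Suc n * D b x)"])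
    show "continuous_on UNIV (\<lambda>x. max 0 (f x) ^ Suc (Suc n))"
      using c by (intro continuous_intros)
    show "\<bar>max 0 (f x) ^ Suc (Suc n)\<bar> \<le> B" if "x \<in> S" for x
    proof -
      have "\<bar>max 0 (f x)\<bar> \<le> \<bar>M\<bar>" using smooth_bdd_bound[OF Suc.prems that] by linarith
      then have "\<bar>max 0 (f x)\<bar> ^ Suc (Suc n) \<le> \<bar>M\<bar> ^ Suc (Suc n)"
        by (rule power_mono) simp
      then show ?thesis unfolding B_def power_abs[symmetric] by (rule max.coboundedI1)
    qed
    fix b :: 'a assume b: "b \<in> Basis"
    show "((\<lambda>t. max 0 (f (x + t *\<^sub>R b)) ^ Suc (Suc n)) has_real_derivative real (Suc (Suc n)) * (max 0 (f x) ^ Suc n * D b x)) (at 0)" for x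
      using DERIV_chain2[OF DERIV_max_0_power[of n "f (x + 0 *\<^sub>R b)"] D(1)[OF b, of x]]
      by (simp add: mult_ac)
    have "smooth_bdd n S (2 ^ n * (K * \<bar>M\<bar>)) (\<lambda>x. max 0 (f x) ^ Suc n * D b x)"
      using K D(2)[OF b] by (intro smooth_bdd_mult) (auto intro: smooth_bdd_mono simp del: power_Suc)
    from smooth_bdd_scale[OF this, of "real (Suc (Suc n))"]
    have "smooth_bdd n S K' (\<lambda>x. real (Suc (Suc n)) * (max 0 (f x) ^ Suc n * D b x))"
      by (simp add: K'_def del: power_Suc)
    then show "smooth_bdd n S B (\<lambda>x. real (Suc (Suc n)) * (max 0 (f x) ^ Suc n * D b x))"
      by (rule smooth_bdd_mono) (simp add: B_def)
  qed
  moreover have "B \<ge> 0" unfolding B_def by (rule max.coboundedI1) simp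
  ultimately show ?case by blast
qed

text \<open>The cut-off is the positive part of 1 - ((|x|^2 - R^2)_+)^(n+1), raised to the power n +
  1. The squared norm is used because it is a polynomial, smooth at the origin too; beyond R + 1 one
  has |x|^2 - R^2 \<ge> 2 R + 1 \<ge> 1, so the outer positive part vanishes.\<close>

lemma smooth_cutoff:
  fixes R :: real
  assumes "0 \<le> R"
  obtains \<psi> :: "'a::euclidean_space \<Rightarrow> real" and M where
    "0 \<le> M" "smooth_bdd n (cball 0 (R + 1)) M \<psi>" "\<And>x. norm x \<le> R \<Longrightarrow> \<psi> x = 1" "\<And>x. norm x > R + 1 \<Longrightarrow> \<psi> x = 0"
proof -
  let ?S = "cball (0::'a) (R + 1)"
  have 1: "\<exists>M\<ge>0. smooth_bdd n ?S M (\<lambda>x::'a. (b \<bullet> x)\<^sup>2)" if "b \<in> Basis" for b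
    using smooth_bdd_power[OF _ smooth_bdd_inner[of ?S "R+1" b n], of 2] assms that
    by (intro exI[of _ "2 ^ (n * 2) * (R + 1 + 1)\<^sup>2"]) auto
  obtain M1 where M1: "smooth_bdd n ?S M1 (\<lambda>x. \<Sum>b\<in>Basis. (b \<bullet> x)\<^sup>2)"
    using smooth_bdd_sum[OF finite_Basis, of n ?S "\<lambda>b x. (b \<bullet> x)\<^sup>2"] 1 by blast
  have n2: "(\<Sum>b\<in>Basis. (b \<bullet> x)\<^sup>2) = (norm x)\<^sup>2" for x :: 'a
    unfolding power2_norm_eq_inner by (subst euclidean_inner) (simp add: power2_eq_square inner_commute)
  from smooth_bdd_add[OF M1 smooth_bdd_const[of "- (R\<^sup>2)" "R\<^sup>2"]]
  have "smooth_bdd n ?S (M1 + R\<^sup>2) (\<lambda>x. (norm x)\<^sup>2 + - (R\<^sup>2))" by (simp add: n2)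
  from smooth_bdd_max_0_power[OF bounded_cball this]
  obtain M2 where "smooth_bdd n ?S M2 (\<lambda>x. max 0 ((norm x)\<^sup>2 + - (R\<^sup>2)) ^ Suc n)" by blast
  from smooth_bdd_add[OF smooth_bdd_const[of 1 1] smooth_bdd_scale[OF this, of "-1"]]
  have "smooth_bdd n ?S (1 + M2) (\<lambda>x. 1 - max 0 ((norm x)\<^sup>2 - R\<^sup>2) ^ Suc n)" by simp
  from smooth_bdd_max_0_power[OF bounded_cball this]
  obtain M where M: "0 \<le> M" "smooth_bdd n ?S M (\<lambda>x. max 0 (1 - max 0 ((norm x)\<^sup>2 - R\<^sup>2) ^ Suc n) ^ Suc n)" by blast
  show ?thesis
  proof (rule that[OF M])
    fix x :: 'a assume "norm x \<le> R"
    then have "(norm x)\<^sup>2 \<le> R\<^sup>2" by (rule power_mono) simp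
    then have "max 0 ((norm x)\<^sup>2 - R\<^sup>2) = 0" by linarith
    then show "max 0 (1 - max 0 ((norm x)\<^sup>2 - R\<^sup>2) ^ Suc n) ^ Suc n = 1" by simp
  next
    fix x :: 'a assume "norm x > R + 1"
    then have "(R + 1)\<^sup>2 \<le> (norm x)\<^sup>2" using assms by (intro power_mono) linarith+
    moreover have "(R + 1)\<^sup>2 = R\<^sup>2 + 2 * R + 1" by (simp add: power2_sum)
    ultimately have "1 \<le> (norm x)\<^sup>2 - R\<^sup>2" using assms by linarith
    then have "1 \<le> max 0 ((norm x)\<^sup>2 - R\<^sup>2) ^ Suc n" by (intro one_le_power) (rule max.coboundedI2)
    then have "max 0 (1 - max 0 ((norm x)\<^sup>2 - R\<^sup>2) ^ Suc n) = 0" by linarith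
    then show "max 0 (1 - max 0 ((norm x)\<^sup>2 - R\<^sup>2) ^ Suc n) ^ Suc n = 0" by simp
  qed
qed

section \<open>The Fourier transform of smooth functions with compact support\<close>

text \<open>Unnormalised, and with the sign opposite to that in \<open>spectral_density\<close>;
  this is why the factor (2 pi)^d appears in \<open>fourier_inversion\<close>.\<close>

definition fourier :: "('a::euclidean_space \<Rightarrow> real) \<Rightarrow> 'a \<Rightarrow> complex" where
  "fourier f w = (LINT x|lborel. complex_of_real (f x) * cis (- (w \<bullet> x)))"

lemma borel_measurable_cis [measurable]:
  "f \<in> borel_measurable M \<Longrightarrow> (\<lambda>x. cis (f x)) \<in> borel_measurable M"
  by (rule borel_measurable_continuous_on[of cis]) (auto intro!: continuous_intros)

lemma integrable_continuous_supp:
  fixes f :: "'a::euclidean_space \<Rightarrow> 'b::{banach, second_countable_topology}"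
  assumes "continuous_on UNIV f" "\<And>x. norm x > A \<Longrightarrow> f x = 0"
  shows "integrable lborel f"
proof -
  have "integrable lborel (\<lambda>x. indicator (cball 0 A) x *\<^sub>R f x)"
    using assms(1) by (intro borel_integrable_compact) (auto intro: continuous_on_subset)
  moreover have "indicator (cball 0 A) x *\<^sub>R f x = f x" for x
    using assms(2)[of x] by (auto simp: indicator_def)
  ultimately show ?thesis by simp
qed

section \<open>Translation invariance and differentiation under the integral\<close>

lemma integral_translate_lborel:
  fixes f :: "'a::euclidean_space \<Rightarrow> 'b::{banach, second_countable_topology}"
  assumes "f \<in> borel_measurable borel"
  shows "(LINT x|lborel. f (x + a)) = (LINT x|lborel. f x)"
proof -
  have "(LINT x|lborel. f x) = (LINT x|distr lborel borel ((+) a). f x)"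
    by (simp only: lborel_distr_plus)
  also have "\<dots> = (LINT x|lborel. f (a + x))"
    using assms by (intro integral_distr) auto
  finally show ?thesis by (simp add: add.commute)
qed

lemma integrable_translate_lborel:
  fixes f :: "'a::euclidean_space \<Rightarrow> 'b::{banach, second_countable_topology}"
  assumes "integrable lborel f"
  shows "integrable lborel (\<lambda>x. f (x + a))"
proof -
  have [measurable]: "f \<in> borel_measurable borel" using assms by auto
  have "integrable (distr lborel borel ((+) a)) f"
    using assms by (simp only: lborel_distr_plus)
  then show ?thesis by (subst (asm) integrable_distr_eq) (auto simp: add.commute)
qed

lemma has_vector_derivative_at_0_iff:
  fixes f :: "real \<Rightarrow> 'b::real_normed_vector"
  shows "(f has_vector_derivative D) (at 0) \<longleftrightarrow> ((\<lambda>t. (1/t) *\<^sub>R (f t - f 0)) \<longlongrightarrow> D) (at 0)"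
proof -
  have e: "norm (f t - f 0 - t *\<^sub>R D) / norm t = norm ((1/t) *\<^sub>R (f t - f 0) - D)" if "t \<noteq> 0" for t
  proof -
    have "(1/t) *\<^sub>R (f t - f 0) - D = (1/t) *\<^sub>R (f t - f 0 - t *\<^sub>R D)"
      using that by (simp add: scaleR_diff_right)
    then show ?thesis by (simp only: norm_scaleR) simp
  qed
  have "(f has_vector_derivative D) (at 0) \<longleftrightarrow> ((\<lambda>t. norm (f t - f 0 - t *\<^sub>R D) / norm t) \<longlongrightarrow> 0) (at 0)"
    unfolding has_vector_derivative_def has_derivative_at by (simp add: bounded_linear_scaleR_left)
  also have "\<dots> \<longleftrightarrow> ((\<lambda>t. norm ((1/t) *\<^sub>R (f t - f 0) - D)) \<longlongrightarrow> 0) (at 0)"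
    by (rule tendsto_cong) (use e in \<open>auto simp: eventually_at_filter\<close>)
  also have "\<dots> \<longleftrightarrow> ((\<lambda>t. (1/t) *\<^sub>R (f t - f 0)) \<longlongrightarrow> D) (at 0)"
    unfolding tendsto_norm_zero_iff by (rule LIM_zero_iff)
  finally show ?thesis .
qed

text \<open>Dominated convergence for the difference quotients along an arbitrary sequence tending
  to 0. The increment bound is linear in t, so w dominates the quotients; since it is assumed only
  for |t| \<le> 1, the sequence is shifted by an index N.\<close>

lemma has_vector_derivative_integral:
  fixes f :: "real \<Rightarrow> 'a \<Rightarrow> complex"
  assumes i: "\<And>t. integrable M (f t)" and [measurable]: "f' \<in> borel_measurable M" and w: "integrable M w"
    and D: "\<And>x. ((\<lambda>t. f t x) has_vector_derivative f' x) (at 0)"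
    and b: "\<And>t x. \<bar>t\<bar> \<le> 1 \<Longrightarrow> cmod (f t x - f 0 x) \<le> \<bar>t\<bar> * w x"
  shows "((\<lambda>t. LINT x|M. f t x) has_vector_derivative (LINT x|M. f' x)) (at 0)"
  unfolding has_vector_derivative_at_0_iff tendsto_at_iff_sequentially o_def
proof (intro allI impI)
  fix X :: "nat \<Rightarrow> real" assume X: "\<forall>i. X i \<in> UNIV - {0}" "X \<longlonglongrightarrow> 0"
  have "\<forall>\<^sub>F i in sequentially. \<bar>X i\<bar> < 1"
    using X(2) by (auto dest: tendstoD[of _ _ _ 1] simp: dist_real_def)
  then obtain N where N: "\<And>i. i \<ge> N \<Longrightarrow> \<bar>X i\<bar> \<le> 1" unfolding eventually_sequentially by (meson less_imp_le)
  have m[measurable]: "f t \<in> borel_measurable M" for t using i[of t] by auto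
  have "(\<lambda>i. LINT x|M. (1 / X (i + N)) *\<^sub>R (f (X (i + N)) x - f 0 x)) \<longlonglongrightarrow> (LINT x|M. f' x)"
  proof (rule integral_dominated_convergence[where w=w])
    show "AE x in M. (\<lambda>i. (1 / X (i + N)) *\<^sub>R (f (X (i + N)) x - f 0 x)) \<longlonglongrightarrow> f' x"
    proof (rule AE_I2)
      fix x
      have "(\<lambda>i. (1 / X i) *\<^sub>R (f (X i) x - f 0 x)) \<longlonglongrightarrow> f' x"
        using D[of x] X unfolding has_vector_derivative_at_0_iff tendsto_at_iff_sequentially o_def by blast
      then show "(\<lambda>i. (1 / X (i + N)) *\<^sub>R (f (X (i + N)) x - f 0 x)) \<longlonglongrightarrow> f' x" by (rule LIMSEQ_ignore_initial_segment)
    qed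
    fix i
    have "X (i + N) \<noteq> 0" using X(1) by auto
    then show "AE x in M. norm ((1 / X (i + N)) *\<^sub>R (f (X (i + N)) x - f 0 x)) \<le> w x"
      using b[OF N[of "i + N"]] by (auto simp: divide_simps mult.commute)
  qed (use w in auto)
  moreover have "(LINT x|M. (1 / t) *\<^sub>R (f t x - f 0 x)) = (1 / t) *\<^sub>R ((LINT x|M. f t x) - (LINT x|M. f 0 x))" for t
    using i by simp
  ultimately have "(\<lambda>k. (1 / X (k + N)) *\<^sub>R ((LINT x|M. f (X (k + N)) x) - (LINT x|M. f 0 x))) \<longlonglongrightarrow> (LINT x|M. f' x)"
    by (simp only:)
  then show "(\<lambda>k. (1 / X k) *\<^sub>R ((LINT x|M. f (X k) x) - (LINT x|M. f 0 x))) \<longlonglongrightarrow> (LINT x|M. f' x)"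
    by (rule LIMSEQ_offset)
qed

text \<open>By translation invariance the integral of G(x + t b) over x is constant in t;
  differentiating it under the integral at t = 0 gives the claim. This takes the place of an
  integration by parts in one coordinate.\<close>

lemma integral_directional_derivative:
  fixes G G' :: "'a::euclidean_space \<Rightarrow> complex"
  assumes G: "continuous_on UNIV G" and G': "continuous_on UNIV G'"
    and supp: "\<And>x. norm x > A \<Longrightarrow> G x = 0" "\<And>x. norm x > A \<Longrightarrow> G' x = 0"
    and D: "\<And>x. ((\<lambda>t. G (x + t *\<^sub>R b)) has_vector_derivative G' x) (at 0)"
    and b: "norm b \<le> 1"
  shows "(LINT x|lborel. G' x) = 0"
proof -
  have [measurable]: "G \<in> borel_measurable borel" "G' \<in> borel_measurable borel"
    using G G' by (auto intro: borel_measurable_continuous_onI)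
  have iG: "integrable lborel G" using G supp(1) by (rule integrable_continuous_supp)
  have "compact (G' ` cball 0 A)"
    using G' by (intro compact_continuous_image) (auto intro: continuous_on_subset)
  from compact_imp_bounded[OF this]
  obtain K where "\<forall>y\<in>G' ` cball 0 A. norm y \<le> K" and K0: "K > 0"
    unfolding bounded_pos by blast
  then have K: "norm (G' x) \<le> K" for x
    using supp(2)[of x] by (cases "norm x \<le> A") auto
  have deriv: "((\<lambda>t. G (x + t *\<^sub>R b)) has_vector_derivative G' (x + t *\<^sub>R b)) (at t)" for x t
  proof -
    have "((\<lambda>s. s - t) has_vector_derivative 1) (at t)"
      by (auto intro!: derivative_eq_intros)
    from vector_diff_chain_at[OF this, of "\<lambda>s. G ((x + t *\<^sub>R b) + s *\<^sub>R b)"] D[of "x + t *\<^sub>R b"]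
    show ?thesis by (simp add: o_def algebra_simps)
  qed
  have lip: "norm (G (x + t *\<^sub>R b) - G x) \<le> K * \<bar>t\<bar>" for x t
  proof -
    have "norm ((\<lambda>t. G (x + t *\<^sub>R b)) t - (\<lambda>t. G (x + t *\<^sub>R b)) 0) \<le> K * norm (t - 0)"
    proof (rule differentiable_bound[of UNIV])
      fix s :: real
      show "((\<lambda>t. G (x + t *\<^sub>R b)) has_derivative (\<lambda>h. h *\<^sub>R G' (x + s *\<^sub>R b))) (at s within UNIV)"
        using deriv[of x s] by (simp add: has_vector_derivative_def)
      show "onorm (\<lambda>h. h *\<^sub>R G' (x + s *\<^sub>R b)) \<le> K"
        using mult_left_mono[OF K[of "x + s *\<^sub>R b"] abs_ge_zero]
        by (intro onorm_le) (simp add: mult.commute)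
    qed auto
    then show ?thesis by simp
  qed
  have "((\<lambda>t. LINT x|lborel. G (x + t *\<^sub>R b)) has_vector_derivative (LINT x|lborel. G' x)) (at 0)"
  proof (rule has_vector_derivative_integral)
    show "integrable lborel (\<lambda>x. G (x + t *\<^sub>R b))" for t by (rule integrable_translate_lborel[OF iG])
    \<comment> \<open>Translations by t b with |t| \<le> 1 and |b| \<le> 1 move the support by at
      most 1, hence the radius A + 1; the height K is the Lipschitz constant of G along b.\<close>
    show "integrable lborel (\<lambda>x. K * indicator (cball (0::'a) (A + 1)) x)"
      by (auto intro!: integrable_mult_right integrable_real_indicator emeasure_bounded_finite)
    fix t :: real and x assume t: "\<bar>t\<bar> \<le> 1"
    show "cmod (G (x + t *\<^sub>R b) - G (x + 0 *\<^sub>R b)) \<le> \<bar>t\<bar> * (K * indicator (cball 0 (A + 1)) x)"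
    proof (cases "norm x \<le> A + 1")
      case True
      then show ?thesis using lip[of x t] by (simp add: mult.commute)
    next
      case False
      have "norm (t *\<^sub>R b) \<le> 1" using b t mult_mono[of "\<bar>t\<bar>" 1 "norm b" 1] by simp
      then have "norm (x + t *\<^sub>R b) > A" using False norm_diff_ineq[of x "t *\<^sub>R b"] by linarith
      then show ?thesis using supp(1) False by simp
    qed
  qed (use D in simp_all)
  moreover have "((\<lambda>t. LINT x|lborel. G (x + t *\<^sub>R b)) has_vector_derivative 0) (at 0)"
    by (simp add: integral_translate_lborel)
  ultimately show ?thesis by (rule vector_derivative_unique_at)
qed

text \<open>The outside of the closed ball is open, so f vanishes near x along the line. The support
  condition thus survives differentiation, which inductions over the order need.\<close>

lemma directional_derivative_supp:
  assumes "\<And>x. norm x > A \<Longrightarrow> f x = 0" "((\<lambda>t. f (x + t *\<^sub>R b)) has_real_derivative D) (at 0)" "norm x > A"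
  shows "D = 0"
proof -
  have "((\<lambda>t. norm (x + t *\<^sub>R b)) \<longlongrightarrow> norm (x + 0 *\<^sub>R b)) (at 0)"
    by (intro tendsto_intros)
  then have "\<forall>\<^sub>F t in at 0. norm (x + t *\<^sub>R b) > A"
    using assms(3) by (auto intro: order_tendstoD)
  then have "\<forall>\<^sub>F t in at 0. f (x + t *\<^sub>R b) = 0"
    by eventually_elim (rule assms(1))
  then have "((\<lambda>t. f (x + t *\<^sub>R b)) has_real_derivative 0) (at 0)"
    by (subst has_field_derivative_cong_eventually[of _ "\<lambda>_. 0"]) (use assms in auto)
  with assms(2) show ?thesis by (rule DERIV_unique)
qed

lemma has_vector_derivative_cis_affine:
  "((\<lambda>t. cis (c + a * t)) has_vector_derivative \<i> * complex_of_real a * cis (c + a * t)) (at t)"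
  unfolding has_vector_derivative_complex_iff by (auto intro!: derivative_eq_intros)

text \<open>The derivative of f(x) cis(-(w.x)) along b is (f' - i (w.b) f) cis(-(w.x)), and its
  integral vanishes by \<open>integral_directional_derivative\<close>.\<close>

lemma fourier_derivative:
  assumes f: "continuous_on UNIV f" "\<And>x. norm x > A \<Longrightarrow> f x = 0"
    and D: "\<And>x. ((\<lambda>t. f (x + t *\<^sub>R b)) has_real_derivative f' x) (at 0)" "continuous_on UNIV f'"
    and b: "norm b \<le> 1"
  shows "fourier f' w = \<i> * complex_of_real (w \<bullet> b) * fourier f w"
proof -
  have f'0: "f' x = 0" if "norm x > A" for x
    by (rule directional_derivative_supp[OF f(2) D(1) that])
  let ?e = "\<lambda>x. cis (- (w \<bullet> x))"
  have i1: "integrable lborel (\<lambda>x. complex_of_real (f' x) * ?e x)"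
    by (rule integrable_continuous_supp[of _ A]) (use D f'0 in \<open>auto intro!: continuous_intros\<close>)
  have i2: "integrable lborel (\<lambda>x. complex_of_real (f x) * ?e x)"
    by (rule integrable_continuous_supp[of _ A]) (use f in \<open>auto intro!: continuous_intros\<close>)
  have "(LINT x|lborel. complex_of_real (f' x) * ?e x - \<i> * complex_of_real (w \<bullet> b) * (complex_of_real (f x) * ?e x)) = 0"
  proof (rule integral_directional_derivative[OF _ _ _ _ _ b])
    show "continuous_on UNIV (\<lambda>x. complex_of_real (f x) * ?e x)"
      by (intro continuous_intros f)
    show "continuous_on UNIV (\<lambda>x. complex_of_real (f' x) * ?e x - \<i> * complex_of_real (w \<bullet> b) * (complex_of_real (f x) * ?e x))"
      by (intro continuous_intros f D)
    fix x
    have "((\<lambda>t. ?e (x + t *\<^sub>R b)) has_vector_derivative \<i> * complex_of_real (- (w \<bullet> b)) * ?e x) (at 0)"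
      using has_vector_derivative_cis_affine[of "- (w \<bullet> x)" "- (w \<bullet> b)" 0]
      by (simp add: inner_add_right mult.commute)
    moreover have "((\<lambda>t. complex_of_real (f (x + t *\<^sub>R b))) has_vector_derivative complex_of_real (f' x)) (at 0)"
      using D(1)[of x] unfolding has_real_derivative_iff_has_vector_derivative
      by (rule bounded_linear.has_vector_derivative[OF bounded_linear_of_real])
    ultimately have "((\<lambda>t. complex_of_real (f (x + t *\<^sub>R b)) * ?e (x + t *\<^sub>R b)) has_vector_derivative
        complex_of_real (f (x + 0 *\<^sub>R b)) * (\<i> * complex_of_real (- (w \<bullet> b)) * ?e x) + complex_of_real (f' x) * ?e (x + 0 *\<^sub>R b)) (at 0)"
      by (intro has_vector_derivative_mult)
    moreover have "complex_of_real (f (x + 0 *\<^sub>R b)) * (\<i> * complex_of_real (- (w \<bullet> b)) * ?e x) + complex_of_real (f' x) * ?e (x + 0 *\<^sub>R b)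
       = complex_of_real (f' x) * ?e x - \<i> * complex_of_real (w \<bullet> b) * (complex_of_real (f x) * ?e x)"
      by simp
    ultimately show "((\<lambda>t. complex_of_real (f (x + t *\<^sub>R b)) * ?e (x + t *\<^sub>R b)) has_vector_derivative
        complex_of_real (f' x) * ?e x - \<i> * complex_of_real (w \<bullet> b) * (complex_of_real (f x) * ?e x)) (at 0)"
      by (simp only:)
  qed (use f f'0 in auto)
  then show ?thesis
    unfolding fourier_def using i1 i2 by simp
qed

text \<open>Each of n derivatives along b puts a factor i (w.b) on the transform. The last
  derivative is bounded by M on the ball and vanishes outside, so its transform is at most M times
  the volume.\<close>

lemma fourier_decay:
  fixes f :: "'a::euclidean_space \<Rightarrow> real"
  assumes "smooth_bdd n (cball 0 A) M f" "\<And>x. norm x > A \<Longrightarrow> f x = 0" "0 \<le> M" "b \<in> Basis"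
  shows "\<bar>w \<bullet> b\<bar> ^ n * cmod (fourier f w) \<le> M * measure lborel (cball (0::'a) A)"
  using assms(1,2)
proof (induction n arbitrary: f)
  case 0
  have i: "integrable lborel (\<lambda>x. complex_of_real (f x) * cis (- (w \<bullet> x)))"
    by (rule integrable_continuous_supp[of _ A]) (use 0 in \<open>auto intro!: continuous_intros\<close>)
  have "cmod (fourier f w) \<le> (LINT x|lborel. cmod (complex_of_real (f x) * cis (- (w \<bullet> x))))"
    unfolding fourier_def by (rule integral_norm_bound)
  also have "\<dots> \<le> (LINT x|lborel. M * indicator (cball (0::'a) A) x)"
  proof (rule integral_mono)
    show "integrable lborel (\<lambda>x. M * indicator (cball (0::'a) A) x)"
      by (auto intro!: integrable_mult_right integrable_real_indicator emeasure_bounded_finite)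
    show "cmod (complex_of_real (f x) * cis (- (w \<bullet> x))) \<le> M * indicator (cball (0::'a) A) x" for x
      using 0 by (cases "norm x \<le> A") (auto simp: norm_mult indicator_def)
  qed (use i in auto)
  also have "\<dots> = M * measure lborel (cball (0::'a) A)" by simp
  finally show ?case by simp
next
  case (Suc n)
  obtain f' where f': "\<And>x. ((\<lambda>t. f (x + t *\<^sub>R b)) has_real_derivative f' x) (at 0)" "smooth_bdd n (cball 0 A) M f'"
    using smooth_bdd_SucE[OF Suc.prems(1)] assms(4) by metis
  have "f' x = 0" if "norm x > A" for x
    by (rule directional_derivative_supp[OF Suc.prems(2) f'(1) that])
  from Suc.IH[OF f'(2) this] have "\<bar>w \<bullet> b\<bar> ^ n * cmod (fourier f' w) \<le> M * measure lborel (cball (0::'a) A)" .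
  moreover have "fourier f' w = \<i> * complex_of_real (w \<bullet> b) * fourier f w"
    using assms(4) Suc.prems(2)
    by (intro fourier_derivative[OF smooth_bdd_continuous[OF Suc.prems(1)] _ f'(1) smooth_bdd_continuous[OF f'(2)]]) auto
  ultimately show ?case by (simp add: norm_mult mult_ac)
qed

section \<open>Affine substitution and Fourier inversion\<close>

lemma integral_affine_lborel:
  fixes f :: "'a::euclidean_space \<Rightarrow> 'b::{banach, second_countable_topology}"
  assumes [measurable]: "f \<in> borel_measurable borel" and c: "c \<noteq> 0"
  shows "(LINT x|lborel. f x) = \<bar>c\<bar> ^ DIM('a) *\<^sub>R (LINT x|lborel. f (a + c *\<^sub>R x))"
proof -
  have "(LINT x|lborel. f x) = (LINT x|density (distr lborel borel (\<lambda>x. a + c *\<^sub>R x)) (\<lambda>_. ennreal (\<bar>c\<bar> ^ DIM('a))). f x)"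
    using lborel_affine[OF c, of a] by (simp add: ennreal_power)
  also have "\<dots> = (LINT x|distr lborel borel (\<lambda>x. a + c *\<^sub>R x). \<bar>c\<bar> ^ DIM('a) *\<^sub>R f x)"
    by (subst integral_density) auto
  also have "\<dots> = \<bar>c\<bar> ^ DIM('a) *\<^sub>R (LINT x|lborel. f (a + c *\<^sub>R x))"
    by (subst integral_distr) auto
  finally show ?thesis .
qed

lemma integrable_affine_lborel:
  fixes f :: "'a::euclidean_space \<Rightarrow> 'b::{banach, second_countable_topology}"
  assumes "integrable lborel f" and c: "c \<noteq> 0"
  shows "integrable lborel (\<lambda>x. f (a + c *\<^sub>R x))"
proof -
  have [measurable]: "f \<in> borel_measurable borel" using assms by auto
  have "integrable (density (distr lborel borel (\<lambda>x. a + c *\<^sub>R x)) (\<lambda>_. ennreal (\<bar>c\<bar> ^ DIM('a)))) f"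
    using lborel_affine[OF c, of a] assms by (simp add: ennreal_power)
  then have "integrable lborel (\<lambda>x. \<bar>c\<bar> ^ DIM('a) *\<^sub>R f (a + c *\<^sub>R x))"
    by (subst (asm) integrable_density) (auto simp: integrable_distr_eq)
  from integrable_scaleR_right[OF this, of "inverse (\<bar>c\<bar> ^ DIM('a))"]
  show ?thesis using c by simp
qed

text \<open>Gaussian summation: with the factor exp(-t |w|^2) inserted, Fubini's theorem turns the
  inverse integral into a convolution of f with a heat kernel, and t \<rightarrow> 0 restores both
  sides. Continuity of f identifies the limit at every point, not only almost everywhere.\<close>

lemma fourier_inversion:
  fixes f :: "real^'d \<Rightarrow> real"
  assumes f: "continuous_on UNIV f" "\<And>x. norm x > A \<Longrightarrow> f x = 0"
    and F: "integrable lborel (fourier f)"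
  shows "complex_of_real ((2 * pi) ^ CARD('d) * f x) = (LINT w|lborel. fourier f w * cis (w \<bullet> x))"
proof -
  let ?d = "real CARD('d) / 2"
  define g where "g = (\<lambda>t (w::real^'d). exp (- t * (norm w)\<^sup>2))"
  have [measurable]: "f \<in> borel_measurable borel"
    using f by (auto intro: borel_measurable_continuous_onI)
  have fm: "fourier f \<in> borel_measurable borel" using F by auto
  have if': "integrable lborel f" using f by (rule integrable_continuous_supp)
  have gm[measurable]: "g t \<in> borel_measurable borel" for t
    unfolding g_def by measurable
  have gi: "integrable lborel (g t)" "(LINT w|lborel. g t w) = (pi / t) powr ?d" if "t > 0" for t
    using gaussian_fourier[OF that, of "0 :: real^'d"]
    by (simp_all add: has_bochner_integral_iff g_def complex_of_real_integrable_eq)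
  have step1: "(LINT w|lborel. complex_of_real (g t w) * (fourier f w * cis (w \<bullet> x)))
     = complex_of_real ((4 * pi) powr ?d * (LINT z|lborel. f (x + (2 * sqrt t) *\<^sub>R z) * g 1 z))" if t: "t > 0" for t
  proof -
    define H where "H = (\<lambda>w y. complex_of_real (g t w) * (complex_of_real (f y) * cis (w \<bullet> (x - y))))"
    have [measurable]: "case_prod H \<in> borel_measurable (lborel \<Otimes>\<^sub>M lborel)"
      unfolding H_def by measurable
    have Hn: "cmod (H w y) = g t w * \<bar>f y\<bar>" for w y by (simp add: H_def norm_mult g_def)
    have HI: "integrable (lborel \<Otimes>\<^sub>M lborel) (case_prod H)"
    proof (rule lborel_pair.Fubini_integrable)
      show "integrable lborel (\<lambda>w. LINT y|lborel. cmod (case (w, y) of (w, y) \<Rightarrow> H w y))"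
        using gi[OF t] by (simp add: Hn)
      have "integrable lborel (H w)" for w
      proof (rule Bochner_Integration.integrable_bound[OF integrable_mult_right[OF integrable_abs[OF if'], of "g t w"]])
        show "H w \<in> borel_measurable lborel" unfolding H_def by measurable
        show "AE y in lborel. norm (H w y) \<le> norm (g t w * \<bar>f y\<bar>)" unfolding Hn by simp
      qed
      then show "AE w in lborel. integrable lborel (\<lambda>y. case (w, y) of (w, y) \<Rightarrow> H w y)" by simp
    qed simp
    have e: "H w y = complex_of_real (g t w) * cis (w \<bullet> x) * (complex_of_real (f y) * cis (- (w \<bullet> y)))" for w y
    proof -
      have "cis (w \<bullet> (x - y)) = cis (w \<bullet> x) * cis (- (w \<bullet> y))" by (simp add: cis_mult inner_diff_right)
      then show ?thesis by (simp add: H_def)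
    qed
    have "(LINT y|lborel. H w y) = complex_of_real (g t w) * (fourier f w * cis (w \<bullet> x))" for w
      by (simp only: e integral_mult_right_zero fourier_def) (simp add: mult_ac)
    then have "(LINT w|lborel. complex_of_real (g t w) * (fourier f w * cis (w \<bullet> x))) = (LINT w|lborel. LINT y|lborel. H w y)"
      by simp
    also have "\<dots> = (LINT y|lborel. LINT w|lborel. H w y)" using lborel_pair.Fubini_integral[OF HI] by simp
    also have "\<dots> = (LINT y|lborel. complex_of_real (f y * ((pi / t) powr ?d * exp (- (norm (x - y))\<^sup>2 / (4 * t)))))"
    proof (rule Bochner_Integration.integral_cong[OF refl])
      fix y
      have "H w y = complex_of_real (f y) * (complex_of_real (exp (- t * (norm w)\<^sup>2)) * cis (w \<bullet> (x - y)))" for w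
        by (simp add: H_def g_def mult_ac)
      then show "(LINT w|lborel. H w y) = complex_of_real (f y * ((pi / t) powr ?d * exp (- (norm (x - y))\<^sup>2 / (4 * t))))"
        using gaussian_fourier[OF t, of "x - y"] by (simp add: has_bochner_integral_iff)
    qed
    also have "\<dots> = complex_of_real (LINT y|lborel. f y * ((pi / t) powr ?d * exp (- (norm (x - y))\<^sup>2 / (4 * t))))"
      by (rule integral_complex_of_real)
    \<comment> \<open>The substitution y = x + 2 sqrt(t) z turns the heat kernel into the fixed
      Gaussian exp(-|z|^2); all powers of t cancel and (4 pi)^(d/2) is left.\<close>
    also have "(LINT y|lborel. f y * ((pi / t) powr ?d * exp (- (norm (x - y))\<^sup>2 / (4 * t))))
       = \<bar>2 * sqrt t\<bar> ^ CARD('d) * (LINT z|lborel. f (x + (2 * sqrt t) *\<^sub>R z) * ((pi / t) powr ?d * exp (- (norm (x - (x + (2 * sqrt t) *\<^sub>R z)))\<^sup>2 / (4 * t))))"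
      using t by (subst integral_affine_lborel[of _ "2 * sqrt t" x]) auto
    also have "\<dots> = (4 * pi) powr ?d * (LINT z|lborel. f (x + (2 * sqrt t) *\<^sub>R z) * g 1 z)"
    proof -
      have "exp (- (norm (x - (x + (2 * sqrt t) *\<^sub>R z)))\<^sup>2 / (4 * t)) = g 1 z" for z
        using t by (simp add: g_def power_mult_distrib)
      then have "f (x + (2 * sqrt t) *\<^sub>R z) * ((pi / t) powr ?d * exp (- (norm (x - (x + (2 * sqrt t) *\<^sub>R z)))\<^sup>2 / (4 * t)))
          = (pi / t) powr ?d * (f (x + (2 * sqrt t) *\<^sub>R z) * g 1 z)" for z
        by (simp only: mult.left_commute)
      moreover have "\<bar>2 * sqrt t\<bar> ^ CARD('d) * (pi / t) powr ?d = (4 * pi) powr ?d"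
      proof -
        have "\<bar>2 * sqrt t\<bar> = (4 * t) powr (1/2)"
          using t by (simp add: powr_half_sqrt real_sqrt_mult)
        moreover have "\<bar>2 * sqrt t\<bar> ^ CARD('d) = \<bar>2 * sqrt t\<bar> powr real CARD('d)"
          using t by (intro powr_realpow[symmetric]) simp
        ultimately have "\<bar>2 * sqrt t\<bar> ^ CARD('d) = (4 * t) powr ?d"
          by (simp only: powr_powr) simp
        moreover have "(4 * t) powr ?d * (pi / t) powr ?d = (4 * t * (pi / t)) powr ?d"
          by (rule powr_mult[symmetric])
        moreover have "4 * t * (pi / t) = 4 * pi" using t by simp
        ultimately show ?thesis by (simp only:)
      qed
      ultimately show ?thesis
        by (simp only: integral_mult_right_zero) (simp only: mult.assoc[symmetric])
    qed
    finally show ?thesis .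
  qed
  define T where "T n = 1 / real (Suc n)" for n
  have T: "T n > 0" "T \<longlonglongrightarrow> 0" for n
    unfolding T_def by (simp, rule LIMSEQ_Suc, rule lim_1_over_n)
  have L: "(\<lambda>n. LINT w|lborel. complex_of_real (g (T n) w) * (fourier f w * cis (w \<bullet> x))) \<longlonglongrightarrow> (LINT w|lborel. fourier f w * cis (w \<bullet> x))"
  proof (rule integral_dominated_convergence[where w="\<lambda>w. cmod (fourier f w)"])
    show "AE w in lborel. (\<lambda>n. complex_of_real (g (T n) w) * (fourier f w * cis (w \<bullet> x))) \<longlonglongrightarrow> fourier f w * cis (w \<bullet> x)"
    proof (rule AE_I2)
      fix w
      have "(\<lambda>n. complex_of_real (exp (- T n * (norm w)\<^sup>2)) * (fourier f w * cis (w \<bullet> x)))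
         \<longlonglongrightarrow> complex_of_real (exp (- 0 * (norm w)\<^sup>2)) * (fourier f w * cis (w \<bullet> x))"
        by (intro tendsto_intros T)
      then show "(\<lambda>n. complex_of_real (g (T n) w) * (fourier f w * cis (w \<bullet> x))) \<longlonglongrightarrow> fourier f w * cis (w \<bullet> x)"
        by (simp add: g_def)
    qed
    show "AE w in lborel. cmod (complex_of_real (g (T n) w) * (fourier f w * cis (w \<bullet> x))) \<le> cmod (fourier f w)" for n
    proof (rule AE_I2)
      fix w
      have "g (T n) w \<le> 1" "0 \<le> g (T n) w" using T(1)[of n] by (auto simp: g_def)
      then show "cmod (complex_of_real (g (T n) w) * (fourier f w * cis (w \<bullet> x))) \<le> cmod (fourier f w)"
        by (simp add: norm_mult mult_left_le_one_le)
    qed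
  qed (use F fm in auto)
  obtain B where B: "\<And>y. \<bar>f y\<bar> \<le> B"
  proof -
    have "compact (f ` cball 0 A)"
      using f by (intro compact_continuous_image) (auto intro: continuous_on_subset)
    from compact_imp_bounded[OF this]
    obtain K where "\<forall>y\<in>f ` cball 0 A. norm y \<le> K" and "K > 0"
      unfolding bounded_pos by blast
    then have K: "\<And>x. x \<in> cball 0 A \<Longrightarrow> norm (f x) \<le> K" "K > 0" by auto
    have "\<bar>f y\<bar> \<le> K" for y using K f(2)[of y] by (cases "norm y \<le> A") auto
    then show ?thesis by (rule that)
  qed
  have R: "(\<lambda>n. LINT z|lborel. f (x + (2 * sqrt (T n)) *\<^sub>R z) * g 1 z) \<longlonglongrightarrow> (LINT z|lborel. f x * g 1 z)"
  proof (rule integral_dominated_convergence[where w="\<lambda>w. B * g 1 w"])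
    show "AE z in lborel. (\<lambda>n. f (x + (2 * sqrt (T n)) *\<^sub>R z) * g 1 z) \<longlonglongrightarrow> f x * g 1 z"
    proof (rule AE_I2)
      fix z
      have "(\<lambda>n. f (x + (2 * sqrt (T n)) *\<^sub>R z)) \<longlonglongrightarrow> f (x + (2 * sqrt 0) *\<^sub>R z)"
        using f(1) by (intro isCont_tendsto_compose[of _ f] tendsto_intros T) (simp add: continuous_on_eq_continuous_at)
      then show "(\<lambda>n. f (x + (2 * sqrt (T n)) *\<^sub>R z) * g 1 z) \<longlonglongrightarrow> f x * g 1 z"
        by (intro tendsto_intros) simp
    qed
    show "AE z in lborel. norm (f (x + (2 * sqrt (T n)) *\<^sub>R z) * g 1 z) \<le> B * g 1 z" for n
      using B by (auto simp: abs_mult g_def)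
  qed (use gi(1)[of 1] in auto)
  have "(\<lambda>n. complex_of_real ((4 * pi) powr ?d * (LINT z|lborel. f (x + (2 * sqrt (T n)) *\<^sub>R z) * g 1 z)))
     \<longlonglongrightarrow> complex_of_real ((4 * pi) powr ?d * (LINT z|lborel. f x * g 1 z))"
    by (intro tendsto_intros R)
  then have "(\<lambda>n. LINT w|lborel. complex_of_real (g (T n) w) * (fourier f w * cis (w \<bullet> x)))
     \<longlonglongrightarrow> complex_of_real ((4 * pi) powr ?d * (LINT z|lborel. f x * g 1 z))"
    by (simp only: step1[OF T(1)])
  from LIMSEQ_unique[OF L this]
  have "(LINT w|lborel. fourier f w * cis (w \<bullet> x)) = complex_of_real ((4 * pi) powr ?d * (f x * pi powr ?d))"
    using gi(2)[of 1] by simp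
  \<comment> \<open>The factor \<open>pi powr ?d\<close> is the integral of exp(-|z|^2).\<close>
  also have "(4 * pi) powr ?d * (f x * pi powr ?d) = (2 * pi) ^ CARD('d) * f x"
  proof -
    have "(4 * pi) powr ?d * pi powr ?d = (4 * pi * pi) powr ?d"
      by (rule powr_mult[symmetric])
    also have "4 * pi * pi = (2 * pi) powr 2" by (simp add: power2_eq_square)
    also have "((2 * pi) powr 2) powr ?d = (2 * pi) powr real CARD('d)" by (simp only: powr_powr) simp
    also have "\<dots> = (2 * pi) ^ CARD('d)" by (simp add: powr_realpow)
    finally show ?thesis by simp
  qed
  finally show ?thesis by simp
qed

section \<open>Spectral energy and the dual norm\<close>

lemma sobolev_weight_pos [simp]: "sobolev_weight m w > 0"
proof -
  have "1 + (norm w)\<^sup>2 > 0" by (smt (verit) zero_le_power2)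
  then show ?thesis by (simp add: sobolev_weight_def)
qed

lemma sobolev_weight_nonneg [simp]: "sobolev_weight m w \<ge> 0"
  using sobolev_weight_pos[of m w] by linarith

lemma sobolev_weight_add: "sobolev_weight (a + b) w = sobolev_weight a w * sobolev_weight b w"
  by (simp add: sobolev_weight_def powr_add)

lemma sobolev_weight_0 [simp]: "sobolev_weight 0 w = 1"
  using sobolev_weight_pos[of 1 w] by (auto simp: sobolev_weight_def)

lemma sobolev_weight_inverse [simp]: "sobolev_weight m w * sobolev_weight (- m) w = 1"
  using sobolev_weight_add[of m "- m" w] by simp

lemma sobolev_weight_mono: "a \<le> b \<Longrightarrow> sobolev_weight a w \<le> sobolev_weight b w"
  by (simp add: sobolev_weight_def powr_mono)

lemma borel_measurable_sobolev_weight [measurable]: "sobolev_weight m \<in> borel_measurable borel"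
  unfolding sobolev_weight_def[abs_def] by measurable

lemma integrable_sobolev_weight:
  assumes "m > real CARD('d) / 2"
  shows "integrable lborel (\<lambda>w::real^'d. sobolev_weight (- m) w)"
  using matern_integral[OF assms, of 0] by (simp add: has_bochner_integral_iff complex_of_real_integrable_eq)

lemma Cauchy_Schwarz_lebesgue:
  fixes f g :: "'a \<Rightarrow> real"
  assumes [measurable]: "f \<in> borel_measurable M" "g \<in> borel_measurable M"
    and f: "integrable M (\<lambda>x. (f x)\<^sup>2)" and g: "integrable M (\<lambda>x. (g x)\<^sup>2)"
  shows "integrable M (\<lambda>x. f x * g x)"
    and "\<bar>LINT x|M. f x * g x\<bar> \<le> sqrt (LINT x|M. (f x)\<^sup>2) * sqrt (LINT x|M. (g x)\<^sup>2)"
proof -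
  have b: "\<bar>f x * g x\<bar> \<le> (f x)\<^sup>2 + (g x)\<^sup>2" for x
  proof -
    have "0 \<le> (\<bar>f x\<bar> - \<bar>g x\<bar>)\<^sup>2" by simp
    then have "2 * (\<bar>f x\<bar> * \<bar>g x\<bar>) \<le> (f x)\<^sup>2 + (g x)\<^sup>2" by (simp add: power2_diff)
    moreover have "\<bar>f x\<bar> * \<bar>g x\<bar> \<ge> 0" by simp
    ultimately show ?thesis unfolding abs_mult by linarith
  qed
  show i: "integrable M (\<lambda>x. f x * g x)"
    by (rule Bochner_Integration.integrable_bound[OF Bochner_Integration.integrable_add[OF f g]]) (use b in auto)
  define a b c where "a = (LINT x|M. (f x)\<^sup>2)" and "b = (LINT x|M. (g x)\<^sup>2)" and "c = (LINT x|M. f x * g x)"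
  have q: "0 \<le> t\<^sup>2 * a - 2 * t * c + b" for t
  proof -
    have "0 \<le> (LINT x|M. (t * f x - g x)\<^sup>2)" by simp
    also have "\<dots> = (LINT x|M. t\<^sup>2 * (f x)\<^sup>2 - 2 * t * (f x * g x) + (g x)\<^sup>2)"
      by (intro Bochner_Integration.integral_cong) (auto simp: power2_diff power_mult_distrib algebra_simps)
    also have "\<dots> = t\<^sup>2 * a - 2 * t * c + b" using f g i by (simp add: a_def b_def c_def)
    finally show ?thesis .
  qed
  have "a \<ge> 0" "b \<ge> 0" by (auto simp: a_def b_def)
  have "c\<^sup>2 \<le> a * b"
  proof (cases "a = 0")
    case True
    have "c = 0"
    proof (rule ccontr)
      assume "c \<noteq> 0"
      \<comment> \<open>With a = 0 the quadratic is affine in t, and this t gives it the value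
        -1.\<close>
      then show False using q[of "(b + 1) / (2 * c)"] True by simp
    qed
    then show ?thesis using \<open>a \<ge> 0\<close> \<open>b \<ge> 0\<close> by simp
  next
    case False
    then have "a > 0" using \<open>a \<ge> 0\<close> by simp
    then have "c\<^sup>2 / a \<le> b" using q[of "c / a"] by (simp add: power2_eq_square field_simps)
    then show ?thesis using \<open>a > 0\<close> by (simp add: field_simps)
  qed
  then have "sqrt (c\<^sup>2) \<le> sqrt (a * b)" by (rule real_sqrt_le_mono)
  then show "\<bar>LINT x|M. f x * g x\<bar> \<le> sqrt (LINT x|M. (f x)\<^sup>2) * sqrt (LINT x|M. (g x)\<^sup>2)"
    by (simp add: a_def b_def c_def real_sqrt_mult)
qed

section \<open>Energy of spectral densities\<close>

definition energy :: "real \<Rightarrow> (real^'d \<Rightarrow> complex) \<Rightarrow> real" where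
  "energy m g = (LINT w|lborel. sobolev_weight m w * (cmod (g w))\<^sup>2)"

definition finite_energy :: "real \<Rightarrow> (real^'d \<Rightarrow> complex) \<Rightarrow> bool" where
  "finite_energy m g \<longleftrightarrow> g \<in> borel_measurable borel \<and>
     integrable lborel (\<lambda>w. sobolev_weight m w * (cmod (g w))\<^sup>2)"

lemma spectral_density_iff:
  "spectral_density m u g \<longleftrightarrow> finite_energy m g \<and> (\<forall>x. complex_of_real (u x) = (LINT w|lborel. g w * cis (w \<bullet> x)))"
  by (auto simp: spectral_density_def finite_energy_def)

lemma spectral_density_finite_energy: "spectral_density m u g \<Longrightarrow> finite_energy m g"
  by (simp add: spectral_density_iff)

lemma spectral_density_integral: "spectral_density m u g \<Longrightarrow> complex_of_real (u x) = (LINT w|lborel. g w * cis (w \<bullet> x))"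
  by (simp add: spectral_density_iff)

lemma energy_nonneg [simp]: "energy m g \<ge> 0"
  unfolding energy_def by (intro Bochner_Integration.integral_nonneg) simp

lemma finite_energy_measurable: "finite_energy m g \<Longrightarrow> g \<in> borel_measurable borel"
  by (simp add: finite_energy_def)

lemma borel_measurable_cnj [measurable (raw)]:
  "f \<in> borel_measurable M \<Longrightarrow> (\<lambda>x. cnj (f x)) \<in> borel_measurable M"
  by (rule borel_measurable_continuous_on[of cnj]) (auto intro!: continuous_intros)

text \<open>The product is split so that g carries the square root of the weight of order m and f
  the square root of the reciprocal weight.\<close>

lemma energy_Cauchy_Schwarz:
  fixes g :: "real^'d \<Rightarrow> complex" and f :: "real^'d \<Rightarrow> real"
  assumes g: "finite_energy m g" and [measurable]: "f \<in> borel_measurable borel"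
    and f: "integrable lborel (\<lambda>w. sobolev_weight (- m) w * (f w)\<^sup>2)"
  shows "integrable lborel (\<lambda>w. cmod (g w) * f w)"
    and "\<bar>LINT w|lborel. cmod (g w) * f w\<bar> \<le> sqrt (energy m g) * sqrt (LINT w|lborel. sobolev_weight (- m) w * (f w)\<^sup>2)"
proof -
  have [measurable]: "g \<in> borel_measurable borel" by (rule finite_energy_measurable[OF g])
  let ?F = "\<lambda>w. sqrt (sobolev_weight m w) * cmod (g w)" and ?G = "\<lambda>w. sqrt (sobolev_weight (- m) w) * f w"
  have 1: "(?F w)\<^sup>2 = sobolev_weight m w * (cmod (g w))\<^sup>2" for w by (simp add: power_mult_distrib)
  have 2: "(?G w)\<^sup>2 = sobolev_weight (- m) w * (f w)\<^sup>2" for w by (simp add: power_mult_distrib)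
  have 3: "?F w * ?G w = cmod (g w) * f w" for w
  proof -
    have "?F w * ?G w = sqrt (sobolev_weight m w * sobolev_weight (- m) w) * (cmod (g w) * f w)"
      by (simp only: real_sqrt_mult) (simp only: mult_ac)
    then show ?thesis by simp
  qed
  have "integrable lborel (\<lambda>w. ?F w * ?G w)"
    by (rule Cauchy_Schwarz_lebesgue) (use f g in \<open>auto simp: 1 2 finite_energy_def\<close>)
  then show "integrable lborel (\<lambda>w. cmod (g w) * f w)" unfolding 3 .
  have "\<bar>LINT w|lborel. ?F w * ?G w\<bar> \<le> sqrt (LINT w|lborel. (?F w)\<^sup>2) * sqrt (LINT w|lborel. (?G w)\<^sup>2)"
    by (rule Cauchy_Schwarz_lebesgue) (use f g in \<open>auto simp: 1 2 finite_energy_def\<close>)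
  then show "\<bar>LINT w|lborel. cmod (g w) * f w\<bar> \<le> sqrt (energy m g) * sqrt (LINT w|lborel. sobolev_weight (- m) w * (f w)\<^sup>2)"
    unfolding 1 2 3 energy_def .
qed

text \<open>This is the core of the Sobolev embedding: m > d/2 makes the weight of order -m
  integrable, so the energy controls the L1 norm of the density and, through
  \<open>spectral_density_bound\<close>, all values of u.\<close>

lemma finite_energy_integrable:
  fixes g :: "real^'d \<Rightarrow> complex"
  assumes m: "m > real CARD('d) / 2" and g: "finite_energy m g"
  shows "integrable lborel g"
    and "(LINT w|lborel. cmod (g w)) \<le> sqrt (LINT w|lborel. sobolev_weight (- m) (w::real^'d)) * sqrt (energy m g)"
proof -
  have "integrable lborel (\<lambda>w. cmod (g w) * 1)"
    by (rule energy_Cauchy_Schwarz(1)[OF g]) (use integrable_sobolev_weight[OF m] in auto)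
  then show "integrable lborel g"
    using finite_energy_measurable[OF g] by (simp add: integrable_norm_iff)
  have "\<bar>LINT w|lborel. cmod (g w) * 1\<bar> \<le> sqrt (energy m g) * sqrt (LINT w|lborel. sobolev_weight (- m) (w::real^'d) * 1\<^sup>2)"
    by (rule energy_Cauchy_Schwarz(2)[OF g]) (use integrable_sobolev_weight[OF m] in auto)
  then show "(LINT w|lborel. cmod (g w)) \<le> sqrt (LINT w|lborel. sobolev_weight (- m) (w::real^'d)) * sqrt (energy m g)"
    by (simp add: mult.commute)
qed

lemma integrable_mult_cis:
  fixes g :: "'a \<Rightarrow> complex"
  assumes "integrable M g" "f \<in> borel_measurable M"
  shows "integrable M (\<lambda>w. g w * cis (f w))"
  by (rule Bochner_Integration.integrable_bound[OF assms(1)]) (use assms in \<open>auto simp: norm_mult\<close>)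

lemma spectral_density_bound:
  fixes u :: "real^'d \<Rightarrow> real"
  assumes m: "m > real CARD('d) / 2" and u: "spectral_density m u g"
  shows "\<bar>u x\<bar> \<le> sqrt (LINT w|lborel. sobolev_weight (- m) (w::real^'d)) * sqrt (energy m g)"
proof -
  have "\<bar>u x\<bar> = cmod (LINT w|lborel. g w * cis (w \<bullet> x))"
    using spectral_density_integral[OF u, of x] by (metis norm_of_real real_norm_def)
  also have "\<dots> \<le> (LINT w|lborel. cmod (g w * cis (w \<bullet> x)))" by (rule integral_norm_bound)
  also have "\<dots> = (LINT w|lborel. cmod (g w))" by (simp add: norm_mult)
  finally show ?thesis
    using finite_energy_integrable(2)[OF m spectral_density_finite_energy[OF u]] by linarith
qed

lemma finite_energy_scale:
  assumes "finite_energy m g"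
  shows "finite_energy m (\<lambda>w. complex_of_real c * g w)" "energy m (\<lambda>w. complex_of_real c * g w) = c\<^sup>2 * energy m g"
proof -
  have [measurable]: "g \<in> borel_measurable borel" by (rule finite_energy_measurable[OF assms])
  have *: "sobolev_weight m w * (cmod (complex_of_real c * g w))\<^sup>2 = c\<^sup>2 * (sobolev_weight m w * (cmod (g w))\<^sup>2)" for w
    by (simp add: norm_mult power_mult_distrib)
  show "finite_energy m (\<lambda>w. complex_of_real c * g w)"
    using assms unfolding finite_energy_def * by auto
  show "energy m (\<lambda>w. complex_of_real c * g w) = c\<^sup>2 * energy m g"
    unfolding energy_def * by simp
qed

lemma finite_energy_inner:
  assumes "finite_energy m g" "finite_energy m k"
  shows "integrable lborel (\<lambda>w. complex_of_real (sobolev_weight m w) * (g w * cnj (k w)))"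
    and "cmod (LINT w|lborel. complex_of_real (sobolev_weight m w) * (g w * cnj (k w))) \<le> sqrt (energy m g) * sqrt (energy m k)"
proof -
  have [measurable]: "g \<in> borel_measurable borel" "k \<in> borel_measurable borel"
    using assms by (auto simp: finite_energy_def)
  have 1: "sobolev_weight (- m) w * (sobolev_weight m w * cmod (k w))\<^sup>2 = sobolev_weight m w * (cmod (k w))\<^sup>2" for w
  proof -
    have "sobolev_weight (- m) w * (sobolev_weight m w * cmod (k w))\<^sup>2 
        = (sobolev_weight m w * sobolev_weight (- m) w) * (sobolev_weight m w * (cmod (k w))\<^sup>2)"
      by (simp only: power2_eq_square mult_ac)
    then show ?thesis by simp
  qed
  have 2: "cmod (complex_of_real (sobolev_weight m w) * (g w * cnj (k w))) = cmod (g w) * (sobolev_weight m w * cmod (k w))" for w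
    by (simp add: norm_mult)
  have I: "integrable lborel (\<lambda>w. cmod (g w) * (sobolev_weight m w * cmod (k w)))"
    by (rule energy_Cauchy_Schwarz[OF assms(1)]) (use assms(2) in \<open>auto simp: 1 finite_energy_def\<close>)
  show "integrable lborel (\<lambda>w. complex_of_real (sobolev_weight m w) * (g w * cnj (k w)))"
    by (rule Bochner_Integration.integrable_bound[OF I]) (auto simp: norm_mult)
  have "cmod (LINT w|lborel. complex_of_real (sobolev_weight m w) * (g w * cnj (k w)))
      \<le> (LINT w|lborel. cmod (complex_of_real (sobolev_weight m w) * (g w * cnj (k w))))" by (rule integral_norm_bound)
  also have "\<dots> = (LINT w|lborel. cmod (g w) * (sobolev_weight m w * cmod (k w)))" unfolding 2 ..
  also have "\<dots> \<le> sqrt (energy m g) * sqrt (LINT w|lborel. sobolev_weight (- m) w * (sobolev_weight m w * cmod (k w))\<^sup>2)"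
    using energy_Cauchy_Schwarz(2)[OF assms(1), of "\<lambda>w. sobolev_weight m w * cmod (k w)"] assms(2)
    unfolding 1 finite_energy_def by auto
  also have "(LINT w|lborel. sobolev_weight (- m) w * (sobolev_weight m w * cmod (k w))\<^sup>2) = energy m k"
    unfolding 1 energy_def ..
  finally show "cmod (LINT w|lborel. complex_of_real (sobolev_weight m w) * (g w * cnj (k w))) \<le> sqrt (energy m g) * sqrt (energy m k)" .
qed

lemma energy_eq_inner:
  "complex_of_real (energy m g) = (LINT w|lborel. complex_of_real (sobolev_weight m w) * (g w * cnj (g w)))"
proof -
  have "complex_of_real (sobolev_weight m w) * (g w * cnj (g w)) = complex_of_real (sobolev_weight m w * (cmod (g w))\<^sup>2)" for w
    by (simp flip: complex_norm_square)
  then show ?thesis unfolding energy_def by (simp only: integral_complex_of_real)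
qed

lemma finite_energy_add_scale:
  assumes "finite_energy m g" "finite_energy m k"
  defines "I \<equiv> (LINT w|lborel. complex_of_real (sobolev_weight m w) * (g w * cnj (k w)))"
  shows "finite_energy m (\<lambda>w. g w + complex_of_real \<kappa> * k w)"
    and "energy m (\<lambda>w. g w + complex_of_real \<kappa> * k w) = energy m g + 2 * \<kappa> * Re I + \<kappa>\<^sup>2 * energy m k"
proof -
  have [measurable]: "g \<in> borel_measurable borel" "k \<in> borel_measurable borel"
    using assms by (auto simp: finite_energy_def)
  have e: "sobolev_weight m w * (cmod (g w + complex_of_real \<kappa> * k w))\<^sup>2 =
     sobolev_weight m w * (cmod (g w))\<^sup>2 + 2 * \<kappa> * Re (complex_of_real (sobolev_weight m w) * (g w * cnj (k w)))
       + \<kappa>\<^sup>2 * (sobolev_weight m w * (cmod (k w))\<^sup>2)" for w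
    unfolding cmod_power2 by (simp add: algebra_simps power2_eq_square)
  have i: "integrable lborel (\<lambda>w. Re (complex_of_real (sobolev_weight m w) * (g w * cnj (k w))))"
    by (rule integrable_Re[OF finite_energy_inner(1)[OF assms(1,2)]])
  have i1: "integrable lborel (\<lambda>w. sobolev_weight m w * (cmod (g w))\<^sup>2)" "integrable lborel (\<lambda>w. sobolev_weight m w * (cmod (k w))\<^sup>2)"
    using assms(1,2) by (auto simp: finite_energy_def)
  show "finite_energy m (\<lambda>w. g w + complex_of_real \<kappa> * k w)"
    unfolding finite_energy_def e using i i1 by simp
  have "Re I = (LINT w|lborel. Re (complex_of_real (sobolev_weight m w) * (g w * cnj (k w))))"
    unfolding I_def by (rule integral_Re[OF finite_energy_inner(1)[OF assms(1,2)], symmetric])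
  then show "energy m (\<lambda>w. g w + complex_of_real \<kappa> * k w) = energy m g + 2 * \<kappa> * Re I + \<kappa>\<^sup>2 * energy m k"
    unfolding energy_def e using i i1 by simp
qed

lemma spectral_density_scale:
  assumes u: "spectral_density m u g"
  shows "spectral_density m (\<lambda>x. c * u x) (\<lambda>w. complex_of_real c * g w)"
  unfolding spectral_density_iff
proof (intro conjI allI)
  show "finite_energy m (\<lambda>w. complex_of_real c * g w)"
    by (intro finite_energy_scale spectral_density_finite_energy[OF u])
  show "complex_of_real (c * u x) = (LINT w|lborel. complex_of_real c * g w * cis (w \<bullet> x))" for x
    using spectral_density_integral[OF u, of x] by (simp add: mult.assoc)
qed

lemma spectral_density_add:
  fixes u :: "real^'d \<Rightarrow> real"
  assumes m: "m > real CARD('d) / 2" and u: "spectral_density m u g" and v: "spectral_density m v k"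
  shows "spectral_density m (\<lambda>x. u x + \<kappa> * v x) (\<lambda>w. g w + complex_of_real \<kappa> * k w)"
  unfolding spectral_density_iff
proof (intro conjI allI)
  note fe = spectral_density_finite_energy[OF u] spectral_density_finite_energy[OF v]
  show "finite_energy m (\<lambda>w. g w + complex_of_real \<kappa> * k w)"
    by (intro finite_energy_add_scale fe)
  fix x
  have "integrable lborel (\<lambda>w. g w * cis (w \<bullet> x))" "integrable lborel (\<lambda>w. k w * cis (w \<bullet> x))"
    by (intro integrable_mult_cis finite_energy_integrable[OF m] fe; simp)+
  then show "complex_of_real (u x + \<kappa> * v x) = (LINT w|lborel. (g w + complex_of_real \<kappa> * k w) * cis (w \<bullet> x))"
    using spectral_density_integral[OF u, of x] spectral_density_integral[OF v, of x]
    by (simp add: distrib_right mult.assoc)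
qed

lemma spectral_density_zero: "spectral_density m (\<lambda>_. 0) (\<lambda>_. 0)"
  by (simp add: spectral_density_iff finite_energy_def)

lemma spectral_density_sum:
  fixes u :: "'i \<Rightarrow> real^'d \<Rightarrow> real"
  assumes m: "m > real CARD('d) / 2" and "finite I" "\<And>i. i \<in> I \<Longrightarrow> spectral_density m (u i) (g i)"
  shows "spectral_density m (\<lambda>x. \<Sum>i\<in>I. c i * u i x) (\<lambda>w. \<Sum>i\<in>I. complex_of_real (c i) * g i w)"
  using assms(2,3)
proof (induction I rule: finite_induct)
  case empty
  then show ?case by (simp add: spectral_density_zero)
next
  case (insert i I)
  have "spectral_density m (\<lambda>x. (\<Sum>i\<in>I. c i * u i x) + c i * u i x) (\<lambda>w. (\<Sum>i\<in>I. complex_of_real (c i) * g i w) + complex_of_real (c i) * g i w)"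
    using insert by (intro spectral_density_add[OF m]) auto
  then show ?case using insert.hyps by (simp add: add.commute)
qed

lemma sobolev_space_lincomb:
  fixes u :: "real^'d \<Rightarrow> real"
  assumes m: "m > real CARD('d) / 2" and "u \<in> sobolev_space m" "v \<in> sobolev_space m"
  shows "(\<lambda>x. a * u x + b * v x) \<in> sobolev_space m"
proof -
  obtain g k where "spectral_density m u g" "spectral_density m v k"
    using assms unfolding sobolev_space_def by auto
  then have "spectral_density m (\<lambda>x. a * u x + b * v x) (\<lambda>w. complex_of_real a * g w + complex_of_real b * k w)"
    by (intro spectral_density_add[OF m] spectral_density_scale)
  then show ?thesis unfolding sobolev_space_def by blast
qed

section \<open>Sobolev norm and dual norm through densities\<close>

lemma sobolev_norm_eq: "sobolev_norm m u = Inf {sqrt (energy m g) |g. spectral_density m u g}"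
  by (simp add: sobolev_norm_def energy_def)

lemma sobolev_norm_le: "spectral_density m u g \<Longrightarrow> sobolev_norm m u \<le> sqrt (energy m g)"
  unfolding sobolev_norm_eq by (intro cInf_lower bdd_belowI[of _ 0]) auto

lemma sobolev_norm_nonneg: "u \<in> sobolev_space m \<Longrightarrow> 0 \<le> sobolev_norm m u"
  unfolding sobolev_norm_eq by (intro cInf_greatest) (auto simp: sobolev_space_def)

text \<open>The norm is an infimum over densities, so an estimate valid for every density passes to
  it. The case K = 0 is separate because the proof divides by K.\<close>

lemma le_sobolev_norm:
  assumes "u \<in> sobolev_space m" "0 \<le> K" "\<And>g. spectral_density m u g \<Longrightarrow> y \<le> K * sqrt (energy m g)"
  shows "y \<le> K * sobolev_norm m u"
proof (cases "K = 0")
  case True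
  then show ?thesis using assms by (auto simp: sobolev_space_def)
next
  case False
  then have K: "K > 0" using assms by simp
  have "y / K \<le> sobolev_norm m u"
    unfolding sobolev_norm_eq
    by (intro cInf_greatest) (use assms K in \<open>auto simp: sobolev_space_def field_simps\<close>)
  then show ?thesis using K by (simp add: field_simps)
qed

text \<open>Boundedness is recorded next to the estimate because a supremum of reals is informative
  only over a bounded nonempty set; the zero function provides nonemptiness.\<close>

lemma sobolev_dual_norm_le:
  fixes F :: "(real^'d \<Rightarrow> real) \<Rightarrow> real"
  assumes K: "0 \<le> K" "\<And>u g. spectral_density m u g \<Longrightarrow> \<bar>F u\<bar> \<le> K * sqrt (energy m g)"
  shows "sobolev_dual_norm m F \<le> K" and "bdd_above {\<bar>F u\<bar> |u. u \<in> sobolev_space m \<and> sobolev_norm m u \<le> 1}"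
proof -
  have *: "\<bar>F u\<bar> \<le> K" if "u \<in> sobolev_space m" "sobolev_norm m u \<le> 1" for u
  proof -
    have "\<bar>F u\<bar> \<le> K * sobolev_norm m u" by (rule le_sobolev_norm[OF that(1)]) (use K in auto)
    also have "\<dots> \<le> K * 1" using K that by (intro mult_left_mono) auto
    finally show ?thesis by simp
  qed
  then show "bdd_above {\<bar>F u\<bar> |u. u \<in> sobolev_space m \<and> sobolev_norm m u \<le> 1}" by (auto intro!: bdd_aboveI[of _ K])
  have "(\<lambda>_::real^'d. 0) \<in> sobolev_space m" using spectral_density_zero by (auto simp: sobolev_space_def)
  moreover have "sobolev_norm m (\<lambda>_::real^'d. 0) \<le> 1"
  proof -
    have "sobolev_norm m (\<lambda>_::real^'d. 0) \<le> sqrt (energy m (\<lambda>_::real^'d. 0))"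
      by (rule sobolev_norm_le[OF spectral_density_zero])
    also have "\<dots> = 0" by (simp add: energy_def)
    finally show ?thesis by linarith
  qed
  ultimately show "sobolev_dual_norm m F \<le> K"
    unfolding sobolev_dual_norm_def using * by (intro cSup_least) auto
qed

text \<open>Scaling u to energy 1 puts it into the unit ball over which the supremum is taken. The
  constant K makes this supremum finite and settles densities of energy 0, which cannot be
  scaled.\<close>

lemma le_sobolev_dual_norm:
  assumes K: "0 \<le> K" "\<And>u g. spectral_density m u g \<Longrightarrow> \<bar>F u\<bar> \<le> K * sqrt (energy m g)"
    and hom: "\<And>u c. u \<in> sobolev_space m \<Longrightarrow> F (\<lambda>x. c * u x) = c * F u"
    and u: "spectral_density m u g"
  shows "\<bar>F u\<bar> \<le> sobolev_dual_norm m F * sqrt (energy m g)"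
proof (cases "energy m g = 0")
  case True
  then show ?thesis using K(2)[OF u] by simp
next
  case False
  then have e: "energy m g > 0" using energy_nonneg[of m g] by linarith
  let ?c = "inverse (sqrt (energy m g))"
  have s: "spectral_density m (\<lambda>x. ?c * u x) (\<lambda>w. complex_of_real ?c * g w)"
    by (rule spectral_density_scale[OF u])
  have "energy m (\<lambda>w. complex_of_real ?c * g w) = ?c\<^sup>2 * energy m g"
    by (rule finite_energy_scale[OF spectral_density_finite_energy[OF u]])
  also have "\<dots> = 1" using e by (simp add: power_inverse)
  finally have "sobolev_norm m (\<lambda>x. ?c * u x) \<le> 1" using sobolev_norm_le[OF s] by simp
  then have "\<bar>F (\<lambda>x. ?c * u x)\<bar> \<le> sobolev_dual_norm m F"
    unfolding sobolev_dual_norm_def using s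
    by (intro cSup_upper sobolev_dual_norm_le[OF K]) (auto simp: sobolev_space_def)
  moreover have "F (\<lambda>x. ?c * u x) = ?c * F u" using u by (intro hom) (auto simp: sobolev_space_def)
  ultimately have "?c * \<bar>F u\<bar> \<le> sobolev_dual_norm m F" using e by (simp add: abs_mult)
  then have "sqrt (energy m g) * (?c * \<bar>F u\<bar>) \<le> sqrt (energy m g) * sobolev_dual_norm m F"
    by (rule mult_left_mono) simp
  moreover have "sqrt (energy m g) * (?c * \<bar>F u\<bar>) = \<bar>F u\<bar>" using e by simp
  ultimately show ?thesis by (simp only: mult.commute)
qed

section \<open>From minimality to orthogonality\<close>

lemma exists_sign_aligned:
  fixes A p e :: real
  assumes "p \<ge> 0"
  shows "\<exists>\<sigma>. \<bar>\<sigma>\<bar> = p \<and> \<bar>A\<bar> + p * \<bar>e\<bar> = \<bar>A + \<sigma> * e\<bar>"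
proof -
  have "\<bar>A\<bar> + p * \<bar>e\<bar> = \<bar>A + t\<bar>" if "t = (if A < 0 then - (p * \<bar>e\<bar>) else p * \<bar>e\<bar>)" for t
    using mult_nonneg_nonneg[OF assms abs_ge_zero[of e]] that by (auto split: if_splits)
  moreover have "(if A < 0 then - (p * \<bar>e\<bar>) else p * \<bar>e\<bar>) = ((if A < 0 then - 1 else 1) * (if e < 0 then - 1 else 1) * p) * e"
    by auto
  ultimately show ?thesis using assms
    by (intro exI[of _ "(if A < 0 then - 1 else 1) * (if e < 0 then - 1 else 1) * p"]) auto
qed

text \<open>
  Adding \<open>\<kappa> u0\<close> to the component of a test function orthogonal to u0 changes the value of F to
  first order in \<open>\<kappa>\<close>, but the norm of the test function only to second order.
\<close>

lemma dual_norm_minimizer_orthogonal: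
  fixes u0 :: "real^'d \<Rightarrow> real"
  assumes m: "m > real CARD('d) / 2"
    and lin: "\<And>u v a b. u \<in> sobolev_space m \<Longrightarrow> v \<in> sobolev_space m \<Longrightarrow>
        F (\<lambda>x. a * u x + b * v x) = a * F u + b * F v"
    and K: "0 \<le> K" "\<And>u g. spectral_density m u g \<Longrightarrow> \<bar>F u\<bar> \<le> K * sqrt (energy m g)"
    and u0: "spectral_density m u0 k"
    and rep: "\<And>v g. spectral_density m v g \<Longrightarrow>
        complex_of_real (\<Lambda> v) = (LINT w|lborel. complex_of_real (sobolev_weight m w) * (g w * cnj (k w)))"
    and min: "\<And>\<tau>. sobolev_dual_norm m F \<le> sobolev_dual_norm m (\<lambda>u. F u - \<tau> * \<Lambda> u)"
  shows "F u0 = 0"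
proof (cases "energy m k = 0")
  case True
  then show ?thesis using K(2)[OF u0] by simp
next
  case False
  define U where "U = energy m k"
  have U: "U > 0" using False energy_nonneg[of m k] unfolding U_def by linarith
  define e where "e = F u0"
  define D where "D = sobolev_dual_norm m F"
  have fk: "finite_energy m k" by (rule spectral_density_finite_energy[OF u0])
  have D: "\<bar>F v\<bar> \<le> D * sqrt (energy m g)" if "spectral_density m v g" for v g
    unfolding D_def
  proof (rule le_sobolev_dual_norm[OF K _ that])
    fix u :: "real^'d \<Rightarrow> real" and c assume "u \<in> sobolev_space m"
    then show "F (\<lambda>x. c * u x) = c * F u" using lin[of u u c 0] by simp
  qed
  have "0 \<le> D * sqrt U" using D[OF u0] by (simp add: U_def)
  then have D0: "0 \<le> D" using U by (simp add: zero_le_mult_iff)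
  have u0s: "u0 \<in> sobolev_space m" using u0 by (auto simp: sobolev_space_def)
  \<comment> \<open>The component of v orthogonal to u0 is v - \<beta> u0 with \<beta> = \<Lambda> v
    / U, and F takes the value F v - (e / U) \<Lambda> v on it. Adding \<sigma> u0 with |\<sigma>| =
    \<kappa> r and the favourable sign raises the absolute value by \<kappa> r |e|, while the energy
    is at most r^2 + \<sigma>^2 U.\<close>
  have key: "\<bar>F v - e / U * \<Lambda> v\<bar> + \<kappa> * sqrt (energy m g) * \<bar>e\<bar> \<le> D * (1 + \<kappa>\<^sup>2 * U / 2) * sqrt (energy m g)"
    if v: "spectral_density m v g" and \<kappa>: "\<kappa> > 0" for v g \<kappa>
  proof -
    define \<beta> where "\<beta> = \<Lambda> v / U"
    define r where "r = sqrt (energy m g)"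
    have fg: "finite_energy m g" by (rule spectral_density_finite_energy[OF v])
    have vs: "v \<in> sobolev_space m" using v by (auto simp: sobolev_space_def)
    have Re: "Re (LINT w|lborel. complex_of_real (sobolev_weight m w) * (g w * cnj (k w))) = \<beta> * U"
      using rep[OF v] U by (metis Re_complex_of_real \<beta>_def nonzero_eq_divide_eq order_less_irrefl)
    have "\<bar>F v - e / U * \<Lambda> v\<bar> + \<kappa> * r * \<bar>e\<bar> \<le> D * sqrt (r\<^sup>2 + (\<kappa> * r)\<^sup>2 * U)"
    proof -
      obtain \<sigma> where \<sigma>: "\<bar>\<sigma>\<bar> = \<kappa> * r" "\<bar>F v - e / U * \<Lambda> v\<bar> + \<kappa> * r * \<bar>e\<bar> = \<bar>(F v - e / U * \<Lambda> v) + \<sigma> * e\<bar>"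
        using exists_sign_aligned[of "\<kappa> * r" "F v - e / U * \<Lambda> v" e] \<kappa> by (auto simp: r_def)
      let ?c = "\<sigma> - \<beta>"
      have s: "spectral_density m (\<lambda>x. v x + ?c * u0 x) (\<lambda>w. g w + complex_of_real ?c * k w)"
        by (rule spectral_density_add[OF m v u0])
      have "energy m (\<lambda>w. g w + complex_of_real ?c * k w) = r\<^sup>2 + 2 * ?c * (\<beta> * U) + ?c\<^sup>2 * U"
        using finite_energy_add_scale(2)[OF fg fk, of ?c] unfolding Re U_def[symmetric] by (simp add: r_def)
      also have "\<dots> = r\<^sup>2 + \<sigma>\<^sup>2 * U - \<beta>\<^sup>2 * U" by (simp add: power2_eq_square algebra_simps)
      also have "\<dots> \<le> r\<^sup>2 + \<sigma>\<^sup>2 * U" using U by simp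
      finally have E: "energy m (\<lambda>w. g w + complex_of_real ?c * k w) \<le> r\<^sup>2 + (\<kappa> * r)\<^sup>2 * U"
        unfolding \<sigma>(1)[symmetric] by simp
      have "F (\<lambda>x. v x + ?c * u0 x) = F v + ?c * e"
        using lin[OF vs u0s, of 1 ?c] by (simp add: e_def)
      also have "\<dots> = (F v - e / U * \<Lambda> v) + \<sigma> * e" by (simp add: \<beta>_def algebra_simps)
      finally have "\<bar>(F v - e / U * \<Lambda> v) + \<sigma> * e\<bar> \<le> D * sqrt (energy m (\<lambda>w. g w + complex_of_real ?c * k w))"
        using D[OF s] by simp
      also have "\<dots> \<le> D * sqrt (r\<^sup>2 + (\<kappa> * r)\<^sup>2 * U)" using D0 E by (intro mult_left_mono) auto
      finally show ?thesis unfolding \<sigma>(2) .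
    qed
    \<comment> \<open>This is sqrt(1 + z) \<le> 1 + z / 2: the norm grows only to second order in
      \<kappa>.\<close>
    also have "sqrt (r\<^sup>2 + (\<kappa> * r)\<^sup>2 * U) \<le> (1 + \<kappa>\<^sup>2 * U / 2) * r"
    proof (rule real_le_lsqrt)
      show "0 \<le> (1 + \<kappa>\<^sup>2 * U / 2) * r" using U by (simp add: r_def)
      have "((1 + \<kappa>\<^sup>2 * U / 2) * r)\<^sup>2 = r\<^sup>2 + (\<kappa> * r)\<^sup>2 * U + (\<kappa>\<^sup>2 * U / 2 * r)\<^sup>2"
        by (simp add: power2_eq_square algebra_simps)
      then show "r\<^sup>2 + (\<kappa> * r)\<^sup>2 * U \<le> ((1 + \<kappa>\<^sup>2 * U / 2) * r)\<^sup>2" by simp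
    qed
    finally show ?thesis using D0 by (simp add: r_def mult_left_mono mult.assoc)
  qed
  \<comment> \<open>By \<open>key\<close> the competitor with \<tau> = e / U has dual norm at most
    \<open>?K\<close>, which is D plus a term of order \<kappa>^2 minus \<kappa> |e|; minimality
    excludes \<open>?K\<close> < D.\<close>
  have small: "\<bar>e\<bar> \<le> D * U / 2 * \<kappa>" if \<kappa>: "\<kappa> > 0" for \<kappa>
  proof -
    let ?K = "D * (1 + \<kappa>\<^sup>2 * U / 2) - \<kappa> * \<bar>e\<bar>"
    have b: "\<bar>F v - e / U * \<Lambda> v\<bar> \<le> ?K * sqrt (energy m g)" if "spectral_density m v g" for v g
      using key[OF that \<kappa>] by (simp add: algebra_simps)
    have "0 \<le> ?K * sqrt U" using b[OF u0] by (simp add: U_def)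
    then have K0: "0 \<le> ?K" using U by (simp add: zero_le_mult_iff)
    have "D \<le> ?K" unfolding D_def
      by (rule order_trans[OF min[of "e / U"] sobolev_dual_norm_le(1)[OF K0 b, unfolded D_def]])
    then have "\<kappa> * \<bar>e\<bar> \<le> \<kappa> * (D * U / 2 * \<kappa>)" by (simp add: algebra_simps power2_eq_square)
    then show ?thesis using \<kappa> by (simp only: mult_le_cancel_left_pos)
  qed
  have "e = 0"
  proof (rule ccontr)
    assume "e \<noteq> 0"
    then have p: "\<bar>e\<bar> > 0" by simp
    define P where "P = D * U"
    have "P > 0" using small[of 1] p by (simp add: P_def)
    \<comment> \<open>With \<kappa> = |e| / P the bound \<open>small\<close> reads |e| \<le> |e| /
      2.\<close>
    moreover have "\<bar>e\<bar> \<le> P / 2 * (\<bar>e\<bar> / P)"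
      unfolding P_def by (rule small) (use \<open>P > 0\<close> p in \<open>simp add: P_def\<close>)
    ultimately show False using p by simp
  qed
  then show ?thesis by (simp add: e_def)
qed

lemma sobolev_space_subset: "sobolev_space m \<subseteq> sobolev_space_on m \<Omega>"
  by (auto simp: sobolev_space_on_def)

text \<open>The quotient norm is at most the norm of any extension, so one density of one extension
  suffices. That v and u need only agree on \<Omega> is what admits cut-off polynomials as
  v.\<close>

lemma sobolev_functional_bound:
  assumes "sobolev_functional m \<Omega> L"
  obtains B where "0 \<le> B" "\<And>u v g. spectral_density m v g \<Longrightarrow> (\<And>x. x \<in> \<Omega> \<Longrightarrow> v x = u x) \<Longrightarrow>
      \<bar>L u\<bar> \<le> B * sqrt (energy m g)"
proof -
  obtain B where B: "\<And>u. u \<in> sobolev_space_on m \<Omega> \<Longrightarrow> \<bar>L u\<bar> \<le> B * sobolev_norm_on m \<Omega> u"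
    using assms unfolding sobolev_functional_def by blast
  show ?thesis
  proof (rule that[of "\<bar>B\<bar>"])
    fix u v g assume v: "spectral_density m v g" and eq: "\<And>x. x \<in> \<Omega> \<Longrightarrow> v x = u x"
    have vs: "v \<in> sobolev_space m" using v by (auto simp: sobolev_space_def)
    then have us: "u \<in> sobolev_space_on m \<Omega>" using eq by (auto simp: sobolev_space_on_def)
    let ?S = "{sobolev_norm m v |v. v \<in> sobolev_space m \<and> (\<forall>x\<in>\<Omega>. v x = u x)}"
    have ne: "sobolev_norm m v \<in> ?S" using vs eq by blast
    have lb: "\<And>y. y \<in> ?S \<Longrightarrow> 0 \<le> y" using sobolev_norm_nonneg by blast
    have 1: "sobolev_norm_on m \<Omega> u \<le> sobolev_norm m v"
      unfolding sobolev_norm_on_def using ne lb by (intro cInf_lower bdd_belowI[of _ 0]) auto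
    have 0: "0 \<le> sobolev_norm_on m \<Omega> u"
      unfolding sobolev_norm_on_def using ne lb by (intro cInf_greatest) auto
    have "\<bar>L u\<bar> \<le> B * sobolev_norm_on m \<Omega> u" by (rule B[OF us])
    also have "\<dots> \<le> \<bar>B\<bar> * sqrt (energy m g)"
      using 0 1 sobolev_norm_le[OF v] by (intro mult_mono) auto
    finally show "\<bar>L u\<bar> \<le> \<bar>B\<bar> * sqrt (energy m g)" .
  qed simp
qed

text \<open>In the energy of h^(-d) g(w / h), substitution replaces the weight at w by that at h w,
  which is no larger because h \<le> 1 and m \<ge> 0.\<close>

lemma spectral_density_dilate:
  fixes u :: "real^'d \<Rightarrow> real"
  assumes m: "0 \<le> m" and u: "spectral_density m u g" and h: "0 < h" "h \<le> 1"
  shows "spectral_density m (\<lambda>x. u (h *\<^sub>R x)) (\<lambda>w. complex_of_real (inverse (h ^ CARD('d))) * g (inverse h *\<^sub>R w))"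
  unfolding spectral_density_iff
proof (intro conjI allI)
  have [measurable]: "g \<in> borel_measurable borel"
    using u by (auto simp: spectral_density_def)
  let ?k = "\<lambda>w. complex_of_real (inverse (h ^ CARD('d))) * g (inverse h *\<^sub>R w)"
  have i: "integrable lborel (\<lambda>w. sobolev_weight m w * (cmod (g w))\<^sup>2)" using u by (simp add: spectral_density_def)
  have "integrable lborel (\<lambda>w. sobolev_weight m (h *\<^sub>R w) * (cmod (g w))\<^sup>2)"
  proof (rule Bochner_Integration.integrable_bound[OF i])
    have "(norm (h *\<^sub>R w))\<^sup>2 \<le> (norm w)\<^sup>2" for w :: "real^'d"
      using h mult_left_le_one_le[of "norm w" h] by (intro power_mono) auto
    then have "sobolev_weight m (h *\<^sub>R w) \<le> sobolev_weight m w" for w :: "real^'d"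
      using m unfolding sobolev_weight_def by (intro powr_mono2) auto
    then show "AE w in lborel. norm (sobolev_weight m (h *\<^sub>R w) * (cmod (g w))\<^sup>2) \<le> norm (sobolev_weight m w * (cmod (g w))\<^sup>2)"
      by (auto simp: abs_mult intro!: mult_right_mono)
  qed measurable
  from integrable_affine_lborel[OF this, of "inverse h" 0]
  have "integrable lborel (\<lambda>w. sobolev_weight m w * (cmod (g (inverse h *\<^sub>R w)))\<^sup>2)" using h by simp
  then have "integrable lborel (\<lambda>w. (inverse (h ^ CARD('d)))\<^sup>2 * (sobolev_weight m w * (cmod (g (inverse h *\<^sub>R w)))\<^sup>2))"
    by (rule integrable_mult_right)
  moreover have "(inverse (h ^ CARD('d)))\<^sup>2 * (sobolev_weight m w * (cmod (g (inverse h *\<^sub>R w)))\<^sup>2) = sobolev_weight m w * (cmod (?k w))\<^sup>2" for w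
    using h by (simp add: norm_mult power_mult_distrib norm_power norm_inverse)
  ultimately show "finite_energy m ?k" unfolding finite_energy_def by (auto simp del: of_real_inverse of_real_power)
  fix x
  have "(LINT w|lborel. ?k w * cis (w \<bullet> x)) = h ^ CARD('d) *\<^sub>R (LINT w|lborel. ?k (0 + h *\<^sub>R w) * cis ((0 + h *\<^sub>R w) \<bullet> x))"
    using h by (subst integral_affine_lborel[of _ h 0]) auto
  also have "(LINT w|lborel. ?k (0 + h *\<^sub>R w) * cis ((0 + h *\<^sub>R w) \<bullet> x)) = complex_of_real (inverse (h ^ CARD('d))) * (LINT w|lborel. g w * cis (w \<bullet> (h *\<^sub>R x)))"
    using h by (simp add: mult.assoc del: of_real_inverse of_real_power)
  also have "h ^ CARD('d) *\<^sub>R \<dots> = (LINT w|lborel. g w * cis (w \<bullet> (h *\<^sub>R x)))"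
    using h by (simp add: scaleR_conv_of_real)
  finally show "complex_of_real (u (h *\<^sub>R x)) = (LINT w|lborel. ?k w * cis (w \<bullet> x))"
    using spectral_density_integral[OF u, of "h *\<^sub>R x"] by simp
qed

section \<open>Spectral densities of smooth functions\<close>

lemma borel_measurable_fourier:
  fixes f :: "'a::euclidean_space \<Rightarrow> real"
  assumes [measurable]: "f \<in> borel_measurable borel"
  shows "fourier f \<in> borel_measurable borel"
  unfolding fourier_def[abs_def] by measurable

text \<open>Some coordinate satisfies |w| \<le> d |w.b|, because |w| is at most the l1 norm. Decay
  of order n along this axis bounds |w|^n times the transform, decay of order 0 the transform
  itself, and (1 + |w|^2)^(n/2) \<le> 2^(n/2) (1 + |w|^n) combines the two.\<close>

lemma fourier_bound:
  fixes f :: "real^'d \<Rightarrow> real"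
  assumes f: "smooth_bdd n (cball 0 A) M f" "\<And>x. norm x > A \<Longrightarrow> f x = 0" "0 \<le> M"
  shows "cmod (fourier f w) \<le> 2 powr (real n / 2) * (1 + real CARD('d) ^ n) * measure lborel (cball (0::real^'d) A) * M
           * sobolev_weight (- (real n / 2)) w"
proof -
  define V where "V = measure lborel (cball (0::real^'d) A)"
  let ?d = "real CARD('d)" and ?F = "cmod (fourier f w)"
  have V: "V \<ge> 0" by (simp add: V_def)
  obtain b0 :: "real^'d" where "b0 \<in> Basis" using nonempty_Basis by blast
  then have F0: "?F \<le> M * V"
    using fourier_decay[OF smooth_bdd_le[OF f(1), of 0] f(2,3), of b0 w] by (simp add: V_def)
  have "\<exists>b\<in>Basis. norm w \<le> ?d * \<bar>w \<bullet> b\<bar>"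
  proof (rule ccontr)
    assume "\<not> (\<exists>b\<in>Basis. norm w \<le> ?d * \<bar>w \<bullet> b\<bar>)"
    then have *: "\<And>b. b \<in> Basis \<Longrightarrow> \<bar>w \<bullet> b\<bar> < norm w / ?d" by (force simp: field_simps)
    have "norm w \<le> (\<Sum>b\<in>Basis. \<bar>w \<bullet> b\<bar>)" by (rule norm_le_l1)
    also have "\<dots> < (\<Sum>b\<in>(Basis::(real^'d) set). norm w / ?d)" by (rule sum_strict_mono) (use * in auto)
    also have "\<dots> = norm w" by simp
    finally show False by simp
  qed
  then obtain b where b: "b \<in> Basis" "norm w \<le> ?d * \<bar>w \<bullet> b\<bar>" by blast
  have Fn: "norm w ^ n * ?F \<le> ?d ^ n * (M * V)"
  proof -
    have "norm w ^ n * ?F \<le> (?d * \<bar>w \<bullet> b\<bar>) ^ n * ?F" using b by (intro mult_right_mono power_mono) auto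
    also have "\<dots> = ?d ^ n * (\<bar>w \<bullet> b\<bar> ^ n * ?F)" by (simp add: power_mult_distrib)
    also have "\<dots> \<le> ?d ^ n * (M * V)"
      using fourier_decay[OF f b(1), of w] by (intro mult_left_mono) (auto simp: V_def)
    finally show ?thesis .
  qed
  have W: "sobolev_weight (real n / 2) w \<le> 2 powr (real n / 2) * (1 + norm w ^ n)"
  proof (cases "norm w \<le> 1")
    case True
    then have "(norm w)\<^sup>2 \<le> 1" by (simp add: power_le_one)
    then have "sobolev_weight (real n / 2) w \<le> 2 powr (real n / 2)"
      unfolding sobolev_weight_def by (intro powr_mono2) auto
    also have "\<dots> \<le> 2 powr (real n / 2) * (1 + norm w ^ n)" by simp
    finally show ?thesis .
  next
    case False
    then have "1 + (norm w)\<^sup>2 \<le> 2 * (norm w)\<^sup>2" by (simp add: one_le_power)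
    then have "sobolev_weight (real n / 2) w \<le> (2 * (norm w)\<^sup>2) powr (real n / 2)"
      unfolding sobolev_weight_def by (intro powr_mono2) auto
    also have "\<dots> = 2 powr (real n / 2) * ((norm w)\<^sup>2) powr (real n / 2)" by (rule powr_mult)
    also have "((norm w)\<^sup>2) powr (real n / 2) = norm w ^ n"
    proof -
      have "(norm w)\<^sup>2 = norm w powr 2" using False by (simp add: powr_numeral)
      then have "((norm w)\<^sup>2) powr (real n / 2) = norm w powr real n" by (simp only: powr_powr) simp
      also have "\<dots> = norm w ^ n" using False by (intro powr_realpow) linarith
      finally show ?thesis .
    qed
    also have "2 powr (real n / 2) * norm w ^ n \<le> 2 powr (real n / 2) * (1 + norm w ^ n)" by simp
    finally show ?thesis .
  qed
  have "sobolev_weight (real n / 2) w * ?F \<le> 2 powr (real n / 2) * (1 + norm w ^ n) * ?F"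
    using W by (intro mult_right_mono) auto
  also have "\<dots> = 2 powr (real n / 2) * (?F + norm w ^ n * ?F)" by (simp add: algebra_simps)
  also have "\<dots> \<le> 2 powr (real n / 2) * (M * V + ?d ^ n * (M * V))"
    using F0 Fn by (intro mult_left_mono add_mono) auto
  also have "\<dots> = 2 powr (real n / 2) * (1 + ?d ^ n) * V * M" by (simp add: algebra_simps)
  finally have le: "sobolev_weight (real n / 2) w * ?F \<le> 2 powr (real n / 2) * (1 + ?d ^ n) * V * M" .
  have "?F = (sobolev_weight (real n / 2) w * sobolev_weight (- (real n / 2)) w) * ?F" by simp
  also have "\<dots> = (sobolev_weight (real n / 2) w * ?F) * sobolev_weight (- (real n / 2)) w" by (simp only: mult_ac)
  also have "\<dots> \<le> 2 powr (real n / 2) * (1 + ?d ^ n) * V * M * sobolev_weight (- (real n / 2)) w"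
    using le by (rule mult_right_mono) simp
  finally show ?thesis unfolding V_def .
qed

text \<open>The density is (2 pi)^(-d) times the transform. Decay of order n puts the energy
  integrand below a multiple of the weight of order -(n - m), integrable because n - m > d/2. The
  constant is independent of f, so the norm is linear in the derivative bound M.\<close>

lemma spectral_density_smooth:
  fixes A :: real
  assumes m: "m > real CARD('d) / 2" and n: "real n > m + real CARD('d) / 2"
  shows "\<exists>C\<ge>0. \<forall>(f::real^'d \<Rightarrow> real) M. smooth_bdd n (cball 0 A) M f \<longrightarrow> (\<forall>x. norm x > A \<longrightarrow> f x = 0) \<longrightarrow> 0 \<le> M \<longrightarrow>
           (\<exists>g. spectral_density m f g \<and> energy m g \<le> (C * M)\<^sup>2)"
proof -
  define C1 where "C1 = 2 powr (real n / 2) * (1 + real CARD('d) ^ n) * measure lborel (cball (0::real^'d) A)"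
  define P where "P = (2 * pi) ^ CARD('d)"
  define I where "I = (LINT w|lborel. sobolev_weight (- (real n - m)) (w::real^'d))"
  have P: "P > 0" by (simp add: P_def)
  have C1: "C1 \<ge> 0" by (simp add: C1_def)
  have I: "I \<ge> 0" unfolding I_def by (intro Bochner_Integration.integral_nonneg) simp
  have Ii: "integrable lborel (\<lambda>w::real^'d. sobolev_weight (- (real n - m)) w)"
    by (rule integrable_sobolev_weight) (use n in simp)
  show ?thesis
  proof (intro exI[of _ "C1 / P * sqrt I"] conjI allI impI)
    show "0 \<le> C1 / P * sqrt I" using C1 P I by simp
    fix f :: "real^'d \<Rightarrow> real" and M
    assume f: "smooth_bdd n (cball 0 A) M f" "\<forall>x. norm x > A \<longrightarrow> f x = 0" "0 \<le> M"
    have fc: "continuous_on UNIV f" by (rule smooth_bdd_continuous[OF f(1)])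
    have [measurable]: "fourier f \<in> borel_measurable borel"
      using fc by (intro borel_measurable_fourier borel_measurable_continuous_onI)
    have b: "cmod (fourier f w) \<le> C1 * M * sobolev_weight (- (real n / 2)) w" for w
      using fourier_bound[OF f(1) _ f(3)] f(2) by (auto simp: C1_def)
    have FI: "integrable lborel (fourier f)"
    proof (rule Bochner_Integration.integrable_bound)
      show "integrable lborel (\<lambda>w::real^'d. C1 * M * sobolev_weight (- (real n / 2)) w)"
        by (intro integrable_mult_right integrable_sobolev_weight) (use m n in simp)
      show "AE w in lborel. norm (fourier f w) \<le> norm (C1 * M * sobolev_weight (- (real n / 2)) w)"
        using b by (auto intro: order_trans[OF _ abs_ge_self])
    qed simp
    let ?g = "\<lambda>w. complex_of_real (inverse P) * fourier f w"
    have e: "sobolev_weight m w * (cmod (?g w))\<^sup>2 \<le> (C1 / P * M)\<^sup>2 * sobolev_weight (- (real n - m)) w" for w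
    proof -
      have "cmod (?g w) \<le> C1 / P * M * sobolev_weight (- (real n / 2)) w"
      proof -
        have "cmod (?g w) = inverse P * cmod (fourier f w)"
          using P by (simp only: norm_mult norm_of_real) simp
        also have "\<dots> \<le> inverse P * (C1 * M * sobolev_weight (- (real n / 2)) w)"
          using b P by (intro mult_left_mono) auto
        finally show ?thesis by (simp only: divide_inverse mult_ac)
      qed
      then have "(cmod (?g w))\<^sup>2 \<le> (C1 / P * M * sobolev_weight (- (real n / 2)) w)\<^sup>2" by (intro power_mono) auto
      then have "sobolev_weight m w * (cmod (?g w))\<^sup>2 \<le> sobolev_weight m w * (C1 / P * M * sobolev_weight (- (real n / 2)) w)\<^sup>2"
        by (intro mult_left_mono) auto
      also have "\<dots> = (C1 / P * M)\<^sup>2 * (sobolev_weight m w * (sobolev_weight (- (real n / 2)) w * sobolev_weight (- (real n / 2)) w))"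
        by (simp only: power_mult_distrib power2_eq_square mult_ac)
      also have "\<dots> = (C1 / P * M)\<^sup>2 * sobolev_weight (- (real n - m)) w"
        by (simp flip: sobolev_weight_add)
      finally show ?thesis .
    qed
    have fe: "finite_energy m ?g"
      unfolding finite_energy_def
    proof
      show "integrable lborel (\<lambda>w. sobolev_weight m w * (cmod (?g w))\<^sup>2)"
      proof (rule Bochner_Integration.integrable_bound)
        show "integrable lborel (\<lambda>w::real^'d. (C1 / P * M)\<^sup>2 * sobolev_weight (- (real n - m)) w)"
          by (rule integrable_mult_right[OF Ii])
        show "AE w in lborel. norm (sobolev_weight m w * (cmod (?g w))\<^sup>2) \<le> norm ((C1 / P * M)\<^sup>2 * sobolev_weight (- (real n - m)) w)"
        proof (rule AE_I2)
          fix w :: "real^'d"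
          have "norm (sobolev_weight m w * (cmod (?g w))\<^sup>2) = sobolev_weight m w * (cmod (?g w))\<^sup>2" by simp
          also have "\<dots> \<le> norm ((C1 / P * M)\<^sup>2 * sobolev_weight (- (real n - m)) w)"
            using e[of w] by (simp only: real_norm_def order_trans[OF _ abs_ge_self])
          finally show "norm (sobolev_weight m w * (cmod (?g w))\<^sup>2) \<le> norm ((C1 / P * M)\<^sup>2 * sobolev_weight (- (real n - m)) w)" .
        qed
      qed simp
    qed simp
    have "energy m ?g \<le> (LINT w|lborel. (C1 / P * M)\<^sup>2 * sobolev_weight (- (real n - m)) (w::real^'d))"
      unfolding energy_def using fe Ii e
      by (intro integral_mono) (auto simp: finite_energy_def intro!: integrable_mult_right)
    also have "\<dots> = (C1 / P * M)\<^sup>2 * I" by (simp add: I_def)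
    also have "\<dots> = (C1 / P * M)\<^sup>2 * (sqrt I)\<^sup>2" using I by simp
    also have "\<dots> = (C1 / P * sqrt I * M)\<^sup>2" by (simp only: power_mult_distrib mult_ac)
    finally have "energy m ?g \<le> (C1 / P * sqrt I * M)\<^sup>2" .
    moreover have "spectral_density m f ?g"
      unfolding spectral_density_iff
    proof (intro conjI allI fe)
      fix x
      have "(LINT w|lborel. ?g w * cis (w \<bullet> x)) = complex_of_real (inverse P) * complex_of_real (P * f x)"
        using fourier_inversion[OF fc _ FI, of A x] f(2) by (simp add: P_def mult.assoc)
      also have "\<dots> = complex_of_real (f x)" using P by simp
      finally show "complex_of_real (f x) = (LINT w|lborel. ?g w * cis (w \<bullet> x))" by (rule sym)
    qed
    ultimately show "\<exists>g. spectral_density m f g \<and> energy m g \<le> (C1 / P * sqrt I * M)\<^sup>2" by blast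
  qed
qed

text \<open>Multiplication by a cut-off that is 1 on the ball of radius R. This opens functionals
  that are continuous only in the Sobolev norm over a bounded set to polynomials, Taylor remainders
  and powers of linear forms.\<close>

lemma spectral_density_extension:
  fixes R :: real
  assumes m: "m > real CARD('d) / 2" and n: "real n > m + real CARD('d) / 2" and R: "0 \<le> R"
  shows "\<exists>C\<ge>0. \<forall>(f::real^'d \<Rightarrow> real) M. smooth_bdd n (cball 0 (R + 1)) M f \<longrightarrow> 0 \<le> M \<longrightarrow>
           (\<exists>v g. spectral_density m v g \<and> energy m g \<le> (C * M)\<^sup>2 \<and> (\<forall>x. norm x \<le> R \<longrightarrow> v x = f x))"
proof -
  obtain \<psi> :: "real^'d \<Rightarrow> real" and K where \<psi>: "0 \<le> K" "smooth_bdd n (cball 0 (R + 1)) K \<psi>"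
      "\<And>x. norm x \<le> R \<Longrightarrow> \<psi> x = 1" "\<And>x. norm x > R + 1 \<Longrightarrow> \<psi> x = 0"
    using smooth_cutoff[OF R, of n] by metis
  obtain C where C: "C \<ge> 0" "\<And>(f::real^'d \<Rightarrow> real) M. smooth_bdd n (cball 0 (R + 1)) M f \<Longrightarrow> (\<forall>x. norm x > R + 1 \<longrightarrow> f x = 0) \<Longrightarrow> 0 \<le> M \<Longrightarrow>
           (\<exists>g. spectral_density m f g \<and> energy m g \<le> (C * M)\<^sup>2)"
    using spectral_density_smooth[OF m n, of "R + 1"] by metis
  show ?thesis
  proof (intro exI[of _ "C * (2 ^ n * K)"] conjI allI impI)
    fix f :: "real^'d \<Rightarrow> real" and M assume f: "smooth_bdd n (cball 0 (R + 1)) M f" "0 \<le> M"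
    have "\<exists>g. spectral_density m (\<lambda>x. \<psi> x * f x) g \<and> energy m g \<le> (C * (2 ^ n * (K * M)))\<^sup>2"
      using \<psi> f by (intro C(2) smooth_bdd_mult) auto
    then obtain g where "spectral_density m (\<lambda>x. \<psi> x * f x) g" "energy m g \<le> (C * (2 ^ n * K) * M)\<^sup>2"
      by (auto simp: mult.assoc)
    then show "\<exists>v g. spectral_density m v g \<and> energy m g \<le> (C * (2 ^ n * K) * M)\<^sup>2 \<and> (\<forall>x. norm x \<le> R \<longrightarrow> v x = f x)"
      using \<psi>(3) by (intro exI[of _ "\<lambda>x. \<psi> x * f x"] exI[of _ g]) auto
  qed (use C \<psi> in auto)
qed

text \<open>
  Ridge functions \<open>\<phi> (\<eta> \<bullet> x)\<close> are superposed with a density supported in the unit ball; each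
  differentiation moves to the next profile \<open>\<phi> (Suc l)\<close> and puts a factor \<open>\<eta> \<bullet> b\<close> on the density.
\<close>

lemma smooth_bdd_ridge_integral:
  fixes g :: "'a::euclidean_space \<Rightarrow> complex" and \<phi> :: "nat \<Rightarrow> real \<Rightarrow> complex"
  assumes \<phi>: "\<And>l z. (\<phi> l has_vector_derivative \<phi> (Suc l) z) (at z)"
    and b: "\<And>l z. cmod (\<phi> l z) \<le> D * \<bar>z\<bar> ^ (J - l)" and D: "0 \<le> D" and A: "1 \<le> A"
    and g: "integrable lborel g" "\<And>\<eta>. norm \<eta> > 1 \<Longrightarrow> g \<eta> = 0"
  shows "smooth_bdd n (cball 0 A) (D * A ^ J * (LINT \<eta>|lborel. cmod (g \<eta>) * norm \<eta> ^ (J - l)))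
           (\<lambda>x. Re (LINT \<eta>|lborel. g \<eta> * \<phi> l (\<eta> \<bullet> x)))"
  using g
proof (induction n arbitrary: l g)
  have cont: "continuous_on UNIV (\<phi> l)" for l
    using \<phi> by (auto intro!: continuous_at_imp_continuous_on has_vector_derivative_continuous)
  have [measurable]: "\<phi> l \<in> borel_measurable borel" for l by (rule borel_measurable_continuous_onI[OF cont])
  have inner1: "\<bar>\<eta> \<bullet> x\<bar> \<le> norm \<eta> * norm x" for \<eta> x :: 'a by (rule Cauchy_Schwarz_ineq2)
  have bound: "cmod (\<phi> l (\<eta> \<bullet> x)) \<le> D * (norm \<eta> ^ (J - l) * norm x ^ (J - l))" for l and \<eta> x :: 'a
  proof -
    have "\<bar>\<eta> \<bullet> x\<bar> ^ (J - l) \<le> (norm \<eta> * norm x) ^ (J - l)" by (intro power_mono inner1) simp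
    then show ?thesis using order_trans[OF b[of l "\<eta> \<bullet> x"] mult_left_mono[OF _ D]] by (simp add: power_mult_distrib)
  qed
  have moment: "integrable lborel (\<lambda>\<eta>. cmod (g \<eta>) * norm \<eta> ^ k)" if g: "integrable lborel g" "\<And>\<eta>. norm \<eta> > 1 \<Longrightarrow> g \<eta> = 0" 
    for g :: "'a \<Rightarrow> complex" and k
  proof (rule Bochner_Integration.integrable_bound[OF integrable_norm[OF g(1)]])
    show "AE \<eta> in lborel. norm (cmod (g \<eta>) * norm \<eta> ^ k) \<le> norm (cmod (g \<eta>))"
    proof (rule AE_I2)
      fix \<eta> :: 'a
      show "norm (cmod (g \<eta>) * norm \<eta> ^ k) \<le> norm (cmod (g \<eta>))"
        using g(2)[of \<eta>] by (cases "norm \<eta> \<le> 1") (auto simp: abs_mult intro!: mult_right_le_one_le power_le_one)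
    qed
  qed (use g in auto)
  have int: "integrable lborel (\<lambda>\<eta>. g \<eta> * \<phi> l (\<eta> \<bullet> x))" if g: "integrable lborel g" "\<And>\<eta>. norm \<eta> > 1 \<Longrightarrow> g \<eta> = 0" 
    for g :: "'a \<Rightarrow> complex" and x l
  proof (rule Bochner_Integration.integrable_bound)
    show "integrable lborel (\<lambda>\<eta>. cmod (g \<eta>) * norm \<eta> ^ (J - l) * (D * norm x ^ (J - l)))"
      by (intro integrable_mult_left moment[OF g])
    show "AE \<eta> in lborel. norm (g \<eta> * \<phi> l (\<eta> \<bullet> x)) \<le> norm (cmod (g \<eta>) * norm \<eta> ^ (J - l) * (D * norm x ^ (J - l)))"
    proof (rule AE_I2)
      fix \<eta> :: 'a
      have "norm (g \<eta> * \<phi> l (\<eta> \<bullet> x)) \<le> cmod (g \<eta>) * (D * (norm \<eta> ^ (J - l) * norm x ^ (J - l)))"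
        unfolding norm_mult by (intro mult_left_mono bound) simp
      also have "\<dots> = cmod (g \<eta>) * norm \<eta> ^ (J - l) * (D * norm x ^ (J - l))" by (simp only: mult_ac)
      also have "\<dots> \<le> norm \<dots>" by simp
      finally show "norm (g \<eta> * \<phi> l (\<eta> \<bullet> x)) \<le> norm (cmod (g \<eta>) * norm \<eta> ^ (J - l) * (D * norm x ^ (J - l)))" .
    qed
  qed (use g in auto)
  have base: "continuous_on UNIV (\<lambda>x. Re (LINT \<eta>|lborel. g \<eta> * \<phi> l (\<eta> \<bullet> x)))"
    "\<bar>Re (LINT \<eta>|lborel. g \<eta> * \<phi> l (\<eta> \<bullet> x))\<bar> \<le> D * A ^ J * (LINT \<eta>|lborel. cmod (g \<eta>) * norm \<eta> ^ (J - l))"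
    if g: "integrable lborel g" "\<And>\<eta>. norm \<eta> > 1 \<Longrightarrow> g \<eta> = 0" and x: "x \<in> cball 0 A"
    for g :: "'a \<Rightarrow> complex" and x l
  proof -
    show "continuous_on UNIV (\<lambda>x. Re (LINT \<eta>|lborel. g \<eta> * \<phi> l (\<eta> \<bullet> x)))"
    proof (intro continuous_intros, unfold continuous_on_sequentially, intro allI ballI impI, elim conjE)
      fix X :: "nat \<Rightarrow> 'a" and a assume X: "X \<longlonglongrightarrow> a"
      then obtain B where B: "\<And>i. norm (X i) \<le> B"
        using convergent_imp_Bseq[of X] unfolding convergent_def Bseq_def by blast
      show "((\<lambda>x. LINT \<eta>|lborel. g \<eta> * \<phi> l (\<eta> \<bullet> x)) \<circ> X) \<longlonglongrightarrow> (LINT \<eta>|lborel. g \<eta> * \<phi> l (\<eta> \<bullet> a))"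
        unfolding o_def
      proof (rule integral_dominated_convergence[where w="\<lambda>\<eta>. cmod (g \<eta>) * norm \<eta> ^ (J - l) * (D * B ^ (J - l))"])
        show "integrable lborel (\<lambda>\<eta>. cmod (g \<eta>) * norm \<eta> ^ (J - l) * (D * B ^ (J - l)))"
          by (intro integrable_mult_left moment[OF g])
        show "AE \<eta> in lborel. (\<lambda>i. g \<eta> * \<phi> l (\<eta> \<bullet> X i)) \<longlonglongrightarrow> g \<eta> * \<phi> l (\<eta> \<bullet> a)"
          using cont X by (intro AE_I2 tendsto_mult tendsto_const continuous_on_tendsto_compose[of UNIV "\<phi> l"] tendsto_inner) auto
        show "AE \<eta> in lborel. norm (g \<eta> * \<phi> l (\<eta> \<bullet> X i)) \<le> cmod (g \<eta>) * norm \<eta> ^ (J - l) * (D * B ^ (J - l))" for i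
        proof (rule AE_I2)
          fix \<eta>
          have "norm (g \<eta> * \<phi> l (\<eta> \<bullet> X i)) \<le> cmod (g \<eta>) * (D * (norm \<eta> ^ (J - l) * norm (X i) ^ (J - l)))"
            unfolding norm_mult using bound by (intro mult_left_mono) auto
          also have "\<dots> \<le> cmod (g \<eta>) * (D * (norm \<eta> ^ (J - l) * B ^ (J - l)))"
            using B D by (intro mult_left_mono power_mono) auto
          finally show "norm (g \<eta> * \<phi> l (\<eta> \<bullet> X i)) \<le> cmod (g \<eta>) * norm \<eta> ^ (J - l) * (D * B ^ (J - l))"
            by (simp only: mult_ac)
        qed
      qed (use int[OF g] in auto)
    qed
    have "\<bar>Re (LINT \<eta>|lborel. g \<eta> * \<phi> l (\<eta> \<bullet> x))\<bar> \<le> cmod (LINT \<eta>|lborel. g \<eta> * \<phi> l (\<eta> \<bullet> x))" by (rule abs_Re_le_cmod)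
    also have "\<dots> \<le> (LINT \<eta>|lborel. cmod (g \<eta> * \<phi> l (\<eta> \<bullet> x)))" by (rule integral_norm_bound)
    also have "\<dots> \<le> (LINT \<eta>|lborel. D * A ^ J * (cmod (g \<eta>) * norm \<eta> ^ (J - l)))"
    proof (rule integral_mono)
      fix \<eta>
      have "norm x ^ (J - l) \<le> A ^ (J - l)" using x by (intro power_mono) auto
      also have "\<dots> \<le> A ^ J" using A by (intro power_increasing) auto
      finally have "cmod (\<phi> l (\<eta> \<bullet> x)) \<le> D * (norm \<eta> ^ (J - l) * A ^ J)"
        using D by (intro order_trans[OF bound] mult_left_mono) auto
      then have "cmod (g \<eta>) * cmod (\<phi> l (\<eta> \<bullet> x)) \<le> cmod (g \<eta>) * (D * (norm \<eta> ^ (J - l) * A ^ J))"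
        by (rule mult_left_mono) simp
      then show "cmod (g \<eta> * \<phi> l (\<eta> \<bullet> x)) \<le> D * A ^ J * (cmod (g \<eta>) * norm \<eta> ^ (J - l))"
        unfolding norm_mult by (simp only: mult_ac)
    qed (use int[OF g] moment[OF g] in \<open>auto intro!: integrable_mult_right\<close>)
    finally show "\<bar>Re (LINT \<eta>|lborel. g \<eta> * \<phi> l (\<eta> \<bullet> x))\<bar> \<le> D * A ^ J * (LINT \<eta>|lborel. cmod (g \<eta>) * norm \<eta> ^ (J - l))"
      by simp
  qed
  {
    case 0
    show ?case using base[OF 0] A by (auto intro: base(1)[OF 0, of 0])
  next
    case (Suc n)
    show ?case
    proof (rule smooth_bdd_SucI[where D="\<lambda>b x. Re (LINT \<eta>|lborel. (g \<eta> * complex_of_real (\<eta> \<bullet> b)) * \<phi> (Suc l) (\<eta> \<bullet> x))"])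
      show "continuous_on UNIV (\<lambda>x. Re (LINT \<eta>|lborel. g \<eta> * \<phi> l (\<eta> \<bullet> x)))"
        using A by (intro base(1)[OF Suc.prems, of 0]) auto
      show "\<bar>Re (LINT \<eta>|lborel. g \<eta> * \<phi> l (\<eta> \<bullet> x))\<bar> \<le> D * A ^ J * (LINT \<eta>|lborel. cmod (g \<eta>) * norm \<eta> ^ (J - l))" if "x \<in> cball 0 A" for x
        by (rule base(2)[OF Suc.prems that])
      fix b :: 'a assume bB: "b \<in> Basis"
      have b1: "\<bar>\<eta> \<bullet> b\<bar> \<le> norm \<eta>" for \<eta> using Basis_le_norm[OF bB] by simp
      have gb: "integrable lborel (\<lambda>\<eta>. g \<eta> * complex_of_real (\<eta> \<bullet> b))" "\<And>\<eta>. norm \<eta> > 1 \<Longrightarrow> g \<eta> * complex_of_real (\<eta> \<bullet> b) = 0"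
      proof -
        show "integrable lborel (\<lambda>\<eta>. g \<eta> * complex_of_real (\<eta> \<bullet> b))"
        proof (rule Bochner_Integration.integrable_bound[OF moment[OF Suc.prems, of 1]])
          show "AE \<eta> in lborel. norm (g \<eta> * complex_of_real (\<eta> \<bullet> b)) \<le> norm (cmod (g \<eta>) * norm \<eta> ^ 1)"
            using b1 by (auto simp: norm_mult abs_mult intro!: mult_left_mono)
        qed (use Suc.prems in auto)
      qed (use Suc.prems in auto)
      show "((\<lambda>t. Re (LINT \<eta>|lborel. g \<eta> * \<phi> l (\<eta> \<bullet> (x + t *\<^sub>R b)))) has_real_derivative
          Re (LINT \<eta>|lborel. (g \<eta> * complex_of_real (\<eta> \<bullet> b)) * \<phi> (Suc l) (\<eta> \<bullet> x))) (at 0)" for x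
        unfolding has_real_derivative_iff_has_vector_derivative
      proof (rule bounded_linear.has_vector_derivative[OF bounded_linear_Re], rule has_vector_derivative_integral)
        \<comment> \<open>Bounds the profile \<open>\<phi> (Suc l)\<close> at \<eta>.(x + r b) for
          |r| \<le> 1 and |\<eta>| \<le> 1, up to which the mean value inequality is needed; for
          |\<eta>| > 1 the density vanishes.\<close>
        define K where "K = D * (norm x + 1) ^ (J - Suc l)"
        show "integrable lborel (\<lambda>\<eta>. g \<eta> * \<phi> l (\<eta> \<bullet> (x + t *\<^sub>R b)))" for t by (rule int[OF Suc.prems])
        show "(\<lambda>\<eta>. (g \<eta> * complex_of_real (\<eta> \<bullet> b)) * \<phi> (Suc l) (\<eta> \<bullet> x)) \<in> borel_measurable lborel"
          by (rule borel_measurable_integrable[OF int[OF gb]])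
        show "integrable lborel (\<lambda>\<eta>. cmod (g \<eta>) * K)" using Suc.prems by auto
        have deriv: "((\<lambda>t. \<phi> l (\<eta> \<bullet> (x + t *\<^sub>R b))) has_vector_derivative (\<eta> \<bullet> b) *\<^sub>R \<phi> (Suc l) (\<eta> \<bullet> (x + t *\<^sub>R b))) (at t)" for \<eta> t
        proof -
          have "((\<lambda>t. \<eta> \<bullet> (x + t *\<^sub>R b)) has_vector_derivative \<eta> \<bullet> b) (at t)"
            unfolding has_real_derivative_iff_has_vector_derivative[symmetric] inner_add_right inner_scaleR_right
            by (auto intro!: derivative_eq_intros)
          from vector_diff_chain_at[OF this \<phi>] show ?thesis by (simp add: o_def)
        qed
        show "((\<lambda>t. g \<eta> * \<phi> l (\<eta> \<bullet> (x + t *\<^sub>R b))) has_vector_derivative (g \<eta> * complex_of_real (\<eta> \<bullet> b)) * \<phi> (Suc l) (\<eta> \<bullet> x)) (at 0)" for \<eta>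
          using has_vector_derivative_mult_right[OF deriv[of \<eta> 0], of "g \<eta>"] by (simp add: scaleR_conv_of_real mult.assoc)
        fix t :: real and \<eta> :: 'a assume t: "\<bar>t\<bar> \<le> 1"
        show "cmod (g \<eta> * \<phi> l (\<eta> \<bullet> (x + t *\<^sub>R b)) - g \<eta> * \<phi> l (\<eta> \<bullet> (x + 0 *\<^sub>R b))) \<le> \<bar>t\<bar> * (cmod (g \<eta>) * K)"
        proof (cases "norm \<eta> \<le> 1")
          case True
          have "norm ((\<lambda>t. \<phi> l (\<eta> \<bullet> (x + t *\<^sub>R b))) t - (\<lambda>t. \<phi> l (\<eta> \<bullet> (x + t *\<^sub>R b))) 0) \<le> K * norm (t - 0)"
          proof (rule differentiable_bound[of "cball 0 1"])
            fix r :: real assume r: "r \<in> cball 0 1"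
            show "((\<lambda>t. \<phi> l (\<eta> \<bullet> (x + t *\<^sub>R b))) has_derivative (\<lambda>h. h *\<^sub>R ((\<eta> \<bullet> b) *\<^sub>R \<phi> (Suc l) (\<eta> \<bullet> (x + r *\<^sub>R b))))) (at r within cball 0 1)"
              using deriv[of \<eta> r] unfolding has_vector_derivative_def by (rule has_derivative_at_withinI)
            have n: "norm (x + r *\<^sub>R b) \<le> norm x + 1"
              using norm_triangle_ineq[of x "r *\<^sub>R b"] r bB by simp
            have "cmod (\<phi> (Suc l) (\<eta> \<bullet> (x + r *\<^sub>R b))) \<le> D * (norm \<eta> ^ (J - Suc l) * norm (x + r *\<^sub>R b) ^ (J - Suc l))" by (rule bound)
            also have "\<dots> \<le> D * (1 * (norm x + 1) ^ (J - Suc l))"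
              using True D n by (intro mult_left_mono mult_mono power_mono power_le_one) auto
            finally have c: "cmod (\<phi> (Suc l) (\<eta> \<bullet> (x + r *\<^sub>R b))) \<le> K" by (simp add: K_def)
            have "norm ((\<eta> \<bullet> b) *\<^sub>R \<phi> (Suc l) (\<eta> \<bullet> (x + r *\<^sub>R b))) \<le> 1 * K"
              unfolding norm_scaleR using c True b1[of \<eta>] by (intro mult_mono) auto
            then show "onorm (\<lambda>h. h *\<^sub>R ((\<eta> \<bullet> b) *\<^sub>R \<phi> (Suc l) (\<eta> \<bullet> (x + r *\<^sub>R b)))) \<le> K"
            proof (intro onorm_le)
              fix h :: real
              assume le: "norm ((\<eta> \<bullet> b) *\<^sub>R \<phi> (Suc l) (\<eta> \<bullet> (x + r *\<^sub>R b))) \<le> 1 * K"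
              show "norm (h *\<^sub>R ((\<eta> \<bullet> b) *\<^sub>R \<phi> (Suc l) (\<eta> \<bullet> (x + r *\<^sub>R b)))) \<le> K * norm h"
                using mult_left_mono[OF le, of "\<bar>h\<bar>"] unfolding norm_scaleR[of h] by (simp only: real_norm_def mult_1 mult.commute abs_ge_zero simp_thms)
            qed
          qed (use t in auto)
          then have "cmod (g \<eta>) * cmod (\<phi> l (\<eta> \<bullet> (x + t *\<^sub>R b)) - \<phi> l (\<eta> \<bullet> (x + 0 *\<^sub>R b))) \<le> cmod (g \<eta>) * (K * \<bar>t\<bar>)"
            by (intro mult_left_mono) auto
          then show ?thesis unfolding right_diff_distrib[symmetric] norm_mult by (simp only: mult_ac)
        qed (use Suc.prems in auto)
      qed
      \<comment> \<open>The factor \<eta>.b on the density makes up for the exponent lost in passing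
        from l to \<open>Suc l\<close>. For l \<ge> J the truncated difference \<open>J - l\<close>
        is already 0, and |\<eta>| \<le> 1 on the support of g is used instead. In this way one
        bound serves all derivatives.\<close>
      have mono: "(LINT \<eta>|lborel. cmod (g \<eta> * complex_of_real (\<eta> \<bullet> b)) * norm \<eta> ^ (J - Suc l)) \<le> (LINT \<eta>|lborel. cmod (g \<eta>) * norm \<eta> ^ (J - l))"
      proof (rule integral_mono[OF moment[OF gb] moment[OF Suc.prems]])
        fix \<eta> :: 'a
        show "cmod (g \<eta> * complex_of_real (\<eta> \<bullet> b)) * norm \<eta> ^ (J - Suc l) \<le> cmod (g \<eta>) * norm \<eta> ^ (J - l)"
        proof (cases "norm \<eta> \<le> 1")
          case True
          have "\<bar>\<eta> \<bullet> b\<bar> * norm \<eta> ^ (J - Suc l) \<le> norm \<eta> ^ (J - l)"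
          proof (cases "l < J")
            case True
            then have "norm \<eta> ^ (J - l) = norm \<eta> * norm \<eta> ^ (J - Suc l)"
              by (metis Suc_diff_Suc power_Suc)
            then show ?thesis using b1[of \<eta>] by (simp add: mult_right_mono)
          next
            case False
            then show ?thesis using b1[of \<eta>] \<open>norm \<eta> \<le> 1\<close> by simp
          qed
          then show ?thesis by (simp add: norm_mult mult.assoc mult_left_mono)
        qed (use Suc.prems in auto)
      qed
      show "smooth_bdd n (cball 0 A) (D * A ^ J * (LINT \<eta>|lborel. cmod (g \<eta>) * norm \<eta> ^ (J - l)))
          (\<lambda>x. Re (LINT \<eta>|lborel. (g \<eta> * complex_of_real (\<eta> \<bullet> b)) * \<phi> (Suc l) (\<eta> \<bullet> x)))"
        by (rule smooth_bdd_mono[OF Suc.IH[OF gb]]) (use D A mono in \<open>auto intro!: mult_left_mono\<close>)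
    qed
  }
qed

section \<open>Taylor parts of band-limited functions\<close>

lemma Re_of_real_mult: "Re (complex_of_real r * z) = r * Re z"
  by simp

definition exp_term :: "nat \<Rightarrow> real \<Rightarrow> complex" where
  "exp_term k z = (\<i> * complex_of_real z) ^ k / fact k"

definition exp_rem :: "nat \<Rightarrow> real \<Rightarrow> complex" where
  "exp_rem j z = cis z - (\<Sum>k<j. exp_term k z)"

lemma exp_term_0 [simp]: "exp_term 0 z = 1"
  by (simp add: exp_term_def)

lemma exp_term_Suc: "exp_term (Suc k) z = \<i> * complex_of_real z / of_nat (Suc k) * exp_term k z"
  by (simp add: exp_term_def)

lemma norm_exp_term: "cmod (exp_term k z) \<le> \<bar>z\<bar> ^ k"
proof -
  have "\<bar>z\<bar> ^ k / fact k \<le> \<bar>z\<bar> ^ k / 1" by (intro divide_left_mono) auto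
  then show ?thesis by (simp add: exp_term_def norm_divide norm_power norm_mult)
qed

lemma norm_exp_rem: "cmod (exp_rem j z) \<le> \<bar>z\<bar> ^ j"
proof (cases j)
  case (Suc n)
  have "\<bar>z\<bar> ^ Suc n / fact (Suc n) \<le> \<bar>z\<bar> ^ Suc n / 1"
    using fact_ge_1[of "Suc n", where ?'a = real] by (intro divide_left_mono) auto
  moreover have "cmod (exp_rem j z) \<le> \<bar>z\<bar> ^ Suc n / fact (Suc n)"
    using iexp_approx1[of z n] by (simp add: Suc exp_rem_def exp_term_def cis_conv_exp lessThan_Suc_atMost)
  ultimately show ?thesis by (simp add: Suc)
qed (simp add: exp_rem_def)

lemma has_vector_derivative_exp_term: "(exp_term (Suc k) has_vector_derivative \<i> * exp_term k z) (at z)"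
proof -
  have "((\<lambda>w. (\<i> * w) ^ Suc k / fact (Suc k)) has_field_derivative (\<i> * complex_of_real z) ^ k * \<i> * of_nat (Suc k) / fact (Suc k)) (at (complex_of_real z))"
    by (auto intro!: derivative_eq_intros simp del: power_Suc fact_Suc of_nat_Suc)
  moreover have "(\<i> * complex_of_real z) ^ k * \<i> * of_nat (Suc k) / fact (Suc k) = \<i> * exp_term k z"
    by (simp add: exp_term_def field_simps del: of_nat_Suc)
  ultimately show ?thesis
    unfolding exp_term_def[abs_def] by (auto dest: has_vector_derivative_real_field)
qed

text \<open>Differentiation removes one subtracted term until \<open>exp_rem 0\<close>, which is
  \<open>cis\<close>, reproduces itself up to the factor i. This agrees with the truncated
  subtraction in the index of the ridge profiles.\<close>

lemma has_vector_derivative_exp_rem: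
  "(exp_rem (Suc j) has_vector_derivative \<i> * exp_rem j z) (at z)"
  "(exp_rem 0 has_vector_derivative \<i> * exp_rem 0 z) (at z)"
proof -
  have c: "(cis has_vector_derivative \<i> * cis z) (at z)"
    using has_vector_derivative_cis_affine[of 0 1 z] by simp
  then show "(exp_rem 0 has_vector_derivative \<i> * exp_rem 0 z) (at z)"
    by (simp add: exp_rem_def[abs_def])
  have "((\<lambda>z. \<Sum>k<Suc j. exp_term k z) has_vector_derivative \<i> * (\<Sum>k<j. exp_term k z)) (at z)"
  proof (induction j)
    case (Suc j)
    have "((\<lambda>z. (\<Sum>k<Suc j. exp_term k z) + exp_term (Suc j) z) has_vector_derivative
        \<i> * (\<Sum>k<j. exp_term k z) + \<i> * exp_term j z) (at z)"
      by (intro has_vector_derivative_add Suc has_vector_derivative_exp_term)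
    then show ?case by (simp add: distrib_left)
  qed simp
  from has_vector_derivative_diff[OF c this]
  show "(exp_rem (Suc j) has_vector_derivative \<i> * exp_rem j z) (at z)"
    unfolding exp_rem_def[abs_def] right_diff_distrib .
qed

text \<open>For a density g in the unit ball this is the homogeneous part of degree k in the Taylor
  expansion at 0, written as an integral so that no derivatives at 0 have to be formed.\<close>

definition taylor_part :: "nat \<Rightarrow> ('a::euclidean_space \<Rightarrow> complex) \<Rightarrow> 'a \<Rightarrow> real" where
  "taylor_part k g x = Re (LINT \<eta>|lborel. g \<eta> * exp_term k (\<eta> \<bullet> x))"

definition taylor_rem :: "nat \<Rightarrow> real \<Rightarrow> ('a::euclidean_space \<Rightarrow> complex) \<Rightarrow> 'a \<Rightarrow> real" where
  "taylor_rem J t g x = Re (LINT \<eta>|lborel. g \<eta> * exp_rem J (t * (\<eta> \<bullet> x)))"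

text \<open>The ridge profiles are i^l \<open>exp_term (k - l)\<close>. They are set to 0 beyond l =
  k, where truncated subtraction would yield a nonzero constant in place of the vanishing
  derivative.\<close>

lemma smooth_bdd_taylor_part:
  fixes g :: "'a::euclidean_space \<Rightarrow> complex"
  assumes A: "1 \<le> A" and g: "integrable lborel g" "\<And>\<eta>. norm \<eta> > 1 \<Longrightarrow> g \<eta> = 0"
  shows "smooth_bdd n (cball 0 A) (A ^ k * (LINT \<eta>|lborel. cmod (g \<eta>) * norm \<eta> ^ k)) (taylor_part k g)"
proof -
  define \<phi> where "\<phi> l z = (if l \<le> k then \<i> ^ l * exp_term (k - l) z else 0)" for l z
  have D: "(\<phi> l has_vector_derivative \<phi> (Suc l) z) (at z)" for l z
  proof -
    consider "l < k" | "l = k" | "l > k" by linarith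
    then show ?thesis
    proof cases
      case 1
      then have "k - l = Suc (k - Suc l)" by simp
      then show ?thesis
        using has_vector_derivative_mult_right[OF has_vector_derivative_exp_term[of "k - Suc l" z], of "\<i> ^ l"] 1
        by (simp add: \<phi>_def[abs_def] mult_ac)
    qed (simp_all add: \<phi>_def[abs_def])
  qed
  have b: "cmod (\<phi> l z) \<le> 1 * \<bar>z\<bar> ^ (k - l)" for l z
    using norm_exp_term[of "k - l" z] by (simp add: \<phi>_def norm_mult norm_power)
  show ?thesis
    using smooth_bdd_ridge_integral[OF D b _ A g, of n 0]
    by (simp add: \<phi>_def taylor_part_def[abs_def])
qed

text \<open>The point is the factor t^J in the bound on all derivatives: the l-th profile carries
  t^l from the chain rule and t^(J-l) from the remainder estimate; for l > J surplus powers of t are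
  at most 1.\<close>

lemma smooth_bdd_taylor_rem:
  fixes g :: "'a::euclidean_space \<Rightarrow> complex"
  assumes A: "1 \<le> A" and t: "0 \<le> t" "t \<le> 1" and g: "integrable lborel g" "\<And>\<eta>. norm \<eta> > 1 \<Longrightarrow> g \<eta> = 0"
  shows "smooth_bdd n (cball 0 A) (t ^ J * A ^ J * (LINT \<eta>|lborel. cmod (g \<eta>) * norm \<eta> ^ J)) (taylor_rem J t g)"
proof -
  define \<phi> where "\<phi> l z = (\<i> * complex_of_real t) ^ l * exp_rem (J - l) (t * z)" for l z
  have D: "(\<phi> l has_vector_derivative \<phi> (Suc l) z) (at z)" for l z
  proof -
    have "(exp_rem (J - l) has_vector_derivative \<i> * exp_rem (J - Suc l) (t * z)) (at (t * z))"
    proof (cases "l < J")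
      case True
      then have "J - l = Suc (J - Suc l)" by simp
      then show ?thesis using has_vector_derivative_exp_rem(1) by simp
    qed (simp add: has_vector_derivative_exp_rem)
    moreover have "((\<lambda>z. t * z) has_vector_derivative t) (at z)"
      unfolding has_real_derivative_iff_has_vector_derivative[symmetric] by (auto intro!: derivative_eq_intros)
    ultimately have "((\<lambda>z. exp_rem (J - l) (t * z)) has_vector_derivative t *\<^sub>R (\<i> * exp_rem (J - Suc l) (t * z))) (at z)"
      using vector_diff_chain_at[of "\<lambda>z. t * z" t z "exp_rem (J - l)"] by (simp add: o_def)
    from has_vector_derivative_mult_right[OF this, of "(\<i> * complex_of_real t) ^ l"]
    show ?thesis by (simp add: \<phi>_def[abs_def] scaleR_conv_of_real mult_ac)
  qed
  have b: "cmod (\<phi> l z) \<le> t ^ J * \<bar>z\<bar> ^ (J - l)" for l z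
  proof -
    have "cmod (\<phi> l z) \<le> t ^ l * \<bar>t * z\<bar> ^ (J - l)"
      using norm_exp_rem[of "J - l" "t * z"] t by (simp add: \<phi>_def norm_mult norm_power mult_left_mono)
    also have "\<dots> = t ^ (l + (J - l)) * \<bar>z\<bar> ^ (J - l)"
      using t by (simp add: abs_mult power_mult_distrib power_add)
    also have "\<dots> \<le> t ^ J * \<bar>z\<bar> ^ (J - l)"
      using t by (intro mult_right_mono power_decreasing) auto
    finally show ?thesis .
  qed
  show ?thesis
    using smooth_bdd_ridge_integral[OF D b _ A g, of n 0] t
    by (simp add: \<phi>_def taylor_rem_def[abs_def])
qed

text \<open>A continuous factor is bounded on the unit ball, outside of which g vanishes.\<close>

lemma integrable_supported_mult:
  fixes g :: "'a::euclidean_space \<Rightarrow> complex" and f :: "'a \<Rightarrow> complex"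
  assumes g: "integrable lborel g" "\<And>\<eta>. norm \<eta> > 1 \<Longrightarrow> g \<eta> = 0" and f: "continuous_on UNIV f"
  shows "integrable lborel (\<lambda>\<eta>. g \<eta> * f \<eta>)"
proof -
  have "compact (f ` cball 0 1)"
    using f by (intro compact_continuous_image) (auto intro: continuous_on_subset)
  from compact_imp_bounded[OF this]
  obtain K where "\<forall>y\<in>f ` cball 0 1. norm y \<le> K" and "K > 0"
    unfolding bounded_pos by blast
  then have K: "\<And>x. x \<in> cball 0 1 \<Longrightarrow> norm (f x) \<le> K" "K > 0" by auto
  show ?thesis
  proof (rule Bochner_Integration.integrable_bound)
    show "integrable lborel (\<lambda>\<eta>. complex_of_real K * g \<eta>)" using g by simp
    show "AE \<eta> in lborel. norm (g \<eta> * f \<eta>) \<le> norm (complex_of_real K * g \<eta>)"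
    proof (rule AE_I2)
      fix \<eta> :: 'a
      show "norm (g \<eta> * f \<eta>) \<le> norm (complex_of_real K * g \<eta>)"
      proof (cases "norm \<eta> \<le> 1")
        case True
        then show ?thesis using mult_left_mono[OF K(1)[of \<eta>], of "cmod (g \<eta>)"] K(2)
          by (simp add: norm_mult mult.commute)
      qed (use g in auto)
    qed
    show "(\<lambda>\<eta>. g \<eta> * f \<eta>) \<in> borel_measurable lborel"
      using g borel_measurable_continuous_onI[OF f] by auto
  qed
qed

lemma continuous_on_exp_term [continuous_intros]: "continuous_on S f \<Longrightarrow> continuous_on S (\<lambda>x. exp_term k (f x))"
  unfolding exp_term_def by (intro continuous_intros) auto

lemma taylor_expansion:
  fixes g :: "'a::euclidean_space \<Rightarrow> complex"
  assumes g: "integrable lborel g" "\<And>\<eta>. norm \<eta> > 1 \<Longrightarrow> g \<eta> = 0"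
    and v: "complex_of_real (v (t *\<^sub>R x)) = (LINT \<eta>|lborel. g \<eta> * cis (\<eta> \<bullet> (t *\<^sub>R x)))"
  shows "v (t *\<^sub>R x) = (\<Sum>k<J. t ^ k * taylor_part k g x) + taylor_rem J t g x"
proof -
  let ?e = "\<lambda>k \<eta>. exp_term k (t * (\<eta> \<bullet> x))"
  have i: "integrable lborel (\<lambda>\<eta>. g \<eta> * ?e k \<eta>)" for k
    by (intro integrable_supported_mult[OF g] continuous_intros; assumption)
  have ic: "integrable lborel (\<lambda>\<eta>. g \<eta> * cis (t * (\<eta> \<bullet> x)))"
    by (intro integrable_mult_cis g) auto
  have e: "?e k \<eta> = complex_of_real (t ^ k) * exp_term k (\<eta> \<bullet> x)" for k \<eta>
    by (simp add: exp_term_def power_mult_distrib)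
  have "taylor_rem J t g x = Re (LINT \<eta>|lborel. g \<eta> * cis (t * (\<eta> \<bullet> x)) - (\<Sum>k<J. g \<eta> * ?e k \<eta>))"
    by (simp add: taylor_rem_def exp_rem_def right_diff_distrib sum_distrib_left)
  also have "\<dots> = Re (LINT \<eta>|lborel. g \<eta> * cis (t * (\<eta> \<bullet> x))) - (\<Sum>k<J. Re (LINT \<eta>|lborel. g \<eta> * ?e k \<eta>))"
    using i ic by simp
  also have "Re (LINT \<eta>|lborel. g \<eta> * cis (t * (\<eta> \<bullet> x))) = v (t *\<^sub>R x)"
    using arg_cong[OF v, of Re] by simp
  also have "(\<Sum>k<J. Re (LINT \<eta>|lborel. g \<eta> * ?e k \<eta>)) = (\<Sum>k<J. t ^ k * taylor_part k g x)"
  proof (rule sum.cong[OF refl])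
    fix k
    have "(LINT \<eta>|lborel. g \<eta> * ?e k \<eta>) = complex_of_real (t ^ k) * (LINT \<eta>|lborel. g \<eta> * exp_term k (\<eta> \<bullet> x))"
      unfolding e by (subst integral_mult_right_zero[symmetric]) (simp only: mult_ac)
    then show "Re (LINT \<eta>|lborel. g \<eta> * ?e k \<eta>) = t ^ k * taylor_part k g x"
      by (simp only: taylor_part_def Re_of_real_mult)
  qed
  finally show ?thesis by simp
qed

lemma taylor_part_scale: "taylor_part k g (t *\<^sub>R x) = t ^ k * taylor_part k g x"
proof -
  have "(LINT \<eta>|lborel. g \<eta> * exp_term k (\<eta> \<bullet> (t *\<^sub>R x))) = complex_of_real (t ^ k) * (LINT \<eta>|lborel. g \<eta> * exp_term k (\<eta> \<bullet> x))"
    by (subst integral_mult_right_zero[symmetric]) (simp add: exp_term_def power_mult_distrib mult_ac)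
  then show ?thesis by (simp only: taylor_part_def Re_of_real_mult)
qed

lemma taylor_rem_bound:
  fixes g :: "'a::euclidean_space \<Rightarrow> complex"
  assumes "1 \<le> A" "norm x \<le> A" "integrable lborel g" "\<And>\<eta>. norm \<eta> > 1 \<Longrightarrow> g \<eta> = 0"
  shows "\<bar>taylor_rem J 1 g x\<bar> \<le> A ^ J * (LINT \<eta>|lborel. cmod (g \<eta>) * norm \<eta> ^ J)"
  using smooth_bdd_bound[OF smooth_bdd_taylor_rem[OF assms(1) _ _ assms(3,4), of 1 0 J], of x] assms(2) by simp

section \<open>Polynomials of bounded order\<close>

lemma polynomials_of_order_const: "0 < q \<Longrightarrow> (\<lambda>_. c) \<in> polynomials_of_order q"
  unfolding polynomials_of_order_def
  by (rule CollectI, rule exI[of _ "{\<lambda>_. 0}"], rule exI[of _ "\<lambda>_. c"]) auto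

lemma polynomials_of_order_mono: "q \<le> q' \<Longrightarrow> polynomials_of_order q \<subseteq> polynomials_of_order q'"
  unfolding polynomials_of_order_def by (fastforce intro: less_le_trans)

lemma polynomials_of_order_add:
  assumes "p \<in> polynomials_of_order q" "p' \<in> polynomials_of_order q"
  shows "(\<lambda>x. p x + p' x) \<in> polynomials_of_order q"
proof -
  obtain A c where A: "finite A" "\<forall>\<alpha>\<in>A. (\<Sum>i\<in>UNIV. \<alpha> i) < q" "p = (\<lambda>x. \<Sum>\<alpha>\<in>A. c \<alpha> * (\<Prod>i\<in>UNIV. (x $ i) ^ \<alpha> i))"
    using assms unfolding polynomials_of_order_def by blast
  obtain A' c' where A': "finite A'" "\<forall>\<alpha>\<in>A'. (\<Sum>i\<in>UNIV. \<alpha> i) < q" "p' = (\<lambda>x. \<Sum>\<alpha>\<in>A'. c' \<alpha> * (\<Prod>i\<in>UNIV. (x $ i) ^ \<alpha> i))"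
    using assms unfolding polynomials_of_order_def by blast
  define C where "C \<alpha> = (if \<alpha> \<in> A then c \<alpha> else 0) + (if \<alpha> \<in> A' then c' \<alpha> else 0)" for \<alpha>
  have "(\<Sum>\<alpha>\<in>A \<union> A'. C \<alpha> * f \<alpha>) = (\<Sum>\<alpha>\<in>A. c \<alpha> * f \<alpha>) + (\<Sum>\<alpha>\<in>A'. c' \<alpha> * f \<alpha>)" for f
  proof -
    have "(\<Sum>\<alpha>\<in>A \<union> A'. C \<alpha> * f \<alpha>) = (\<Sum>\<alpha>\<in>A \<union> A'. if \<alpha> \<in> A then c \<alpha> * f \<alpha> else 0) + (\<Sum>\<alpha>\<in>A \<union> A'. if \<alpha> \<in> A' then c' \<alpha> * f \<alpha> else 0)"
      unfolding C_def sum.distrib[symmetric] by (intro sum.cong refl) (auto simp: distrib_right)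
    also have "(\<Sum>\<alpha>\<in>A \<union> A'. if \<alpha> \<in> A then c \<alpha> * f \<alpha> else 0) = (\<Sum>\<alpha>\<in>A. c \<alpha> * f \<alpha>)"
      using A A' by (intro sum.mono_neutral_cong_right) auto
    also have "(\<Sum>\<alpha>\<in>A \<union> A'. if \<alpha> \<in> A' then c' \<alpha> * f \<alpha> else 0) = (\<Sum>\<alpha>\<in>A'. c' \<alpha> * f \<alpha>)"
      using A A' by (intro sum.mono_neutral_cong_right) auto
    finally show ?thesis .
  qed
  then have "(\<lambda>x. p x + p' x) = (\<lambda>x. \<Sum>\<alpha>\<in>A \<union> A'. C \<alpha> * (\<Prod>i\<in>UNIV. (x $ i) ^ \<alpha> i))"
    unfolding A(3) A'(3) by simp
  then show ?thesis unfolding polynomials_of_order_def using A A'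
    by (intro CollectI exI[of _ "A \<union> A'"] exI[of _ C]) auto
qed

lemma polynomials_of_order_sum:
  "finite I \<Longrightarrow> 0 < q \<Longrightarrow> (\<And>i. i \<in> I \<Longrightarrow> p i \<in> polynomials_of_order q) \<Longrightarrow> (\<lambda>x. \<Sum>i\<in>I. p i x) \<in> polynomials_of_order q"
  by (induction I rule: finite_induct) (auto intro: polynomials_of_order_const polynomials_of_order_add)

lemma polynomials_of_order_coord:
  assumes "p \<in> polynomials_of_order q" shows "(\<lambda>x. x $ i * p x) \<in> polynomials_of_order (Suc q)"
proof -
  obtain A c where A: "finite A" "\<forall>\<alpha>\<in>A. (\<Sum>i\<in>UNIV. \<alpha> i) < q" "p = (\<lambda>x. \<Sum>\<alpha>\<in>A. c \<alpha> * (\<Prod>i\<in>UNIV. (x $ i) ^ \<alpha> i))"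
    using assms unfolding polynomials_of_order_def by blast
  \<comment> \<open>S multiplies a monomial by the i-th coordinate; its left inverse T pulls the
    coefficients back along the reindexing.\<close>
  define S where "S \<alpha> = \<alpha>(i := Suc (\<alpha> i))" for \<alpha> :: "'a \<Rightarrow> nat"
  define T where "T \<alpha> = \<alpha>(i := \<alpha> i - 1)" for \<alpha> :: "'a \<Rightarrow> nat"
  have TS: "T (S \<alpha>) = \<alpha>" for \<alpha> by (simp add: S_def T_def)
  then have inj: "inj_on S A" by (metis inj_onI)
  have mono: "(\<Prod>j\<in>UNIV. (x $ j) ^ S \<alpha> j) = x $ i * (\<Prod>j\<in>UNIV. (x $ j) ^ \<alpha> j)" for \<alpha> and x :: "real^'a"
    by (subst (1 2) prod.remove[of _ i]) (auto simp: S_def intro!: prod.cong)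
  have deg: "(\<Sum>j\<in>UNIV. S \<alpha> j) = Suc (\<Sum>j\<in>UNIV. \<alpha> j)" for \<alpha>
    by (subst (1 2) sum.remove[of _ i]) (auto simp: S_def intro!: sum.cong)
  have "(\<lambda>x. x $ i * p x) = (\<lambda>x. \<Sum>\<alpha>\<in>S ` A. c (T \<alpha>) * (\<Prod>j\<in>UNIV. (x $ j) ^ \<alpha> j))"
    unfolding A(3) sum.reindex[OF inj] by (simp add: TS mono sum_distrib_left mult_ac)
  then show ?thesis unfolding polynomials_of_order_def using A
    by (intro CollectI exI[of _ "S ` A"] exI[of _ "\<lambda>\<alpha>. c (T \<alpha>)"]) (auto simp: deg)
qed

text \<open>Induction over k with varying density: as \<eta>.x is the sum of the \<eta>_i x_i, the
  part of degree k + 1 is the sum of x_i times the part of degree k for g multiplied by the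
  imaginary unit, by \<eta>_i and by 1 / (k + 1). This bypasses multinomial coefficients.\<close>

lemma taylor_part_polynomial:
  fixes g :: "real^'d \<Rightarrow> complex"
  assumes "integrable lborel g" "\<And>\<eta>. norm \<eta> > 1 \<Longrightarrow> g \<eta> = 0"
  shows "taylor_part k g \<in> polynomials_of_order (Suc k)"
  using assms
proof (induction k arbitrary: g)
  case 0
  show ?case unfolding taylor_part_def[abs_def] by (simp add: polynomials_of_order_const)
next
  case (Suc k)
  define G where "G i \<eta> = g \<eta> * (\<i> * complex_of_real (\<eta> $ i / real (Suc k)))" for i and \<eta> :: "real^'d"
  have G: "integrable lborel (G i)" "norm \<eta> > 1 \<Longrightarrow> G i \<eta> = 0" for i \<eta>
  proof -
    show "integrable lborel (G i)" unfolding G_def[abs_def]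
      by (intro integrable_supported_mult[OF Suc.prems] continuous_intros; simp)
  qed (use Suc.prems in \<open>simp add: G_def\<close>)
  have e: "g \<eta> * exp_term (Suc k) (\<eta> \<bullet> x) = (\<Sum>i\<in>UNIV. complex_of_real (x $ i) * (G i \<eta> * exp_term k (\<eta> \<bullet> x)))" for \<eta> x
  proof -
    have "g \<eta> * exp_term (Suc k) (\<eta> \<bullet> x) = (\<Sum>i\<in>UNIV. complex_of_real (\<eta> $ i * x $ i)) * (g \<eta> * (\<i> / of_nat (Suc k) * exp_term k (\<eta> \<bullet> x)))"
    proof -
      have "(\<Sum>i\<in>UNIV. complex_of_real (\<eta> $ i * x $ i)) = complex_of_real (\<eta> \<bullet> x)" by (simp add: inner_vec_def)
      then show ?thesis by (simp only: exp_term_Suc divide_inverse mult_ac)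
    qed
    also have "\<dots> = (\<Sum>i\<in>UNIV. complex_of_real (x $ i) * (G i \<eta> * exp_term k (\<eta> \<bullet> x)))"
      unfolding sum_distrib_right by (intro sum.cong refl) (simp add: G_def field_simps del: of_nat_Suc)
    finally show ?thesis .
  qed
  have "taylor_part (Suc k) g x = (\<Sum>i\<in>UNIV. x $ i * taylor_part k (G i) x)" for x
  proof -
    have "integrable lborel (\<lambda>\<eta>. G i \<eta> * exp_term k (\<eta> \<bullet> x))" for i
      by (intro integrable_supported_mult[OF G] continuous_intros; assumption)
    then have "(LINT \<eta>|lborel. g \<eta> * exp_term (Suc k) (\<eta> \<bullet> x)) = (\<Sum>i\<in>UNIV. complex_of_real (x $ i) * (LINT \<eta>|lborel. G i \<eta> * exp_term k (\<eta> \<bullet> x)))"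
      unfolding e by simp
    then show ?thesis unfolding taylor_part_def by (simp only: Re_sum Re_of_real_mult)
  qed
  then have "taylor_part (Suc k) g = (\<lambda>x. \<Sum>i\<in>UNIV. x $ i * taylor_part k (G i) x)" by (rule ext)
  moreover have "taylor_part k (G i) \<in> polynomials_of_order (Suc k)" for i
    by (rule Suc.IH[OF G])
  ultimately show ?case
    by (simp only:) (intro polynomials_of_order_sum polynomials_of_order_coord finite zero_less_Suc)
qed

section \<open>The stencil error\<close>

lemma le_zero_of_powr_bound:
  fixes X K a :: real
  assumes a: "0 < a" and K: "0 \<le> K" and b: "\<And>t. 0 < t \<Longrightarrow> t \<le> 1 \<Longrightarrow> X \<le> K * t powr a"
  shows "X \<le> 0"
proof (rule field_le_epsilon)
  fix e :: real assume e: "0 < e"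
  define r where "r = e / (K + 1)"
  have r: "r > 0" using e K by (simp add: r_def)
  \<comment> \<open>Chosen so that t^a \<le> r, hence K t^a \<le> e; the minimum with 1 keeps t in
    the admissible range.\<close>
  define t where "t = min 1 (r powr (1 / a))"
  have t: "0 < t" "t \<le> 1" using r by (auto simp: t_def)
  have "t powr a \<le> (r powr (1 / a)) powr a" using a t by (intro powr_mono2) (auto simp: t_def)
  also have "\<dots> = r" using a r by (simp add: powr_powr)
  finally have "K * t powr a \<le> K * r" using K by (rule mult_left_mono)
  also have "\<dots> \<le> (K + 1) * r" using r by simp
  also have "\<dots> = e" using K by (simp add: r_def)
  finally show "X \<le> 0 + e" using b[OF t] by simp
qed

lemma sobolev_space_on_lincomb:
  fixes u :: "real^'d \<Rightarrow> real"
  assumes m: "m > real CARD('d) / 2" and "u \<in> sobolev_space_on m \<Omega>" "v \<in> sobolev_space_on m \<Omega>"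
  shows "(\<lambda>x. a * u x + b * v x) \<in> sobolev_space_on m \<Omega>"
proof -
  obtain u' v' where *: "u' \<in> sobolev_space m" "v' \<in> sobolev_space m" "\<forall>x\<in>\<Omega>. u' x = u x" "\<forall>x\<in>\<Omega>. v' x = v x"
    using assms unfolding sobolev_space_on_def by blast
  have "(\<lambda>x. a * u' x + b * v' x) \<in> sobolev_space m" by (rule sobolev_space_lincomb[OF m *(1,2)])
  then show ?thesis unfolding sobolev_space_on_def using *(3,4) by (intro CollectI bexI[of _ "\<lambda>x. a * u' x + b * v' x"]) auto
qed

lemma sobolev_functional_lincomb:
  assumes "sobolev_functional m \<Omega> L" "u \<in> sobolev_space_on m \<Omega>" "v \<in> sobolev_space_on m \<Omega>"
  shows "L (\<lambda>x. a * u x + b * v x) = a * L u + b * L v"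
  using assms unfolding sobolev_functional_def by blast

lemma sobolev_functional_scale:
  assumes "sobolev_functional m \<Omega> L" "u \<in> sobolev_space_on m \<Omega>"
  shows "L (\<lambda>x. a * u x) = a * L u"
  using sobolev_functional_lincomb[OF assms assms(2), of a 0] by simp

lemma sobolev_functional_sum:
  fixes f :: "'i \<Rightarrow> real^'d \<Rightarrow> real"
  assumes m: "m > real CARD('d) / 2" and L: "sobolev_functional m \<Omega> L"
    and "finite I" "\<And>i. i \<in> I \<Longrightarrow> f i \<in> sobolev_space_on m \<Omega>"
  shows "(\<lambda>x. \<Sum>i\<in>I. c i * f i x) \<in> sobolev_space_on m \<Omega> \<and> L (\<lambda>x. \<Sum>i\<in>I. c i * f i x) = (\<Sum>i\<in>I. c i * L (f i))"
  using assms(3,4)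
proof (induction I rule: finite_induct)
  case empty
  have "(\<lambda>_. 0) \<in> sobolev_space_on m \<Omega>"
    using spectral_density_zero[of m] by (auto simp: sobolev_space_on_def sobolev_space_def)
  then show ?case using sobolev_functional_scale[OF L, of "\<lambda>_. 0" 0] by simp
next
  case (insert i I)
  let ?S = "\<lambda>x. \<Sum>i\<in>I. c i * f i x"
  have IH: "?S \<in> sobolev_space_on m \<Omega>" "L ?S = (\<Sum>i\<in>I. c i * L (f i))" using insert by auto
  have f: "f i \<in> sobolev_space_on m \<Omega>" using insert by simp
  have e: "(\<lambda>x. \<Sum>i\<in>insert i I. c i * f i x) = (\<lambda>x. c i * f i x + 1 * ?S x)"
    using insert.hyps by simp
  show ?case unfolding e
    using sobolev_space_on_lincomb[OF m f IH(1), of "c i" 1] sobolev_functional_lincomb[OF L f IH(1), of "c i" 1] IH(2) insert.hyps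
    by simp
qed

text \<open>
  By homogeneity \<open>L v = t powr (- s) * L (v (t \<cdot>))\<close>; letting t tend to 0 in the Taylor expansion of
  \<open>v (t \<cdot>)\<close> shows that L sees only the Taylor part of degree s of a band-limited function v
  (the other parts are annihilated), although L is not known to be a differential operator.
\<close>

lemma functional_band_limited:
  fixes L :: "(real^'d \<Rightarrow> real) \<Rightarrow> real" and \<Omega> :: "(real^'d) set"
  assumes m: "m > real CARD('d) / 2" and R: "0 \<le> R" "\<Omega> \<subseteq> cball 0 R"
    and L: "sobolev_functional m \<Omega> L" and s: "scaling_order m \<Omega> L s" and J: "s < real J"
  shows "\<exists>C\<ge>0. \<forall>v g. spectral_density m v g \<longrightarrow> (\<forall>\<eta>. norm \<eta> > 1 \<longrightarrow> g \<eta> = 0) \<longrightarrow>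
     L v = (\<Sum>k<J. L (taylor_part k g)) \<and>
     (\<forall>k<J. \<bar>L (taylor_part k g)\<bar> \<le> C * (LINT \<eta>|lborel. cmod (g \<eta>) * norm \<eta> ^ k))"
proof -
  obtain n :: nat where n: "real n > m + real CARD('d) / 2" using reals_Archimedean2 by blast
  obtain C0 where C0: "C0 \<ge> 0" "\<And>(f::real^'d \<Rightarrow> real) M. smooth_bdd n (cball 0 (R + 1)) M f \<Longrightarrow> 0 \<le> M \<Longrightarrow>
      \<exists>v g. spectral_density m v g \<and> energy m g \<le> (C0 * M)\<^sup>2 \<and> (\<forall>x. norm x \<le> R \<longrightarrow> v x = f x)"
    using spectral_density_extension[OF m n R(1)] by blast
  obtain B where B: "0 \<le> B" "\<And>u v g. spectral_density m v g \<Longrightarrow> (\<And>x. x \<in> \<Omega> \<Longrightarrow> v x = u x) \<Longrightarrow>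
      \<bar>L u\<bar> \<le> B * sqrt (energy m g)"
    using sobolev_functional_bound[OF L] by metis
  \<comment> \<open>Every function with derivatives bounded on the ball of radius R + 1 is an
    admissible argument of L, and its value is at most a multiple of the derivative bound.\<close>
  have smooth: "f \<in> sobolev_space_on m \<Omega> \<and> \<bar>L f\<bar> \<le> B * (C0 * M)"
    if f: "smooth_bdd n (cball 0 (R + 1)) M f" "0 \<le> M" for f M
  proof -
    obtain v g where v: "spectral_density m v g" "energy m g \<le> (C0 * M)\<^sup>2" "\<forall>x. norm x \<le> R \<longrightarrow> v x = f x"
      using C0(2)[OF f] by blast
    have eq: "v x = f x" if "x \<in> \<Omega>" for x using v(3) R that by auto
    have "f \<in> sobolev_space_on m \<Omega>"
      using v(1) eq unfolding sobolev_space_on_def sobolev_space_def by blast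
    moreover have "\<bar>L f\<bar> \<le> B * sqrt (energy m g)" by (rule B(2)[OF v(1) eq])
    moreover have "sqrt (energy m g) \<le> C0 * M" using v(2) C0(1) f(2) by (intro real_le_lsqrt) auto
    ultimately show ?thesis using B(1) by (meson mult_left_mono order_trans)
  qed
  show ?thesis
  proof (intro exI[of _ "B * (C0 * (R + 1) ^ J)"] conjI allI impI)
    show "0 \<le> B * (C0 * (R + 1) ^ J)" using B C0 R by simp
    fix v g assume v: "spectral_density m v g" and g0: "\<forall>\<eta>::real^'d. norm \<eta> > 1 \<longrightarrow> g \<eta> = 0"
    have gi: "integrable lborel g" by (rule finite_energy_integrable(1)[OF m spectral_density_finite_energy[OF v]])
    have gs: "norm \<eta> > 1 \<Longrightarrow> g \<eta> = 0" for \<eta> using g0 by blast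
    define I where "I k = (LINT \<eta>|lborel. cmod (g \<eta>) * norm \<eta> ^ k)" for k
    have I0: "I k \<ge> 0" for k unfolding I_def by (intro Bochner_Integration.integral_nonneg) simp
    have Q: "taylor_part k g \<in> sobolev_space_on m \<Omega> \<and> \<bar>L (taylor_part k g)\<bar> \<le> B * (C0 * ((R + 1) ^ k * I k))" for k
      using smooth_bdd_taylor_part[OF _ gi gs, of "R + 1" n k] R I0[of k] unfolding I_def by (intro smooth) auto
    show "\<bar>L (taylor_part k g)\<bar> \<le> B * (C0 * (R + 1) ^ J) * (LINT \<eta>|lborel. cmod (g \<eta>) * norm \<eta> ^ k)" if "k < J" for k
    proof -
      have "(R + 1) ^ k * I k \<le> (R + 1) ^ J * I k" using R I0[of k] that by (intro mult_right_mono power_increasing) auto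
      then have "B * (C0 * ((R + 1) ^ k * I k)) \<le> B * (C0 * ((R + 1) ^ J * I k))"
        using B C0 by (intro mult_left_mono) auto
      then show ?thesis using Q[of k] unfolding I_def[symmetric] by (simp add: mult.assoc)
    qed
    have vs: "v \<in> sobolev_space_on m \<Omega>" using v by (auto simp: sobolev_space_on_def sobolev_space_def)
    \<comment> \<open>The scaling order of L and the homogeneity of the Taylor part each extract a
      power of t. The resulting equality is used as it stands, so no case distinction on s = k
      arises.\<close>
    have hom: "t ^ k * L (taylor_part k g) = t powr s * L (taylor_part k g)" if "0 < t" "t \<le> 1" for t k
    proof -
      have "t powr s * L (taylor_part k g) = L (\<lambda>x. taylor_part k g (t *\<^sub>R x))"
        using s Q that unfolding scaling_order_def by simp
      also have "\<dots> = t ^ k * L (taylor_part k g)"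
        unfolding taylor_part_scale using Q by (intro sobolev_functional_scale[OF L]) auto
      finally show ?thesis by (rule sym)
    qed
    \<comment> \<open>X does not depend on t, whereas t^s X is the value of L at the remainder and
      thus of order t^J; since J > s, letting t tend to 0 gives X = 0.\<close>
    define X where "X = L v - (\<Sum>k<J. L (taylor_part k g))"
    have "\<bar>X\<bar> \<le> B * (C0 * ((R + 1) ^ J * I J)) * t powr (real J - s)" if t: "0 < t" "t \<le> 1" for t
    proof -
      have T: "taylor_rem J t g \<in> sobolev_space_on m \<Omega> \<and> \<bar>L (taylor_rem J t g)\<bar> \<le> B * (C0 * (t ^ J * (R + 1) ^ J * I J))"
        using smooth_bdd_taylor_rem[OF _ _ _ gi gs, of "R + 1" t n J] R I0[of J] t unfolding I_def by (intro smooth) auto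
      have S: "(\<lambda>x. \<Sum>k<J. t ^ k * taylor_part k g x) \<in> sobolev_space_on m \<Omega> \<and>
           L (\<lambda>x. \<Sum>k<J. t ^ k * taylor_part k g x) = (\<Sum>k<J. t ^ k * L (taylor_part k g))"
        using Q by (intro sobolev_functional_sum[OF m L]) auto
      have "t powr s * L v = L (\<lambda>x. v (t *\<^sub>R x))"
        using s vs t unfolding scaling_order_def by simp
      also have "(\<lambda>x. v (t *\<^sub>R x)) = (\<lambda>x. 1 * (\<Sum>k<J. t ^ k * taylor_part k g x) + 1 * taylor_rem J t g x)"
      proof (rule ext)
        fix x
        show "v (t *\<^sub>R x) = 1 * (\<Sum>k<J. t ^ k * taylor_part k g x) + 1 * taylor_rem J t g x"
          using taylor_expansion[OF gi gs, of v t x J] spectral_density_integral[OF v, of "t *\<^sub>R x"] by simp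
      qed
      also have "L \<dots> = (\<Sum>k<J. t ^ k * L (taylor_part k g)) + L (taylor_rem J t g)"
        using sobolev_functional_lincomb[OF L, of _ _ 1 1] S T by simp
      also have "(\<Sum>k<J. t ^ k * L (taylor_part k g)) = t powr s * (\<Sum>k<J. L (taylor_part k g))"
        unfolding hom[OF t] by (simp add: sum_distrib_left)
      finally have "t powr s * X = L (taylor_rem J t g)" by (simp add: X_def algebra_simps)
      then have "t powr s * \<bar>X\<bar> \<le> B * (C0 * (t ^ J * (R + 1) ^ J * I J))"
        using T by (metis abs_mult abs_of_nonneg powr_ge_zero)
      then have "t powr (- s) * (t powr s * \<bar>X\<bar>) \<le> t powr (- s) * (B * (C0 * (t ^ J * (R + 1) ^ J * I J)))"
        by (rule mult_left_mono) simp
      moreover have "t powr (- s) * (t powr s * \<bar>X\<bar>) = \<bar>X\<bar>"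
        using t by (simp add: mult.assoc[symmetric] powr_add[symmetric])
      moreover have "t powr (- s) * t ^ J = t powr (real J - s)"
        using t by (simp add: powr_diff powr_minus powr_realpow divide_inverse)
      moreover have "t powr (- s) * (B * (C0 * (t ^ J * (R + 1) ^ J * I J))) = B * (C0 * ((R + 1) ^ J * I J)) * (t powr (- s) * t ^ J)"
        by (simp only: mult_ac)
      ultimately show ?thesis by (simp only:)
    qed
    then have "\<bar>X\<bar> \<le> 0"
      using J B C0 R I0[of J] by (intro le_zero_of_powr_bound[of "real J - s" "B * (C0 * ((R + 1) ^ J * I J))"]) auto
    then show "L v = (\<Sum>k<J. L (taylor_part k g))" by (simp add: X_def)
  qed
qed

text \<open>Exactness cancels the Taylor parts of degree below q. What remains is, for L, the
  degrees from q to J - 1 and, for the stencil, the remainder of order q. Both are controlled by the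
  moment of order q alone, because |\<eta>| \<le> 1 on the support makes higher moments
  smaller.\<close>

lemma stencil_error_band_limited:
  fixes L :: "(real^'d \<Rightarrow> real) \<Rightarrow> real" and \<Omega> :: "(real^'d) set" and x :: "'n::finite \<Rightarrow> real^'d"
  assumes m: "m > real CARD('d) / 2" and R: "0 \<le> R" "\<Omega> \<subseteq> cball 0 R" and x: "range x \<subseteq> \<Omega>"
    and L: "sobolev_functional m \<Omega> L" and s: "scaling_order m \<Omega> L s" and ex: "stencil_exact L x a q"
  shows "\<exists>C\<ge>0. \<forall>v g. spectral_density m v g \<longrightarrow> (\<forall>\<eta>. norm \<eta> > 1 \<longrightarrow> g \<eta> = 0) \<longrightarrow>
     \<bar>L v - (\<Sum>j\<in>UNIV. a $ j * v (x j))\<bar> \<le> C * (LINT \<eta>|lborel. cmod (g \<eta>) * norm \<eta> ^ q)"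
proof -
  obtain J0 :: nat where J0: "s < real J0" using reals_Archimedean2 by blast
  \<comment> \<open>J has to exceed s for the finite expansion of L and to reach q for the
    cancellation.\<close>
  define J where "J = q + J0"
  have J: "s < real J" "q \<le> J" using J0 by (auto simp: J_def)
  obtain C where C: "C \<ge> 0" "\<And>v g. spectral_density m v g \<Longrightarrow> (\<forall>\<eta>. norm \<eta> > 1 \<longrightarrow> g \<eta> = 0) \<Longrightarrow>
     L v = (\<Sum>k<J. L (taylor_part k g)) \<and>
     (\<forall>k<J. \<bar>L (taylor_part k g)\<bar> \<le> C * (LINT \<eta>|lborel. cmod (g \<eta>) * norm \<eta> ^ k))"
    using functional_band_limited[OF m R L s J(1)] by blast
  show ?thesis
  proof (intro exI[of _ "real J * C + (\<Sum>j\<in>UNIV. \<bar>a $ j\<bar>) * (R + 1) ^ q"] conjI allI impI)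
    show "0 \<le> real J * C + (\<Sum>j\<in>UNIV. \<bar>a $ j\<bar>) * (R + 1) ^ q" using C(1) R by (simp add: sum_nonneg)
    fix v g assume v: "spectral_density m v g" and g0: "\<forall>\<eta>::real^'d. norm \<eta> > 1 \<longrightarrow> g \<eta> = 0"
    have gi: "integrable lborel g" by (rule finite_energy_integrable(1)[OF m spectral_density_finite_energy[OF v]])
    have gs: "norm \<eta> > 1 \<Longrightarrow> g \<eta> = 0" for \<eta> using g0 by blast
    define I where "I k = (LINT \<eta>|lborel. cmod (g \<eta>) * norm \<eta> ^ k)" for k
    have mom: "integrable lborel (\<lambda>\<eta>. cmod (g \<eta>) * norm \<eta> ^ k)" for k
    proof -
      have "integrable lborel (\<lambda>\<eta>. g \<eta> * complex_of_real (norm \<eta> ^ k))"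
        by (intro integrable_supported_mult[OF gi gs] continuous_intros; assumption)
      from integrable_norm[OF this] show ?thesis by (simp add: norm_mult norm_power)
    qed
    have I: "I k \<le> I q" if "q \<le> k" for k
      unfolding I_def
    proof (rule integral_mono[OF mom mom])
      fix \<eta> :: "real^'d"
      show "cmod (g \<eta>) * norm \<eta> ^ k \<le> cmod (g \<eta>) * norm \<eta> ^ q"
        using gs[of \<eta>] that by (cases "norm \<eta> \<le> 1") (auto intro!: mult_left_mono power_decreasing)
    qed
    have Iq: "I q \<ge> 0" unfolding I_def by (intro Bochner_Integration.integral_nonneg) simp
    have b: "\<bar>L (taylor_part k g)\<bar> \<le> C * I k" if "k < J" for k
      using C(2)[OF v g0] that unfolding I_def by blast
    have exact: "L (taylor_part k g) = (\<Sum>j\<in>UNIV. a $ j * taylor_part k g (x j))" if "k < q" for k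
      using ex taylor_part_polynomial[OF gi gs, of k] polynomials_of_order_mono[of "Suc k" q] that
      unfolding stencil_exact_def by (auto simp: Suc_le_eq)
    have "v y = (\<Sum>k<q. taylor_part k g y) + taylor_rem q 1 g y" for y
      using taylor_expansion[OF gi gs, of v 1 y q] spectral_density_integral[OF v, of y] by simp
    then have vx: "(\<Sum>j\<in>UNIV. a $ j * v (x j)) = (\<Sum>k<q. L (taylor_part k g)) + (\<Sum>j\<in>UNIV. a $ j * taylor_rem q 1 g (x j))"
      using exact by (simp add: distrib_left sum.distrib sum_distrib_left) (rule sum.swap)
    have "L v = (\<Sum>k<J. L (taylor_part k g))" using C(2)[OF v g0] by blast
    also have "\<dots> = (\<Sum>k<q. L (taylor_part k g)) + (\<Sum>k=q..<J. L (taylor_part k g))"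
      using J(2) by (simp add: lessThan_atLeast0 sum.atLeastLessThan_concat)
    finally have "\<bar>L v - (\<Sum>j\<in>UNIV. a $ j * v (x j))\<bar> = \<bar>(\<Sum>k=q..<J. L (taylor_part k g)) - (\<Sum>j\<in>UNIV. a $ j * taylor_rem q 1 g (x j))\<bar>"
      unfolding vx by simp
    also have "\<dots> \<le> \<bar>\<Sum>k=q..<J. L (taylor_part k g)\<bar> + \<bar>\<Sum>j\<in>UNIV. a $ j * taylor_rem q 1 g (x j)\<bar>" by (rule abs_triangle_ineq4)
    also have "\<bar>\<Sum>k=q..<J. L (taylor_part k g)\<bar> \<le> (\<Sum>k=q..<J. \<bar>L (taylor_part k g)\<bar>)" by (rule sum_abs)
    also have "\<dots> \<le> (\<Sum>k=q..<J. C * I q)"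
    proof (rule sum_mono)
      fix k assume "k \<in> {q..<J}"
      then show "\<bar>L (taylor_part k g)\<bar> \<le> C * I q"
        using b[of k] mult_left_mono[OF I[of k] C(1)] by simp
    qed
    also have "\<dots> \<le> real J * (C * I q)"
      using C(1) Iq by (simp only: sum_constant card_atLeastLessThan) (intro mult_right_mono, auto)
    also have "\<dots> = real J * C * I q" by (simp only: mult.assoc)
    also have "\<bar>\<Sum>j\<in>UNIV. a $ j * taylor_rem q 1 g (x j)\<bar> \<le> (\<Sum>j\<in>UNIV. \<bar>a $ j * taylor_rem q 1 g (x j)\<bar>)" by (rule sum_abs)
    also have "\<dots> \<le> (\<Sum>j\<in>UNIV. \<bar>a $ j\<bar> * ((R + 1) ^ q * I q))"
    proof (rule sum_mono)
      fix j
      have "x j \<in> cball 0 R" using x R(2) by blast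
      then have "norm (x j) \<le> R + 1" by simp
      then have "\<bar>taylor_rem q 1 g (x j)\<bar> \<le> (R + 1) ^ q * I q"
        unfolding I_def using R by (intro taylor_rem_bound gi gs) auto
      then show "\<bar>a $ j * taylor_rem q 1 g (x j)\<bar> \<le> \<bar>a $ j\<bar> * ((R + 1) ^ q * I q)"
        unfolding abs_mult by (rule mult_left_mono) simp
    qed
    also have "\<dots> = (\<Sum>j\<in>UNIV. \<bar>a $ j\<bar>) * (R + 1) ^ q * I q" by (simp add: sum_distrib_right mult.assoc)
    finally show "\<bar>L v - (\<Sum>j\<in>UNIV. a $ j * v (x j))\<bar> \<le> (real J * C + (\<Sum>j\<in>UNIV. \<bar>a $ j\<bar>) * (R + 1) ^ q) * (LINT \<eta>|lborel. cmod (g \<eta>) * norm \<eta> ^ q)"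
      unfolding I_def by (simp add: distrib_right)
  qed
qed

section \<open>Splitting into low and high frequencies\<close>

lemma integral_hermitian_real:
  fixes g :: "real^'d \<Rightarrow> complex"
  assumes [measurable]: "g \<in> borel_measurable borel" and h: "\<And>w. cnj (g (- w)) = g w"
  shows "complex_of_real (Re (LINT w|lborel. g w * cis (w \<bullet> x))) = (LINT w|lborel. g w * cis (w \<bullet> x))"
proof -
  have "(LINT w|lborel. g w * cis (w \<bullet> x)) = (LINT w|lborel. g (0 + (- 1) *\<^sub>R w) * cis ((0 + (- 1) *\<^sub>R w) \<bullet> x))"
    by (subst integral_affine_lborel[of _ "- 1" 0]) auto
  also have "\<dots> = (LINT w|lborel. cnj (g w * cis (w \<bullet> x)))"
  proof (intro Bochner_Integration.integral_cong refl)
    fix w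
    have "g (- w) = cnj (g w)" using h[of "- w"] by simp
    then show "g (0 + (- 1) *\<^sub>R w) * cis ((0 + (- 1) *\<^sub>R w) \<bullet> x) = cnj (g w * cis (w \<bullet> x))"
      by (simp add: cis_cnj)
  qed
  also have "\<dots> = cnj (LINT w|lborel. g w * cis (w \<bullet> x))" by (rule Bochner_Integration.integral_cnj)
  finally show ?thesis by (simp add: complex_eq_iff)
qed

lemma finite_energy_restrict:
  assumes g: "finite_energy m g" and [measurable]: "S \<in> sets borel"
  shows "finite_energy m (\<lambda>w. indicator S w * g w)"
  unfolding finite_energy_def
proof
  have [measurable]: "g \<in> borel_measurable borel" by (rule finite_energy_measurable[OF g])
  show "(\<lambda>w. indicator S w * g w) \<in> borel_measurable borel" by measurable
  show "integrable lborel (\<lambda>w. sobolev_weight m w * (cmod (indicator S w * g w))\<^sup>2)"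
  proof (rule Bochner_Integration.integrable_bound)
    show "integrable lborel (\<lambda>w. sobolev_weight m w * (cmod (g w))\<^sup>2)" using g by (simp add: finite_energy_def)
    show "AE w in lborel. norm (sobolev_weight m w * (cmod (indicator S w * g w))\<^sup>2) \<le> norm (sobolev_weight m w * (cmod (g w))\<^sup>2)"
      by (rule AE_I2) (auto simp: indicator_def abs_mult)
  qed measurable
qed

text \<open>In the variable \<eta> = h w this is the moment of order q of the density of u(h x) over
  the unit ball; the variable w makes it comparable with the energy of g.\<close>

definition low_part :: "nat \<Rightarrow> real \<Rightarrow> (real^'d \<Rightarrow> complex) \<Rightarrow> real" where
  "low_part q h g = (LINT w|lborel. indicator (cball 0 (1 / h)) w * (cmod (g w) * (h * norm w) ^ q))"

lemma low_part_nonneg: "0 < h \<Longrightarrow> 0 \<le> low_part q h g"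
  unfolding low_part_def by (intro Bochner_Integration.integral_nonneg) simp

lemma stencil_error_dilate:
  fixes L :: "(real^'d \<Rightarrow> real) \<Rightarrow> real" and \<Omega> :: "(real^'d) set" and x :: "'n::finite \<Rightarrow> real^'d"
  assumes m: "m > real CARD('d) / 2" and R: "0 \<le> R" "\<Omega> \<subseteq> cball 0 R" and x: "range x \<subseteq> \<Omega>"
    and L: "sobolev_functional m \<Omega> L" and s: "scaling_order m \<Omega> L s" and ex: "stencil_exact L x a q"
  shows "\<exists>C\<ge>0. \<forall>u g h. spectral_density m u g \<longrightarrow> (\<forall>w. cnj (g (- w)) = g w) \<longrightarrow> 0 < h \<longrightarrow> h \<le> 1 \<longrightarrow>
     \<bar>L (\<lambda>y. u (h *\<^sub>R y)) - (\<Sum>j\<in>UNIV. a $ j * u (h *\<^sub>R x j))\<bar> \<le>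
       C * (low_part q h g + h powr (m - real CARD('d) / 2) * sqrt (energy m g))"
proof -
  obtain C1 where C1: "C1 \<ge> 0" "\<And>v g. spectral_density m v g \<Longrightarrow> (\<forall>\<eta>. norm \<eta> > 1 \<longrightarrow> g \<eta> = 0) \<Longrightarrow>
     \<bar>L v - (\<Sum>j\<in>UNIV. a $ j * v (x j))\<bar> \<le> C1 * (LINT \<eta>|lborel. cmod (g \<eta>) * norm \<eta> ^ q)"
    using stencil_error_band_limited[OF m R x L s ex] by blast
  obtain B where B: "0 \<le> B" "\<And>u v g. spectral_density m v g \<Longrightarrow> (\<And>x. x \<in> \<Omega> \<Longrightarrow> v x = u x) \<Longrightarrow>
      \<bar>L u\<bar> \<le> B * sqrt (energy m g)"
    using sobolev_functional_bound[OF L] by metis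
  have m0: "m > 0" using m by (auto intro: le_less_trans[rotated])
  define S0 where "S0 = sqrt (LINT w|lborel. sobolev_weight (- m) (w::real^'d))"
  have S0: "S0 \<ge> 0" by (simp add: S0_def)
  \<comment> \<open>Bounds the error of the fixed stencil on functions of energy 1: B comes from L,
    S0 from the point evaluations.\<close>
  define C2 where "C2 = B + (\<Sum>j\<in>UNIV. \<bar>a $ j\<bar>) * S0"
  have C2: "C2 \<ge> 0" using B S0 by (simp add: C2_def sum_nonneg)
  define C3 where "C3 = C2 * sqrt (2 powr m)"
  have C3: "C3 \<ge> 0" using C2 by (simp add: C3_def)
  show ?thesis
  proof (intro exI[of _ "max C1 C3"] conjI allI impI)
    show "0 \<le> max C1 C3" using C1 by simp
    fix u :: "real^'d \<Rightarrow> real" and g and h :: real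
    assume u: "spectral_density m u g" and herm: "\<forall>w. cnj (g (- w)) = g w" and h: "0 < h" "h \<le> 1"
    have [measurable]: "g \<in> borel_measurable borel" using u by (auto simp: spectral_density_def)
    define v where "v y = u (h *\<^sub>R y)" for y
    define k where "k w = complex_of_real (inverse (h ^ CARD('d))) * g (inverse h *\<^sub>R w)" for w
    have v: "spectral_density m v k"
      unfolding v_def[abs_def] k_def[abs_def] using spectral_density_dilate[OF _ u h] m0 by simp
    have fk: "finite_energy m k" by (rule spectral_density_finite_energy[OF v])
    have [measurable]: "k \<in> borel_measurable borel" by (rule finite_energy_measurable[OF fk])
    define k1 where "k1 w = indicator (cball 0 1) w * k w" for w
    define v1 where "v1 y = Re (LINT w|lborel. k1 w * cis (w \<bullet> y))" for y
    have f1: "finite_energy m k1" unfolding k1_def[abs_def] by (intro finite_energy_restrict fk) auto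
    have [measurable]: "k1 \<in> borel_measurable borel" by (rule finite_energy_measurable[OF f1])
    have herm1: "cnj (k1 (- w)) = k1 w" for w
    proof -
      have "cnj (k (- w)) = k w" using herm by (simp add: k_def)
      then show ?thesis by (simp add: k1_def indicator_def)
    qed
    \<comment> \<open>The cut at |w| = 1 is symmetric and preserves the Hermitian symmetry, so the
      low-frequency part is a real function and an admissible argument of L.\<close>
    have v1: "spectral_density m v1 k1"
      unfolding spectral_density_iff v1_def using f1 integral_hermitian_real[of k1, OF _ herm1] by auto
    define k2 where "k2 w = k w + complex_of_real (- 1) * k1 w" for w
    define v2 where "v2 y = v y + (- 1) * v1 y" for y
    have v2: "spectral_density m v2 k2"
      unfolding v2_def[abs_def] k2_def[abs_def] by (rule spectral_density_add[OF m v v1])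
    have f2: "finite_energy m k2" by (rule spectral_density_finite_energy[OF v2])
    let ?d = "CARD('d)"
    \<comment> \<open>For |w| > 1 one has 1 + |w|^2 \<le> 2 h^2 (1 + |w / h|^2), which gains 2^m
      h^(2m); the factor h^(-2d) from the density and h^d from the substitution turn this into h^(2
      m - d).\<close>
    have E2: "energy m k2 \<le> 2 powr m * (h powr (m - real ?d / 2))\<^sup>2 * energy m g"
    proof -
      have i0: "integrable lborel (\<lambda>w. sobolev_weight m w * (cmod (g w))\<^sup>2)" using u by (simp add: spectral_density_def)
      have i: "integrable lborel (\<lambda>w. sobolev_weight m (inverse h *\<^sub>R w) * (cmod (g (inverse h *\<^sub>R w)))\<^sup>2)"
        using integrable_affine_lborel[OF i0, of "inverse h" 0] h by simp
      have "energy m k2 \<le> (LINT w|lborel. 2 powr m * h powr (2 * m) * (inverse (h ^ ?d))\<^sup>2 * (sobolev_weight m (inverse h *\<^sub>R w) * (cmod (g (inverse h *\<^sub>R w)))\<^sup>2))"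
        unfolding energy_def
      proof (rule integral_mono)
        show "integrable lborel (\<lambda>w. sobolev_weight m w * (cmod (k2 w))\<^sup>2)" using f2 by (simp add: finite_energy_def)
        show "integrable lborel (\<lambda>w. 2 powr m * h powr (2 * m) * (inverse (h ^ ?d))\<^sup>2 * (sobolev_weight m (inverse h *\<^sub>R w) * (cmod (g (inverse h *\<^sub>R w)))\<^sup>2))"
          by (rule integrable_mult_right[OF i])
        fix w :: "real^'d"
        show "sobolev_weight m w * (cmod (k2 w))\<^sup>2 \<le> 2 powr m * h powr (2 * m) * (inverse (h ^ ?d))\<^sup>2 * (sobolev_weight m (inverse h *\<^sub>R w) * (cmod (g (inverse h *\<^sub>R w)))\<^sup>2)"
        proof (cases "norm w \<le> 1")
          case True
          then have "k2 w = 0" by (simp add: k2_def k1_def)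
          then show ?thesis by simp
        next
          case False
          then have "k2 w = k w" by (simp add: k2_def k1_def)
          then have c: "(cmod (k2 w))\<^sup>2 = (inverse (h ^ ?d))\<^sup>2 * (cmod (g (inverse h *\<^sub>R w)))\<^sup>2"
            using h by (simp add: k_def norm_mult norm_inverse norm_power power_mult_distrib)
          have "1 + (norm w)\<^sup>2 \<le> 2 * (norm w)\<^sup>2" using False by (simp add: one_le_power)
          also have "\<dots> = 2 * h\<^sup>2 * (norm (inverse h *\<^sub>R w))\<^sup>2"
            using h by (simp add: power_mult_distrib power_inverse)
          also have "\<dots> \<le> 2 * h\<^sup>2 * (1 + (norm (inverse h *\<^sub>R w))\<^sup>2)" by (intro mult_left_mono) auto
          finally have "sobolev_weight m w \<le> (2 * h\<^sup>2 * (1 + (norm (inverse h *\<^sub>R w))\<^sup>2)) powr m"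
            unfolding sobolev_weight_def using m0 by (intro powr_mono2) auto
          also have "\<dots> = 2 powr m * (h\<^sup>2) powr m * sobolev_weight m (inverse h *\<^sub>R w)"
            unfolding sobolev_weight_def by (simp only: powr_mult)
          also have "(h\<^sup>2) powr m = h powr (2 * m)"
            using h by (simp add: powr_powr flip: powr_numeral)
          finally have "sobolev_weight m w * (cmod (k2 w))\<^sup>2 \<le> (2 powr m * h powr (2 * m) * sobolev_weight m (inverse h *\<^sub>R w)) * (cmod (k2 w))\<^sup>2"
            by (rule mult_right_mono) simp
          then show ?thesis unfolding c by (simp only: mult_ac)
        qed
      qed
      also have "\<dots> = 2 powr m * h powr (2 * m) * (inverse (h ^ ?d))\<^sup>2 * (LINT w|lborel. sobolev_weight m (inverse h *\<^sub>R w) * (cmod (g (inverse h *\<^sub>R w)))\<^sup>2)"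
        by (rule integral_mult_right_zero)
      also have "(LINT w|lborel. sobolev_weight m (inverse h *\<^sub>R w) * (cmod (g (inverse h *\<^sub>R w)))\<^sup>2) = h ^ ?d * energy m g"
      proof -
        have "energy m g = \<bar>inverse h\<bar> ^ ?d * (LINT w|lborel. sobolev_weight m (0 + inverse h *\<^sub>R w) * (cmod (g (0 + inverse h *\<^sub>R w)))\<^sup>2)"
          unfolding energy_def using h by (subst integral_affine_lborel[of _ "inverse h" 0]) auto
        then show ?thesis using h by (simp add: field_simps)
      qed
      also have "2 powr m * h powr (2 * m) * (inverse (h ^ ?d))\<^sup>2 * (h ^ ?d * energy m g) = 2 powr m * (h powr (2 * m) * inverse (h ^ ?d)) * energy m g"
        using h by (simp add: power2_eq_square)
      also have "h powr (2 * m) * inverse (h ^ ?d) = (h powr (m - real ?d / 2))\<^sup>2"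
      proof -
        have "h powr (2 * m) * inverse (h ^ ?d) = h powr (2 * m) * h powr (- real ?d)"
          using h by (simp add: powr_minus powr_realpow)
        also have "\<dots> = h powr ((m - real ?d / 2) + (m - real ?d / 2))" unfolding powr_add[symmetric] by simp
        also have "\<dots> = (h powr (m - real ?d / 2))\<^sup>2" by (simp only: powr_add power2_eq_square)
        finally show ?thesis .
      qed
      finally show ?thesis .
    qed
    have sE2: "sqrt (energy m k2) \<le> sqrt (2 powr m) * (h powr (m - real ?d / 2) * sqrt (energy m g))"
    proof -
      have "sqrt (energy m k2) \<le> sqrt (2 powr m * (h powr (m - real ?d / 2))\<^sup>2 * energy m g)"
        using E2 by (rule real_sqrt_le_mono)
      also have "\<dots> = sqrt (2 powr m) * (h powr (m - real ?d / 2) * sqrt (energy m g))"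
        by (simp add: real_sqrt_mult)
      finally show ?thesis .
    qed
    have e2: "\<bar>L v2 - (\<Sum>j\<in>UNIV. a $ j * v2 (x j))\<bar> \<le> C3 * (h powr (m - real ?d / 2) * sqrt (energy m g))"
    proof -
      have "\<bar>L v2 - (\<Sum>j\<in>UNIV. a $ j * v2 (x j))\<bar> \<le> \<bar>L v2\<bar> + \<bar>\<Sum>j\<in>UNIV. a $ j * v2 (x j)\<bar>" by (rule abs_triangle_ineq4)
      also have "\<bar>L v2\<bar> \<le> B * sqrt (energy m k2)" by (rule B(2)[OF v2 refl])
      also have "\<bar>\<Sum>j\<in>UNIV. a $ j * v2 (x j)\<bar> \<le> (\<Sum>j\<in>UNIV. \<bar>a $ j * v2 (x j)\<bar>)" by (rule sum_abs)
      also have "\<dots> \<le> (\<Sum>j\<in>UNIV. \<bar>a $ j\<bar> * (S0 * sqrt (energy m k2)))"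
        unfolding abs_mult S0_def by (intro sum_mono mult_left_mono spectral_density_bound[OF m v2]) simp
      also have "B * sqrt (energy m k2) + \<dots> = C2 * sqrt (energy m k2)"
        by (simp add: C2_def distrib_right sum_distrib_right mult.assoc)
      also have "\<dots> \<le> C2 * (sqrt (2 powr m) * (h powr (m - real ?d / 2) * sqrt (energy m g)))"
        using sE2 C2 by (rule mult_left_mono)
      finally show ?thesis by (simp add: C3_def mult.assoc)
    qed
    have e1: "\<bar>L v1 - (\<Sum>j\<in>UNIV. a $ j * v1 (x j))\<bar> \<le> C1 * low_part q h g"
    proof -
      have "\<bar>L v1 - (\<Sum>j\<in>UNIV. a $ j * v1 (x j))\<bar> \<le> C1 * (LINT \<eta>|lborel. cmod (k1 \<eta>) * norm \<eta> ^ q)"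
        by (rule C1(2)[OF v1]) (auto simp: k1_def)
      also have "(LINT \<eta>|lborel. cmod (k1 \<eta>) * norm \<eta> ^ q) = h ^ ?d *\<^sub>R (LINT \<eta>|lborel. cmod (k1 (0 + h *\<^sub>R \<eta>)) * norm (0 + h *\<^sub>R \<eta>) ^ q)"
        using h by (subst integral_affine_lborel[of _ h 0]) auto
      also have "\<dots> = (LINT \<eta>|lborel. h ^ ?d * (cmod (k1 (0 + h *\<^sub>R \<eta>)) * norm (0 + h *\<^sub>R \<eta>) ^ q))"
        by simp
      also have "\<dots> = low_part q h g"
        unfolding low_part_def
      proof (intro Bochner_Integration.integral_cong refl)
        fix w :: "real^'d"
        have "norm (h *\<^sub>R w) \<le> 1 \<longleftrightarrow> norm w \<le> 1 / h" using h by (simp add: field_simps)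
        then have "indicator (cball 0 1) (h *\<^sub>R w) = (indicator (cball 0 (1 / h)) w :: complex)"
          by (simp add: indicator_def)
        moreover have "cmod (indicator (cball 0 (1 / h)) w) = indicator (cball 0 (1 / h)) w" by (simp add: indicator_def)
        ultimately have "cmod (k1 (h *\<^sub>R w)) = indicator (cball 0 (1 / h)) w * (inverse (h ^ ?d) * cmod (g w))"
          using h by (simp add: k1_def k_def norm_mult norm_inverse norm_power)
        then show "h ^ ?d * (cmod (k1 (0 + h *\<^sub>R w)) * norm (0 + h *\<^sub>R w) ^ q) = indicator (cball 0 (1 / h)) w * (cmod (g w) * (h * norm w) ^ q)"
          using h by simp
      qed
      finally show ?thesis .
    qed
    have vs: "v1 \<in> sobolev_space_on m \<Omega>" "v2 \<in> sobolev_space_on m \<Omega>"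
      using v1 v2 by (auto simp: sobolev_space_on_def sobolev_space_def)
    have vv: "v = (\<lambda>y. 1 * v1 y + 1 * v2 y)" by (simp add: v2_def fun_eq_iff)
    have "L v = L v1 + L v2" unfolding vv using sobolev_functional_lincomb[OF L vs, of 1 1] by simp
    moreover have "(\<Sum>j\<in>UNIV. a $ j * v (x j)) = (\<Sum>j\<in>UNIV. a $ j * v1 (x j)) + (\<Sum>j\<in>UNIV. a $ j * v2 (x j))"
      by (simp add: vv distrib_left sum.distrib)
    ultimately have "\<bar>L v - (\<Sum>j\<in>UNIV. a $ j * v (x j))\<bar> \<le>
       C1 * low_part q h g + C3 * (h powr (m - real ?d / 2) * sqrt (energy m g))"
      using e1 e2 by linarith
    also have "\<dots> \<le> max C1 C3 * low_part q h g + max C1 C3 * (h powr (m - real ?d / 2) * sqrt (energy m g))"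
      using low_part_nonneg[OF h(1), of q g] by (intro add_mono mult_right_mono) auto
    finally show "\<bar>L (\<lambda>y. u (h *\<^sub>R y)) - (\<Sum>j\<in>UNIV. a $ j * u (h *\<^sub>R x j))\<bar> \<le>
       max C1 C3 * (low_part q h g + h powr (m - real CARD('d) / 2) * sqrt (energy m g))"
      by (simp add: v_def[abs_def] distrib_left)
  qed
qed

text \<open>For negative p the function is compared with dyadic balls: where 2^(-(k+1)) < |\<eta>|
  \<le> 2^(-k) its value is at most \<open>c k\<close>, and the products of \<open>c k\<close> with
  the volume of the ball of radius 2^(-k) form a geometric series of ratio 2^(-d-p) < 1.\<close>

lemma integrable_norm_powr_cball:
  fixes p :: real
  assumes p: "- real DIM('a) < p"
  shows "integrable lborel (\<lambda>\<eta>::'a::euclidean_space. indicator (cball 0 1) \<eta> * norm \<eta> powr p)"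
proof -
  have meas: "(\<lambda>\<eta>::'a. indicator (cball 0 1) \<eta> * norm \<eta> powr p) \<in> borel_measurable borel"
    by (intro borel_measurable_times borel_measurable_indicator) auto
  show ?thesis
  proof (cases "p \<ge> 0")
    case True
    show ?thesis
    proof (rule Bochner_Integration.integrable_bound)
      show "integrable lborel (\<lambda>\<eta>::'a. indicator (cball 0 1) \<eta> :: real)"
        by (auto intro!: integrable_real_indicator emeasure_bounded_finite)
      show "AE \<eta> in lborel. norm (indicator (cball 0 1) \<eta> * norm (\<eta>::'a) powr p) \<le> norm (indicator (cball 0 1) \<eta> :: real)"
        using True by (intro AE_I2) (auto simp: indicator_def powr_le1)
      show "(\<lambda>\<eta>::'a. indicator (cball 0 1) \<eta> * norm \<eta> powr p) \<in> borel_measurable lborel" using meas by simp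
    qed
  next
    case False
    let ?f = "\<lambda>\<eta>::'a. indicator (cball 0 1) \<eta> * norm \<eta> powr p"
    define c where "c n = 2 powr (- p * real (Suc n))" for n :: nat
    define V where "V = unit_ball_vol (real DIM('a))"
    define r where "r = 2 powr (- real DIM('a) - p)"
    have V: "V \<ge> 0" by (simp add: V_def)
    have r: "0 \<le> r" "r < 1" using p by (auto simp: r_def powr_less_one)
    have le: "ennreal (?f \<eta>) \<le> (\<Sum>n. ennreal (c n) * indicator (cball 0 ((1/2) ^ n)) \<eta>)" for \<eta> :: 'a
    \<comment> \<open>By the convention \<open>0 powr p = 0\<close> the integrand has the value 0 at
      the singularity.\<close>
    proof (cases "\<eta> = 0 \<or> norm \<eta> > 1")
      case True
      then show ?thesis by (auto simp: indicator_def)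
    next
      case False
      then have e: "0 < norm \<eta>" "norm \<eta> \<le> 1" by auto
      obtain N where N: "(1/2::real) ^ N < norm \<eta>" using real_arch_pow_inv[OF e(1), of "1/2"] by auto
      define n where "n = (LEAST n. (1/2::real) ^ n < norm \<eta>)"
      have n1: "(1/2) ^ n < norm \<eta>" unfolding n_def by (rule LeastI[of "\<lambda>n. (1/2::real) ^ n < norm \<eta>", OF N])
      then obtain k where k: "n = Suc k" using e(2) by (cases n) auto
      have n2: "norm \<eta> \<le> (1/2) ^ k" using not_less_Least[of k "\<lambda>n. (1/2::real) ^ n < norm \<eta>"] k by (auto simp: n_def)
      have "norm \<eta> powr p \<le> ((1/2) ^ Suc k) powr p"
        using n1 k \<open>\<not> p \<ge> 0\<close> by (intro powr_mono2') auto
      also have "\<dots> = c k"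
      proof -
        have "(1/2::real) ^ Suc k = 2 powr (- real (Suc k))"
          by (simp only: powr_minus powr_realpow[OF zero_less_numeral]) (simp add: power_one_over inverse_eq_divide)
        then show ?thesis by (simp only: powr_powr c_def) (simp add: algebra_simps)
      qed
      finally have le: "norm \<eta> powr p \<le> c k" .
      define F where "F n = ennreal (c n) * indicator (cball 0 ((1/2) ^ n)) \<eta>" for n
      have "ennreal (?f \<eta>) \<le> F k"
        using le n2 e by (simp add: F_def indicator_def ennreal_leI)
      also have "F k = (\<Sum>n\<in>{k}. F n)" by simp
      also have "\<dots> \<le> (\<Sum>n. F n)" by (rule sum_le_suminf) auto
      finally show ?thesis by (simp only: F_def)
    qed
    have "(\<integral>\<^sup>+ \<eta>. ennreal (?f \<eta>) \<partial>lborel) \<le> (\<integral>\<^sup>+ \<eta>. (\<Sum>n. ennreal (c n) * indicator (cball (0::'a) ((1/2) ^ n)) \<eta>) \<partial>lborel)"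
      by (intro nn_integral_mono le)
    also have "\<dots> = (\<Sum>n. \<integral>\<^sup>+ \<eta>. ennreal (c n) * indicator (cball (0::'a) ((1/2) ^ n)) \<eta> \<partial>lborel)"
      by (rule nn_integral_suminf) (intro borel_measurable_times_ennreal borel_measurable_const borel_measurable_indicator, auto)
    also have "\<dots> = (\<Sum>n. ennreal (2 powr (- p) * V * r ^ n))"
    proof (rule suminf_cong)
      fix n
      have "(\<integral>\<^sup>+ \<eta>. ennreal (c n) * indicator (cball (0::'a) ((1/2) ^ n)) \<eta> \<partial>lborel) = ennreal (c n) * emeasure lborel (cball (0::'a) ((1/2) ^ n))"
        by (rule nn_integral_cmult_indicator) auto
      also have "\<dots> = ennreal (c n * (V * ((1/2) ^ n) ^ DIM('a)))"
        by (subst emeasure_cball) (auto simp: V_def c_def ennreal_mult'')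
      also have "c n * (V * ((1/2) ^ n) ^ DIM('a)) = 2 powr (- p) * V * r ^ n"
      proof -
        have "((1/2::real) ^ n) ^ DIM('a) = 2 powr (- (real n * real DIM('a)))"
          by (simp only: powr_minus) (simp add: powr_realpow power_one_over inverse_eq_divide flip: power_mult of_nat_mult)
        moreover have "r ^ n = 2 powr ((- real DIM('a) - p) * real n)"
          unfolding r_def by (simp flip: powr_realpow add: powr_powr)
        moreover have "c n = 2 powr (- p) * 2 powr (- p * real n)"
        proof -
          have "- p * real (Suc n) = - p + - p * real n" by (simp add: algebra_simps)
          then show ?thesis unfolding c_def by (simp only: powr_add)
        qed
        moreover have "2 powr ((- real DIM('a) - p) * real n) = 2 powr (- p * real n) * 2 powr (- (real n * real DIM('a)))"
        proof -
          have "(- real DIM('a) - p) * real n = - p * real n + - (real n * real DIM('a))"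
            by (simp add: algebra_simps)
          then show ?thesis by (simp only: powr_add)
        qed
        ultimately show ?thesis by (simp only: mult_ac)
      qed
      finally show "(\<integral>\<^sup>+ \<eta>. ennreal (c n) * indicator (cball (0::'a) ((1/2) ^ n)) \<eta> \<partial>lborel) = ennreal (2 powr (- p) * V * r ^ n)" .
    qed
    also have "\<dots> = ennreal (\<Sum>n. 2 powr (- p) * V * r ^ n)"
      using V r by (intro suminf_ennreal2 summable_mult summable_geometric) auto
    also have "\<dots> < \<infinity>" by simp
    finally have fin: "(\<integral>\<^sup>+ \<eta>. ennreal (?f \<eta>) \<partial>lborel) < \<infinity>" .
    show ?thesis by (rule integrableI_nonneg) (use fin meas in auto)
  qed
qed

section \<open>Moments of weight vectors\<close>

lemma finite_multi_indices: "finite {\<alpha>::'d::finite \<Rightarrow> nat. (\<Sum>i\<in>UNIV. \<alpha> i) < q}"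
proof (rule finite_subset)
  show "{\<alpha>::'d \<Rightarrow> nat. (\<Sum>i\<in>UNIV. \<alpha> i) < q} \<subseteq> PiE UNIV (\<lambda>_. {..<q})"
  proof
    fix \<alpha> :: "'d \<Rightarrow> nat" assume "\<alpha> \<in> {\<alpha>. (\<Sum>i\<in>UNIV. \<alpha> i) < q}"
    moreover have "\<alpha> i \<le> (\<Sum>i\<in>UNIV. \<alpha> i)" for i by (rule member_le_sum) auto
    ultimately show "\<alpha> \<in> PiE UNIV (\<lambda>_. {..<q})" by (auto intro: le_less_trans)
  qed
  show "finite (PiE UNIV (\<lambda>_::'d. {..<q}))" by (rule finite_PiE) auto
qed

definition moment :: "('n \<Rightarrow> real^'d) \<Rightarrow> real^'n \<Rightarrow> ('d \<Rightarrow> nat) \<Rightarrow> real" where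
  "moment x c \<alpha> = (\<Sum>j\<in>UNIV. c $ j * (\<Prod>i\<in>UNIV. (x j $ i) ^ \<alpha> i))"

text \<open>If all moments of c below degree q vanish, \<open>a + c\<close> is exact as well, so
  uniqueness forces c = 0. The sum of absolute moments is therefore positive on the unit sphere,
  attains a positive minimum there by compactness, and K is the reciprocal of this minimum.\<close>

lemma moments_bound_weights:
  fixes x :: "'n::finite \<Rightarrow> real^'d" and a :: "real^'n"
  assumes ex: "stencil_exact L x a q" and un: "\<And>b. stencil_exact L x b q \<Longrightarrow> b = a"
  shows "\<exists>K\<ge>0. \<forall>c. norm c \<le> K * (\<Sum>\<alpha> | (\<Sum>i\<in>UNIV. \<alpha> i) < q. \<bar>moment x c \<alpha>\<bar>)"
proof -
  let ?A = "{\<alpha>::'d \<Rightarrow> nat. (\<Sum>i\<in>UNIV. \<alpha> i) < q}"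
  let ?f = "\<lambda>c. \<Sum>\<alpha>\<in>?A. \<bar>moment x c \<alpha>\<bar>"
  have zero: "c = 0" if "?f c = 0" for c
  proof -
    have m0: "moment x c \<alpha> = 0" if "(\<Sum>i\<in>UNIV. \<alpha> i) < q" for \<alpha>
      using \<open>?f c = 0\<close> that by (subst (asm) sum_nonneg_eq_0_iff) (auto simp: finite_multi_indices)
    have "stencil_exact L x (a + c) q"
      unfolding stencil_exact_def
    proof
      fix p :: "real^'d \<Rightarrow> real" assume p: "p \<in> polynomials_of_order q"
      then obtain A e where A: "finite A" "\<forall>\<alpha>\<in>A. (\<Sum>i\<in>UNIV. \<alpha> i) < q" "p = (\<lambda>x. \<Sum>\<alpha>\<in>A. e \<alpha> * (\<Prod>i\<in>UNIV. (x $ i) ^ \<alpha> i))"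
        unfolding polynomials_of_order_def by blast
      have "(\<Sum>j\<in>UNIV. c $ j * p (x j)) = (\<Sum>j\<in>UNIV. \<Sum>\<alpha>\<in>A. e \<alpha> * (c $ j * (\<Prod>i\<in>UNIV. (x j $ i) ^ \<alpha> i)))"
        unfolding A(3) sum_distrib_left by (intro sum.cong refl) (simp only: mult_ac)
      also have "\<dots> = (\<Sum>\<alpha>\<in>A. e \<alpha> * moment x c \<alpha>)"
        unfolding moment_def sum_distrib_left by (rule sum.swap)
      also have "\<dots> = 0" using A(2) m0 by simp
      finally show "L p = (\<Sum>j\<in>UNIV. (a + c) $ j * p (x j))"
        using ex p unfolding stencil_exact_def by (simp add: distrib_right sum.distrib)
    qed
    then show ?thesis using un[of "a + c"] by simp
  qed
  have cont: "continuous_on (sphere 0 1) ?f" unfolding moment_def by (intro continuous_intros)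
  obtain c0 where c0: "c0 \<in> sphere 0 1" "\<And>c. c \<in> sphere (0::real^'n) 1 \<Longrightarrow> ?f c0 \<le> ?f c"
    using continuous_attains_inf[OF compact_sphere _ cont] by (metis sphere_eq_empty less_numeral_extra(1) not_one_less_zero)
  have pos: "?f c0 > 0"
  proof -
    have "?f c0 \<noteq> 0" using zero[of c0] c0(1) by auto
    moreover have "?f c0 \<ge> 0" by (intro sum_nonneg) auto
    ultimately show ?thesis by linarith
  qed
  show ?thesis
  proof (intro exI[of _ "1 / ?f c0"] conjI allI)
    show "0 \<le> 1 / ?f c0" using pos by simp
    fix c :: "real^'n"
    have sc: "?f (t *\<^sub>R c) = \<bar>t\<bar> * ?f c" for t
    proof -
      have "moment x (t *\<^sub>R c) \<alpha> = t * moment x c \<alpha>" for \<alpha>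
        by (simp add: moment_def sum_distrib_left mult.assoc)
      then show ?thesis by (simp add: abs_mult sum_distrib_left)
    qed
    show "norm c \<le> 1 / ?f c0 * ?f c"
    proof (cases "c = 0")
      case False
      have "?f c0 \<le> ?f (inverse (norm c) *\<^sub>R c)" using False by (intro c0(2)) simp
      also have "\<dots> = inverse (norm c) * ?f c" unfolding sc by simp
      finally have "norm c * ?f c0 \<le> ?f c" using False by (simp add: field_simps)
      then show ?thesis using pos by (simp add: field_simps)
    qed (use pos in \<open>simp add: sum_nonneg\<close>)
  qed
qed

section \<open>Optimal weights\<close>

lemma norm_power_le_sobolev_weight: "norm w ^ k \<le> sobolev_weight (real k / 2) w"
proof -
  have "sobolev_weight (1 / 2) w = sqrt (1 + (norm w)\<^sup>2)"
    by (simp add: sobolev_weight_def powr_half_sqrt)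
  then have "norm w \<le> sobolev_weight (1 / 2) w" by (simp add: real_le_rsqrt)
  then have "norm w ^ k \<le> sobolev_weight (1 / 2) w ^ k" by (rule power_mono) simp
  also have "\<dots> = sobolev_weight (1 / 2) w powr real k" by (rule powr_realpow[symmetric]) simp
  also have "\<dots> = sobolev_weight (real k / 2) w" by (simp add: sobolev_weight_def powr_powr)
  finally show ?thesis .
qed

text \<open>For q = 0 the zero function is the only admissible polynomial, so every weight vector is
  exact and uniqueness fails for 0 and 1. Positivity makes q - 1 a genuine exponent later
  on.\<close>

lemma exact_order_pos:
  fixes x :: "'n::finite \<Rightarrow> real^'d" and a :: "real^'n"
  assumes L: "sobolev_functional m \<Omega> L" and un: "\<And>b. stencil_exact L x b q \<Longrightarrow> b = a"
  shows "0 < q"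
proof (rule ccontr)
  assume "\<not> 0 < q"
  have zs: "(\<lambda>_. 0) \<in> sobolev_space_on m \<Omega>"
    using spectral_density_zero[of m] by (auto simp: sobolev_space_on_def sobolev_space_def)
  have "L (\<lambda>_. 0) = 0" using sobolev_functional_scale[OF L zs, of 0] by simp
  moreover have "p = (\<lambda>_. 0)" if "p \<in> polynomials_of_order q" for p :: "real^'d \<Rightarrow> real"
  proof -
    obtain A c where A: "\<forall>\<alpha>\<in>A. (\<Sum>i\<in>UNIV. \<alpha> i) < q" "p = (\<lambda>x. \<Sum>\<alpha>\<in>A. c \<alpha> * (\<Prod>i\<in>UNIV. (x $ i) ^ \<alpha> i))"
      using \<open>p \<in> polynomials_of_order q\<close> unfolding polynomials_of_order_def by blast
    then have "A = {}" using \<open>\<not> 0 < q\<close> by auto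
    then show ?thesis using A by simp
  qed
  ultimately have "stencil_exact L x b q" for b unfolding stencil_exact_def by fastforce
  then have "(0::real^'n) = a" "(1::real^'n) = a" using un by blast+
  then have "(0::real^'n) = 1" by simp
  then show False by simp
qed

text \<open>
  Spectral density of the combination of kernel translates that represents \<open>\<Sum>j. c $ j * u (h x\<^sub>j)\<close>.
\<close>

definition node_density :: "real \<Rightarrow> real \<Rightarrow> ('n \<Rightarrow> real^'d) \<Rightarrow> real^'n \<Rightarrow> real^'d \<Rightarrow> complex" where
  "node_density m h x c w = (\<Sum>j\<in>UNIV. complex_of_real (c $ j) *
     (complex_of_real (sobolev_weight (- m) w) * cis (- (w \<bullet> (h *\<^sub>R x j)))))"

lemma node_density_spectral:
  fixes x :: "'n::finite \<Rightarrow> real^'d"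
  assumes m: "m > real CARD('d) / 2"
  obtains u where "spectral_density m u (node_density m h x c)"
proof -
  have "spectral_density m (\<lambda>y. \<Sum>j\<in>UNIV. c $ j * (2 powr (1 - (m - real CARD('d) / 2)) * pi powr (real CARD('d) / 2) / Gamma m
          * matern (m - real CARD('d) / 2) (norm (y - h *\<^sub>R x j)))) (node_density m h x c)"
    unfolding node_density_def[abs_def]
    by (intro spectral_density_sum[OF m] matern_reproducing_kernel(2)[OF m]) auto
  then show ?thesis by (rule that)
qed

lemma node_density_finite_energy:
  fixes x :: "'n::finite \<Rightarrow> real^'d"
  assumes m: "m > real CARD('d) / 2"
  shows "finite_energy m (node_density m h x c)"
  using node_density_spectral[OF m] spectral_density_finite_energy by metis

lemma node_density_represents:
  fixes x :: "'n::finite \<Rightarrow> real^'d"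
  assumes m: "m > real CARD('d) / 2" and v: "spectral_density m v g"
  shows "complex_of_real (nodal_functional c h x v) =
    (LINT w|lborel. complex_of_real (sobolev_weight m w) * (g w * cnj (node_density m h x c w)))"
proof -
  let ?k = "\<lambda>j w. complex_of_real (sobolev_weight (- m) w) * cis (- (w \<bullet> (h *\<^sub>R x j)))"
  have "finite_energy m (?k j)" for j
    using spectral_density_finite_energy[OF matern_reproducing_kernel(2)[OF m]] .
  then have i: "integrable lborel (\<lambda>w. complex_of_real (sobolev_weight m w) * (g w * cnj (?k j w)))" for j
    by (intro finite_energy_inner spectral_density_finite_energy[OF v])
  have "complex_of_real (nodal_functional c h x v) = (\<Sum>j\<in>UNIV. complex_of_real (c $ j) * complex_of_real (v (h *\<^sub>R x j)))"
    by (simp add: nodal_functional_def)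
  also have "\<dots> = (\<Sum>j\<in>UNIV. complex_of_real (c $ j) * (LINT w|lborel. complex_of_real (sobolev_weight m w) * (g w * cnj (?k j w))))"
    using matern_reproducing_kernel(3)[OF m v] by (intro sum.cong refl) simp
  also have "\<dots> = (LINT w|lborel. (\<Sum>j\<in>UNIV. complex_of_real (c $ j) * (complex_of_real (sobolev_weight m w) * (g w * cnj (?k j w)))))"
    using i by simp
  also have "\<dots> = (LINT w|lborel. complex_of_real (sobolev_weight m w) * (g w * cnj (node_density m h x c w)))"
  proof (intro Bochner_Integration.integral_cong refl)
    fix w
    have "cnj (node_density m h x c w) = (\<Sum>j\<in>UNIV. complex_of_real (c $ j) * cnj (?k j w))"
      by (simp only: node_density_def cnj_sum complex_cnj_mult complex_cnj_complex_of_real)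
    then show "(\<Sum>j\<in>UNIV. complex_of_real (c $ j) * (complex_of_real (sobolev_weight m w) * (g w * cnj (?k j w))))
        = complex_of_real (sobolev_weight m w) * (g w * cnj (node_density m h x c w))"
      by (simp only: sum_distrib_left mult.left_commute)
  qed
  finally show ?thesis .
qed

lemma node_density_hermitian: "cnj (node_density m h x c (- w)) = node_density m h x c w"
  by (simp add: node_density_def cis_cnj sobolev_weight_def)

lemma nodal_functional_bound:
  fixes x :: "'n::finite \<Rightarrow> real^'d"
  assumes m: "m > real CARD('d) / 2" and v: "spectral_density m v g"
  shows "\<bar>nodal_functional c h x v\<bar> \<le> sqrt (energy m g) * sqrt (energy m (node_density m h x c))"
  using finite_energy_inner(2)[OF spectral_density_finite_energy[OF v] node_density_finite_energy[OF m]]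
  by (metis node_density_represents[OF m v] norm_of_real real_norm_def)

text \<open>Moving the weights from \<open>a\<close> to \<open>a + \<tau> *\<^sub>R c\<close>
  subtracts \<tau> times the nodal functional of c from the error functional. Minimality over all
  weights thus contains minimality along this line, which yields orthogonality to the representer u;
  the direction c is arbitrary.\<close>

lemma optimal_weights_orthogonal:
  fixes L :: "(real^'d \<Rightarrow> real) \<Rightarrow> real" and x :: "'n::finite \<Rightarrow> real^'d"
  assumes m: "m > real CARD('d) / 2" and L: "sobolev_functional m \<Omega> L"
    and opt: "optimal_weights m L h x a" and u: "spectral_density m u (node_density m h x c)"
  shows "L u = nodal_functional a h x u"
proof -
  define F where "F v = L v - nodal_functional a h x v" for v
  obtain B where B: "0 \<le> B" "\<And>u v g. spectral_density m v g \<Longrightarrow> (\<And>x. x \<in> \<Omega> \<Longrightarrow> v x = u x) \<Longrightarrow>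
      \<bar>L u\<bar> \<le> B * sqrt (energy m g)"
    using sobolev_functional_bound[OF L] by metis
  have "F u = 0"
  proof (rule dual_norm_minimizer_orthogonal[OF m _ _ _ u node_density_represents[OF m]])
    fix u v :: "real^'d \<Rightarrow> real" and a' b
    assume uv: "u \<in> sobolev_space m" "v \<in> sobolev_space m"
    have "L (\<lambda>x. a' * u x + b * v x) = a' * L u + b * L v"
      using uv sobolev_space_subset by (intro sobolev_functional_lincomb[OF L]) blast+
    then show "F (\<lambda>x. a' * u x + b * v x) = a' * F u + b * F v"
      by (simp add: F_def nodal_functional_def algebra_simps sum.distrib sum_distrib_left)
  next
    show "0 \<le> B + sqrt (energy m (node_density m h x a))" using B(1) by simp
    fix v :: "real^'d \<Rightarrow> real" and g assume v: "spectral_density m v g"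
    have "\<bar>F v\<bar> \<le> \<bar>L v\<bar> + \<bar>nodal_functional a h x v\<bar>" unfolding F_def by (rule abs_triangle_ineq4)
    also have "\<dots> \<le> B * sqrt (energy m g) + sqrt (energy m g) * sqrt (energy m (node_density m h x a))"
      by (intro add_mono B(2)[OF v refl] nodal_functional_bound[OF m v])
    finally show "\<bar>F v\<bar> \<le> (B + sqrt (energy m (node_density m h x a))) * sqrt (energy m g)" by (simp add: algebra_simps)
  next
    fix \<tau>
    have e: "F v - \<tau> * nodal_functional c h x v = L v - nodal_functional (a + \<tau> *\<^sub>R c) h x v" for v
      by (simp add: F_def nodal_functional_def algebra_simps sum.distrib sum_distrib_left)
    have "sobolev_dual_norm m F \<le> sobolev_dual_norm m (\<lambda>v. L v - nodal_functional (a + \<tau> *\<^sub>R c) h x v)"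
      using opt unfolding F_def[abs_def] optimal_weights_def is_arg_min_def by (auto simp: not_less)
    then show "sobolev_dual_norm m F \<le> sobolev_dual_norm m (\<lambda>v. F v - \<tau> * nodal_functional c h x v)"
      by (simp only: e)
  qed
  then show ?thesis by (simp add: F_def)
qed

text \<open>In the Cauchy-Schwarz inequality the weight of order -m is at most |w|^(-2m). With
  \<eta> = h w there remains the integral of |\<eta>|^(2q-2m) over the unit ball, finite because 2 q
  - 2 m > -d, that is \<nu> < q; the factors h^(2m) and h^(-d) combine to h^(2\<nu>).\<close>

lemma low_part_le_energy:
  assumes m: "m > real CARD('d) / 2" and q: "0 < q" "m - real CARD('d) / 2 < real q"
  shows "\<exists>C\<ge>0. \<forall>(g::real^'d \<Rightarrow> complex) h. finite_energy m g \<longrightarrow> 0 < h \<longrightarrow>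
     low_part q h g \<le> C * h powr (m - real CARD('d) / 2) * sqrt (energy m g)"
proof -
  define \<nu> where "\<nu> = m - real CARD('d) / 2"
  have \<nu>: "\<nu> < real q" using q(2) by (simp add: \<nu>_def)
  define p where "p = 2 * real q - 2 * m"
  have ip: "integrable lborel (\<lambda>\<eta>::real^'d. indicator (cball 0 1) \<eta> * norm \<eta> powr p)"
    by (rule integrable_norm_powr_cball) (use \<nu> in \<open>simp add: p_def \<nu>_def\<close>)
  define I where "I = (LINT \<eta>|lborel. indicator (cball 0 1) (\<eta>::real^'d) * norm \<eta> powr p)"
  have I0: "I \<ge> 0" unfolding I_def by (intro Bochner_Integration.integral_nonneg) simp
  have m0: "m > 0" using m by (auto intro: le_less_trans[rotated])
  show ?thesis
  proof (intro exI[of _ "sqrt I"] conjI allI impI)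
    show "0 \<le> sqrt I" using I0 by simp
    fix g :: "real^'d \<Rightarrow> complex" and h :: real
    assume g: "finite_energy m g" and h: "0 < h"
    let ?f = "\<lambda>w::real^'d. indicator (cball 0 (1 / h)) w * (h * norm w) ^ q"
    let ?G = "\<lambda>w::real^'d. sobolev_weight (- m) w * (?f w)\<^sup>2"
    let ?H = "\<lambda>w::real^'d. h powr (2 * m) * (indicator (cball 0 1) (0 + h *\<^sub>R w) * norm (0 + h *\<^sub>R w) powr p)"
    have ind: "(indicator (cball 0 (1 / h)) w :: real) = indicator (cball 0 1) (h *\<^sub>R w)" for w :: "real^'d"
      using h by (simp add: indicator_def field_simps)
    have fm: "?f \<in> borel_measurable borel"
      by (intro borel_measurable_times borel_measurable_indicator borel_measurable_power) auto
    have le: "?G w \<le> ?H w" for w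
    proof (cases "w = 0 \<or> norm (h *\<^sub>R w) > 1")
      case True
      then show ?thesis
      proof
        assume "w = 0"
        \<comment> \<open>Positivity of q makes the left-hand side vanish at the origin, where the
          right-hand side is 0 by the convention for \<open>powr\<close>.\<close>
        then show ?thesis using q by (simp add: zero_power)
      next
        assume "norm (h *\<^sub>R w) > 1"
        then have "(indicator (cball 0 1) (h *\<^sub>R w) :: real) = 0" by (simp add: indicator_def)
        then show ?thesis by (simp add: ind)
      qed
    next
      case False
      then have w: "norm w > 0" "norm (h *\<^sub>R w) \<le> 1" by auto
      let ?y = "h * norm w"
      have y: "?y > 0" using w h by simp
      have "sobolev_weight (- m) w \<le> ((norm w)\<^sup>2) powr (- m)"
        unfolding sobolev_weight_def using w m0 by (intro powr_mono2') auto
      also have "\<dots> = norm w powr (- 2 * m)"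
      proof -
        have "(norm w)\<^sup>2 = norm w powr 2" using w by (simp add: powr_numeral)
        then show ?thesis by (simp only: powr_powr) simp
      qed
      also have "\<dots> = h powr (2 * m) * ?y powr (- 2 * m)"
      proof -
        have "h powr (2 * m) * ?y powr (- 2 * m) = (h powr (2 * m) * h powr (- 2 * m)) * norm w powr (- 2 * m)"
          by (simp only: powr_mult mult.assoc)
        also have "h powr (2 * m) * h powr (- 2 * m) = 1" using h by (simp flip: powr_add)
        finally show ?thesis by simp
      qed
      finally have "sobolev_weight (- m) w * (?y ^ q)\<^sup>2 \<le> h powr (2 * m) * ?y powr (- 2 * m) * (?y ^ q)\<^sup>2"
        by (rule mult_right_mono) simp
      also have "h powr (2 * m) * ?y powr (- 2 * m) * (?y ^ q)\<^sup>2 = h powr (2 * m) * ?y powr p"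
      proof -
        have "(?y ^ q)\<^sup>2 = ?y powr real (2 * q)"
          unfolding powr_realpow[OF y] by (simp only: power_mult[symmetric] mult.commute)
        moreover have "- 2 * m + real (2 * q) = p" by (simp add: p_def)
        then have "?y powr (- 2 * m) * ?y powr real (2 * q) = ?y powr p" by (simp only: powr_add[symmetric])
        ultimately show ?thesis by (simp only: mult.assoc)
      qed
      finally have "sobolev_weight (- m) w * (?y ^ q)\<^sup>2 \<le> h powr (2 * m) * ?y powr p" .
      moreover have "(indicator (cball 0 1) (h *\<^sub>R w) :: real) = 1" using w by (simp add: indicator_def)
      ultimately show ?thesis using h by (simp add: ind)
    qed
    have iH: "integrable lborel ?H"
      by (intro integrable_mult_right integrable_affine_lborel[OF ip]) (use h in simp)
    have iG: "integrable lborel ?G"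
    proof (rule Bochner_Integration.integrable_bound[OF iH])
      show "?G \<in> borel_measurable lborel" using fm by simp
      show "AE w in lborel. norm (?G w) \<le> norm (?H w)"
      proof (rule AE_I2)
        fix w :: "real^'d"
        have "0 \<le> ?G w" by simp
        then show "norm (?G w) \<le> norm (?H w)" using le[of w] by (simp only: real_norm_def)
      qed
    qed
    have "(LINT w|lborel. ?G w) \<le> (LINT w|lborel. ?H w)" by (rule integral_mono[OF iG iH le])
    also have "\<dots> = h powr (2 * m) * (LINT w|lborel. indicator (cball 0 1) (0 + h *\<^sub>R w) * norm (0 + h *\<^sub>R (w::real^'d)) powr p)"
      by (rule integral_mult_right_zero)
    also have "(LINT w|lborel. indicator (cball 0 1) (0 + h *\<^sub>R w) * norm (0 + h *\<^sub>R (w::real^'d)) powr p) = h powr (- real CARD('d)) * I"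
    proof -
      have "I = \<bar>h\<bar> ^ CARD('d) * (LINT w|lborel. indicator (cball 0 1) (0 + h *\<^sub>R w) * norm (0 + h *\<^sub>R (w::real^'d)) powr p)"
        unfolding I_def using h ip by (subst integral_affine_lborel[of _ h 0]) auto
      then show ?thesis using h by (simp add: powr_minus powr_realpow field_simps)
    qed
    also have "h powr (2 * m) * (h powr (- real CARD('d)) * I) = (h powr \<nu>)\<^sup>2 * I"
    proof -
      have "2 * m + - real CARD('d) = \<nu> + \<nu>" by (simp add: \<nu>_def)
      then have "h powr (2 * m) * h powr (- real CARD('d)) = h powr \<nu> * h powr \<nu>" by (simp only: powr_add[symmetric])
      then show ?thesis by (simp add: power2_eq_square mult.assoc[symmetric])
    qed
    finally have G: "sqrt (LINT w|lborel. ?G w) \<le> h powr \<nu> * sqrt I"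
      by (intro real_le_lsqrt) (use I0 in \<open>auto simp: power_mult_distrib\<close>)
    have "low_part q h g = (LINT w|lborel. cmod (g w) * ?f w)"
      by (simp only: low_part_def mult.left_commute)
    also have "\<dots> \<le> \<bar>LINT w|lborel. cmod (g w) * ?f w\<bar>" by (rule abs_ge_self)
    also have "\<dots> \<le> sqrt (energy m g) * sqrt (LINT w|lborel. ?G w)"
      by (rule energy_Cauchy_Schwarz(2)[OF g fm iG])
    also have "\<dots> \<le> sqrt (energy m g) * (h powr \<nu> * sqrt I)" using G by (rule mult_left_mono) simp
    finally show "low_part q h g \<le> sqrt I * h powr (m - real CARD('d) / 2) * sqrt (energy m g)"
      by (simp add: \<nu>_def mult_ac)
  qed
qed

lemma low_part_le_powr:
  assumes q: "real q \<le> m - real CARD('d) / 2"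
  shows "\<exists>C\<ge>0. \<forall>(g::real^'d \<Rightarrow> complex) P h. g \<in> borel_measurable borel \<longrightarrow> 0 \<le> P \<longrightarrow> 0 < h \<longrightarrow>
     (\<forall>w. norm w \<le> 1 / h \<longrightarrow> cmod (g w) \<le> sobolev_weight (- m) w * (P * sobolev_weight ((real q - 1) / 2) w)) \<longrightarrow>
     low_part q h g \<le> C * P * h powr real q"
proof -
  \<comment> \<open>The order m is reduced by (q - 1) / 2 from the bound on g and by q / 2 from
    |w|^q. The surplus 1/2 keeps the result above d/2 even if \<nu> = q.\<close>
  define m' where "m' = m - real q + 1 / 2"
  have m': "m' > real CARD('d) / 2" using q by (simp add: m'_def)
  define I where "I = (LINT w|lborel. sobolev_weight (- m') (w::real^'d))"
  have I0: "I \<ge> 0" unfolding I_def by (intro Bochner_Integration.integral_nonneg) simp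
  show ?thesis
  proof (intro exI[of _ I] conjI allI impI I0)
    fix g :: "real^'d \<Rightarrow> complex" and P h :: real
    assume [measurable]: "g \<in> borel_measurable borel" and P0: "0 \<le> P" and h: "0 < h"
      and b: "\<forall>w. norm w \<le> 1 / h \<longrightarrow> cmod (g w) \<le> sobolev_weight (- m) w * (P * sobolev_weight ((real q - 1) / 2) w)"
    let ?H = "\<lambda>w::real^'d. P * h ^ q * sobolev_weight (- m') w"
    have iH: "integrable lborel ?H" by (intro integrable_mult_right integrable_sobolev_weight[OF m'])
    have le: "indicator (cball 0 (1 / h)) w * (cmod (g w) * (h * norm w) ^ q) \<le> ?H w" for w
    proof (cases "norm w \<le> 1 / h")
      case True
      have "cmod (g w) * (h * norm w) ^ q \<le> (sobolev_weight (- m) w * (P * sobolev_weight ((real q - 1) / 2) w)) * (h ^ q * sobolev_weight (real q / 2) w)"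
        unfolding power_mult_distrib using b True norm_power_le_sobolev_weight[of w q] h P0
        by (intro mult_mono mult_left_mono) auto
      also have "\<dots> = P * h ^ q * (sobolev_weight (- m) w * sobolev_weight ((real q - 1) / 2) w * sobolev_weight (real q / 2) w)"
        by (simp only: mult_ac)
      also have "sobolev_weight (- m) w * sobolev_weight ((real q - 1) / 2) w * sobolev_weight (real q / 2) w = sobolev_weight (- m') w"
        unfolding sobolev_weight_add[symmetric] by (rule arg_cong[of _ _ "\<lambda>a. sobolev_weight a w"]) (simp add: m'_def field_simps)
      finally show ?thesis using True by (simp add: indicator_def)
    next
      case False
      then show ?thesis using P0 h by (simp add: indicator_def)
    qed
    have "low_part q h g \<le> (LINT w|lborel. ?H w)"
      unfolding low_part_def
    proof (rule integral_mono[OF _ iH le])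
      show "integrable lborel (\<lambda>w. indicator (cball 0 (1 / h)) w * (cmod (g w) * (h * norm w) ^ q))"
      proof (rule Bochner_Integration.integrable_bound[OF iH])
        show "(\<lambda>w. indicator (cball 0 (1 / h)) w * (cmod (g w) * (h * norm w) ^ q)) \<in> borel_measurable lborel"
          by (intro borel_measurable_times borel_measurable_indicator borel_measurable_power) auto
        show "AE w in lborel. norm (indicator (cball 0 (1 / h)) w * (cmod (g w) * (h * norm w) ^ q)) \<le> norm (?H w)"
        proof (rule AE_I2)
          fix w :: "real^'d"
          have "0 \<le> indicator (cball 0 (1 / h)) w * (cmod (g w) * (h * norm w) ^ q)" using h by simp
          then show "norm (indicator (cball 0 (1 / h)) w * (cmod (g w) * (h * norm w) ^ q)) \<le> norm (?H w)"
            using le[of w] by (simp only: real_norm_def)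
        qed
      qed
    qed
    also have "\<dots> = P * h ^ q * I" unfolding I_def by (rule integral_mult_right_zero)
    finally show "low_part q h g \<le> I * P * h powr real q"
      using h by (simp add: powr_realpow mult_ac)
  qed
qed

text \<open>Both bounds rest on testing c on hX against smooth functions: on hX such a function may
  be replaced by a Sobolev function, so the value is at most its derivative bound times a multiple
  of the square root of the energy. Monomials give the moments of c, powers of linear forms the
  low-order terms of the exponential sum.\<close>

lemma node_density_bounds:
  fixes x :: "'n::finite \<Rightarrow> real^'d" and a_hat :: "real^'n"
  assumes m: "m > real CARD('d) / 2" and q: "0 < q" and R: "0 \<le> R" and xR: "\<And>j. norm (x j) \<le> R"
    and ex: "stencil_exact L x a_hat q" and un: "\<And>b. stencil_exact L x b q \<Longrightarrow> b = a_hat"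
  obtains K P where "0 \<le> K" "0 \<le> P"
    "\<And>c h. 0 < h \<Longrightarrow> h \<le> 1 \<Longrightarrow> norm c \<le> K * h powr (1 - real q) * sqrt (energy m (node_density m h x c))"
    "\<And>c h w. 0 < h \<Longrightarrow> h \<le> 1 \<Longrightarrow> norm w \<le> 1 / h \<Longrightarrow> cmod (node_density m h x c w)
        \<le> sobolev_weight (- m) w * (P * sqrt (energy m (node_density m h x c)) * sobolev_weight ((real q - 1) / 2) w)"
proof -
  obtain n :: nat where n: "real n > m + real CARD('d) / 2" using reals_Archimedean2 by blast
  obtain C0 where C0: "C0 \<ge> 0" "\<And>(f::real^'d \<Rightarrow> real) M. smooth_bdd n (cball 0 (R + 1)) M f \<Longrightarrow> 0 \<le> M \<Longrightarrow>
      \<exists>v g. spectral_density m v g \<and> energy m g \<le> (C0 * M)\<^sup>2 \<and> (\<forall>x. norm x \<le> R \<longrightarrow> v x = f x)"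
    using spectral_density_extension[OF m n R] by blast
  have hx: "norm (h *\<^sub>R x j) \<le> R" if "0 < h" "h \<le> 1" for h j
  proof -
    have "h * norm (x j) \<le> 1 * R" using that xR[of j] by (intro mult_mono) auto
    then show ?thesis using that by simp
  qed
  have test: "\<bar>nodal_functional c h x f\<bar> \<le> C0 * M * sqrt (energy m (node_density m h x c))"
    if f: "smooth_bdd n (cball 0 (R + 1)) M f" "0 \<le> M" and h: "0 < h" "h \<le> 1" for f M h c
  proof -
    obtain v g where v: "spectral_density m v g" "energy m g \<le> (C0 * M)\<^sup>2" "\<And>x. norm x \<le> R \<Longrightarrow> v x = f x"
      using C0(2)[OF f] by blast
    have "nodal_functional c h x f = nodal_functional c h x v"
      using v(3) hx[OF h] by (simp add: nodal_functional_def)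
    moreover have "sqrt (energy m g) \<le> C0 * M" using v(2) C0(1) f(2) by (intro real_le_lsqrt) auto
    ultimately show ?thesis
      using order_trans[OF nodal_functional_bound[OF m v(1)] mult_right_mono] by (simp add: energy_nonneg)
  qed
  define A where "A = {\<alpha>::'d \<Rightarrow> nat. (\<Sum>i\<in>UNIV. \<alpha> i) < q}"
  obtain K where K: "K \<ge> 0" "\<And>c. norm c \<le> K * (\<Sum>\<alpha>\<in>A. \<bar>moment x c \<alpha>\<bar>)"
    using moments_bound_weights[OF ex un] unfolding A_def by blast
  obtain K2 where K2: "K2 \<ge> 0" "\<And>c h. 0 < h \<Longrightarrow> h \<le> 1 \<Longrightarrow>
      norm c \<le> K2 * h powr (1 - real q) * sqrt (energy m (node_density m h x c))"
  proof -
    have "\<exists>M\<ge>0. smooth_bdd n (cball 0 (R + 1)) M (\<lambda>y::real^'d. \<Prod>i\<in>UNIV. (y $ i) ^ \<alpha> i)" for \<alpha>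
    proof (rule smooth_bdd_prod)
      fix i
      have "smooth_bdd n (cball 0 (R + 1)) (R + 1 + 1) (\<lambda>y::real^'d. axis i 1 \<bullet> y)"
        using R by (intro smooth_bdd_inner) auto
      moreover have "0 \<le> R + 1 + 1" using R by simp
      moreover have "axis i 1 \<bullet> y = y $ i" for y :: "real^'d" by (simp add: inner_axis')
      ultimately have "smooth_bdd n (cball 0 (R + 1)) (2 ^ (n * \<alpha> i) * (R + 1 + 1) ^ \<alpha> i) (\<lambda>y::real^'d. (y $ i) ^ \<alpha> i)"
        using smooth_bdd_power[of "R + 1 + 1" n "cball 0 (R + 1)" "\<lambda>y::real^'d. axis i 1 \<bullet> y" "\<alpha> i"] by (simp only:)
      moreover have "0 \<le> 2 ^ (n * \<alpha> i) * (R + 1 + 1) ^ \<alpha> i" using R by simp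
      ultimately show "\<exists>M\<ge>0. smooth_bdd n (cball 0 (R + 1)) M (\<lambda>y::real^'d. (y $ i) ^ \<alpha> i)" by blast
    qed simp
    then have "\<forall>\<alpha>. \<exists>M. 0 \<le> M \<and> smooth_bdd n (cball 0 (R + 1)) M (\<lambda>y::real^'d. \<Prod>i\<in>UNIV. (y $ i) ^ \<alpha> i)" by (rule allI)
    from choice[OF this]
    obtain M where M: "\<And>\<alpha>. M \<alpha> \<ge> 0" "\<And>\<alpha>. smooth_bdd n (cball 0 (R + 1)) (M \<alpha>) (\<lambda>y::real^'d. \<Prod>i\<in>UNIV. (y $ i) ^ \<alpha> i)"
      by blast
    show ?thesis
    proof (rule that[of "K * (\<Sum>\<alpha>\<in>A. C0 * M \<alpha>)"])
      show "0 \<le> K * (\<Sum>\<alpha>\<in>A. C0 * M \<alpha>)" using K C0 M by (auto intro!: mult_nonneg_nonneg sum_nonneg)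
      fix c :: "real^'n" and h :: real assume h: "0 < h" "h \<le> 1"
      define N where "N = sqrt (energy m (node_density m h x c))"
      have "\<bar>moment x c \<alpha>\<bar> \<le> h powr (1 - real q) * (C0 * M \<alpha> * N)" if "\<alpha> \<in> A" for \<alpha>
      proof -
        define e where "e = (\<Sum>i\<in>UNIV. \<alpha> i)"
        have "nodal_functional c h x (\<lambda>y. \<Prod>i\<in>UNIV. (y $ i) ^ \<alpha> i) = h ^ e * moment x c \<alpha>"
          by (simp add: e_def nodal_functional_def moment_def power_mult_distrib prod.distrib power_sum sum_distrib_left mult_ac)
        then have "h ^ e * \<bar>moment x c \<alpha>\<bar> \<le> C0 * M \<alpha> * N"
          using test[OF M(2) M(1) h, of c \<alpha>] h unfolding N_def by (simp add: abs_mult)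
        then have "h powr (- real e) * (h ^ e * \<bar>moment x c \<alpha>\<bar>) \<le> h powr (- real e) * (C0 * M \<alpha> * N)"
          by (rule mult_left_mono) simp
        also have "\<dots> \<le> h powr (1 - real q) * (C0 * M \<alpha> * N)"
        proof (intro mult_right_mono)
          \<comment> \<open>The degree e is at most q - 1 and h \<le> 1, so the top degree
            determines the loss h^(1-q).\<close>
          have "real (Suc e) \<le> real q" using that unfolding A_def e_def of_nat_le_iff by (simp add: Suc_le_eq)
          then have "1 - real q \<le> - real e" unfolding of_nat_Suc by linarith
          then show "h powr (- real e) \<le> h powr (1 - real q)" using h by (intro powr_mono') auto
          show "0 \<le> C0 * M \<alpha> * N" using C0 M by (simp add: N_def)
        qed
        also have "h powr (- real e) * (h ^ e * \<bar>moment x c \<alpha>\<bar>) = \<bar>moment x c \<alpha>\<bar>"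
          using h by (simp add: powr_minus powr_realpow)
        finally show ?thesis .
      qed
      then have "(\<Sum>\<alpha>\<in>A. \<bar>moment x c \<alpha>\<bar>) \<le> (\<Sum>\<alpha>\<in>A. h powr (1 - real q) * (C0 * M \<alpha> * N))" by (rule sum_mono)
      then have "norm c \<le> K * (\<Sum>\<alpha>\<in>A. h powr (1 - real q) * (C0 * M \<alpha> * N))"
        using K(2)[of c] mult_left_mono[OF _ K(1)] by (meson order_trans)
      then show "norm c \<le> K * (\<Sum>\<alpha>\<in>A. C0 * M \<alpha>) * h powr (1 - real q) * sqrt (energy m (node_density m h x c))"
        unfolding N_def[symmetric] by (simp add: sum_distrib_left sum_distrib_right mult_ac)
    qed
  qed
  \<comment> \<open>The sum over l < q collects the terms of the expanded exponential sum, the last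
    summand its remainder; \<open>CARD('n)\<close> arises from bounding every component of c by its
    norm.\<close>
  define P where "P = (\<Sum>l<q. C0 * (2 ^ (n * l) * (R + 1 + 1) ^ l)) + real CARD('n) * K2 * R ^ q"
  have P0: "P \<ge> 0" using C0(1) K2(1) R by (simp add: P_def sum_nonneg)
  show ?thesis
  proof (rule that[OF K2(1) P0 K2(2)])
    fix c :: "real^'n" and h :: real and w :: "real^'d"
    assume h: "0 < h" "h \<le> 1" and w: "norm w \<le> 1 / h"
    define N where "N = sqrt (energy m (node_density m h x c))"
    have N0: "N \<ge> 0" by (simp add: N_def)
    have hw: "h * norm w \<le> 1" using h w by (simp add: field_simps)
    have W: "norm w ^ l \<le> sobolev_weight ((real q - 1) / 2) w" if "l < q" for l
    proof -
      have "norm w ^ l \<le> sobolev_weight (real l / 2) w" by (rule norm_power_le_sobolev_weight)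
      also have "\<dots> \<le> sobolev_weight ((real q - 1) / 2) w" using that by (intro sobolev_weight_mono) auto
      finally show ?thesis .
    qed
    define e where "e = (\<Sum>j\<in>UNIV. complex_of_real (c $ j) * cis (- (w \<bullet> (h *\<^sub>R x j))))"
    define T where "T l = (\<Sum>j\<in>UNIV. complex_of_real (c $ j) * exp_term l (- (w \<bullet> (h *\<^sub>R x j))))" for l
    define E where "E = (\<Sum>j\<in>UNIV. complex_of_real (c $ j) * exp_rem q (- (w \<bullet> (h *\<^sub>R x j))))"
    have "cis z = (\<Sum>l<q. exp_term l z) + exp_rem q z" for z by (simp add: exp_rem_def)
    then have e: "e = (\<Sum>l<q. T l) + E"
      unfolding e_def T_def E_def by (simp add: distrib_left sum.distrib sum_distrib_left) (rule sum.swap)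
    have Tb: "cmod (T l) \<le> C0 * (2 ^ (n * l) * (R + 1 + 1) ^ l) * N * norm w ^ l" for l
    proof -
      \<comment> \<open>Normalisation leaves a linear form of norm at most 1, whose test constant is
        uniform in w. For w = 0 the convention \<open>inverse 0 = 0\<close> gives w' = 0, and w =
        |w| w' persists.\<close>
      define w' where "w' = inverse (norm w) *\<^sub>R w"
      have w': "norm w' \<le> 1" "w = norm w *\<^sub>R w'" by (cases "w = 0"; simp add: w'_def)+
      have "smooth_bdd n (cball 0 (R + 1)) (2 ^ (n * l) * (R + 1 + 1) ^ l) (\<lambda>y. (w' \<bullet> y) ^ l)"
        using R w'(1) by (intro smooth_bdd_power smooth_bdd_inner) auto
      from test[OF this _ h, of "c"] R
      have t: "\<bar>nodal_functional (c) h x (\<lambda>y. (w' \<bullet> y) ^ l)\<bar> \<le> C0 * (2 ^ (n * l) * (R + 1 + 1) ^ l) * N"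
        by (simp add: N_def)
      have ww: "w \<bullet> y = norm w * (w' \<bullet> y)" for y by (subst w'(2)) simp
      have "T l = (- \<i>) ^ l / fact l * complex_of_real (norm w ^ l) * complex_of_real (nodal_functional (c) h x (\<lambda>y. (w' \<bullet> y) ^ l))"
      proof -
        have "exp_term l (- (w \<bullet> y)) = (- \<i>) ^ l / fact l * complex_of_real (norm w ^ l) * complex_of_real ((w' \<bullet> y) ^ l)" for y
        proof -
          have "\<i> * complex_of_real (- (w \<bullet> y)) = (- \<i>) * complex_of_real (norm w) * complex_of_real (w' \<bullet> y)" by (simp add: ww)
          then show ?thesis unfolding exp_term_def by (simp only: power_mult_distrib of_real_power) simp
        qed
        then show ?thesis
          unfolding T_def nodal_functional_def of_real_sum sum_distrib_left
          by (intro sum.cong refl) (simp only: of_real_mult mult_ac)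
      qed
      then have "cmod (T l) = norm w ^ l / fact l * \<bar>nodal_functional (c) h x (\<lambda>y. (w' \<bullet> y) ^ l)\<bar>"
        by (simp only: norm_mult norm_divide norm_power norm_minus_cancel norm_ii norm_of_real) simp
      also have "\<dots> \<le> norm w ^ l * (C0 * (2 ^ (n * l) * (R + 1 + 1) ^ l) * N)"
      proof (rule mult_mono[OF _ t])
        have "norm w ^ l / fact l \<le> norm w ^ l / 1" by (intro divide_left_mono) auto
        then show "norm w ^ l / fact l \<le> norm w ^ l" by simp
      qed auto
      finally show ?thesis by (simp only: mult_ac)
    qed
    \<comment> \<open>One factor h |w| is estimated by 1 to lower the degree from q to q - 1; this
      is where |w| \<le> 1 / h enters.\<close>
    have Eb: "cmod E \<le> real CARD('n) * K2 * R ^ q * N * norm w ^ (q - 1)"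
    proof -
      have "cmod E \<le> (\<Sum>j\<in>UNIV. cmod (complex_of_real (c $ j) * exp_rem q (- (w \<bullet> (h *\<^sub>R x j)))))"
        unfolding E_def by (rule norm_sum)
      also have "\<dots> \<le> (\<Sum>j\<in>(UNIV::'n set). K2 * R ^ q * N * norm w ^ (q - 1))"
      proof (rule sum_mono)
        fix j
        have "\<bar>- (w \<bullet> (h *\<^sub>R x j))\<bar> \<le> norm w * norm (h *\<^sub>R x j)"
          unfolding abs_minus_cancel by (rule Cauchy_Schwarz_ineq2)
        also have "\<dots> \<le> h * norm w * R" using h mult_left_mono[OF xR[of j], of "h * norm w"] by (simp add: mult_ac)
        finally have z: "\<bar>- (w \<bullet> (h *\<^sub>R x j))\<bar> ^ q \<le> (h * norm w * R) ^ q" by (rule power_mono) simp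
        have "cmod (complex_of_real (c $ j) * exp_rem q (- (w \<bullet> (h *\<^sub>R x j)))) \<le> norm (c) * (h * norm w * R) ^ q"
          unfolding norm_mult norm_of_real using component_le_norm_cart[of "c" j]
          by (intro mult_mono order_trans[OF norm_exp_rem z]) auto
        also have "\<dots> \<le> K2 * h powr (1 - real q) * N * (h * norm w * R) ^ q"
          using K2(2)[OF h, of "c"] h R by (intro mult_right_mono) (auto simp: N_def)
        also have "\<dots> = K2 * R ^ q * N * (h powr (1 - real q) * h ^ (q - 1) * ((h * norm w) * norm w ^ (q - 1)))"
        proof -
          have "(h * norm w * R) ^ q = h ^ (q - 1) * ((h * norm w) * norm w ^ (q - 1)) * R ^ q"
            using q by (cases q) (auto simp: power_mult_distrib)
          then show ?thesis by (simp only: mult_ac)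
        qed
        also have "h powr (1 - real q) * h ^ (q - 1) = 1"
          using h q by (simp add: powr_realpow[symmetric] of_nat_diff flip: powr_add)
        also have "K2 * R ^ q * N * (1 * ((h * norm w) * norm w ^ (q - 1))) \<le> K2 * R ^ q * N * norm w ^ (q - 1)"
          using hw h K2(1) R N0 by (intro mult_left_mono) (auto intro: mult_left_le_one_le)
        finally show "cmod (complex_of_real (c $ j) * exp_rem q (- (w \<bullet> (h *\<^sub>R x j)))) \<le> K2 * R ^ q * N * norm w ^ (q - 1)" .
      qed
      finally show ?thesis by (simp add: mult.assoc)
    qed
    have "cmod e \<le> (\<Sum>l<q. cmod (T l)) + cmod E"
      unfolding e by (intro norm_triangle_mono norm_sum order_refl)
    also have "\<dots> \<le> (\<Sum>l<q. C0 * (2 ^ (n * l) * (R + 1 + 1) ^ l) * N * sobolev_weight ((real q - 1) / 2) w)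
         + real CARD('n) * K2 * R ^ q * N * sobolev_weight ((real q - 1) / 2) w"
    proof (intro add_mono sum_mono)
      show "cmod (T l) \<le> C0 * (2 ^ (n * l) * (R + 1 + 1) ^ l) * N * sobolev_weight ((real q - 1) / 2) w" if "l \<in> {..<q}" for l
        using W[of l] that C0(1) R N0 by (intro order_trans[OF Tb] mult_left_mono) auto
      show "cmod E \<le> real CARD('n) * K2 * R ^ q * N * sobolev_weight ((real q - 1) / 2) w"
        using W[of "q - 1"] q K2(1) R N0 by (intro order_trans[OF Eb] mult_left_mono) auto
    qed
    also have "\<dots> = P * N * sobolev_weight ((real q - 1) / 2) w"
      by (simp add: P_def sum_distrib_right distrib_right)
    finally have eb: "cmod e \<le> P * N * sobolev_weight ((real q - 1) / 2) w" .
    have "node_density m h x c w = complex_of_real (sobolev_weight (- m) w) * e"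
      unfolding node_density_def e_def sum_distrib_left by (simp only: mult.left_commute)
    then have "cmod (node_density m h x c w) = sobolev_weight (- m) w * cmod e" by (simp add: norm_mult)
    then show "cmod (node_density m h x c w)
        \<le> sobolev_weight (- m) w * (P * sqrt (energy m (node_density m h x c)) * sobolev_weight ((real q - 1) / 2) w)"
      using eb unfolding N_def by (simp add: mult_left_mono)
  qed
qed

theorem theorem10:
  fixes m s :: real and \<Omega> :: "(real^'d) set" and L :: "(real^'d \<Rightarrow> real) \<Rightarrow> real"
    and x :: "'n::finite \<Rightarrow> real^'d" and a :: "real \<Rightarrow> real^'n" and a_hat :: "real^'n" and q :: nat
  assumes "m > real CARD('d) / 2"
    and "bounded \<Omega>" and "scalable \<Omega>" and "lipschitz_domain \<Omega>"
    and "sobolev_functional m \<Omega> L" and "scaling_order m \<Omega> L s"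
    and "inj x" and "range x \<subseteq> \<Omega>"
    and "\<And>h. 0 < h \<Longrightarrow> h \<le> 1 \<Longrightarrow> optimal_weights m L h x (a h)"
    and "stencil_exact L x a_hat q"
    and "\<And>b. stencil_exact L x b q \<Longrightarrow> b = a_hat"
  shows "\<exists>C. \<forall>\<^sub>F h in at_right 0.
           (m - real CARD('d) / 2 < real q \<longrightarrow>
              infnorm ((h powr s) *\<^sub>R a h - a_hat) \<le> C * h powr (m - real q + 1 - real CARD('d) / 2)) \<and>
           (m - real CARD('d) / 2 \<ge> real q \<longrightarrow>
              infnorm ((h powr s) *\<^sub>R a h - a_hat) \<le> C * h)"
proof -
  note m = assms(1) and L = assms(5) and s = assms(6) and x = assms(8) and opt = assms(9) and ex = assms(10) and un = assms(11)
  define \<nu> where "\<nu> = m - real CARD('d) / 2"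
  have q: "0 < q" by (rule exact_order_pos[OF L un])
  obtain R0 where R0: "\<And>y. y \<in> \<Omega> \<Longrightarrow> norm y \<le> R0" using assms(2) unfolding bounded_iff by blast
  define R where "R = max 0 R0"
  have R: "0 \<le> R" "\<Omega> \<subseteq> cball 0 R" using R0 by (auto simp: R_def le_max_iff_disj)
  have xR: "norm (x j) \<le> R" for j using x R(2) by (meson mem_cball_0 range_subsetD subsetD)
  obtain K2 P where K2: "0 \<le> K2" and P: "0 \<le> P"
    and cb: "\<And>c h. 0 < h \<Longrightarrow> h \<le> 1 \<Longrightarrow> norm c \<le> K2 * h powr (1 - real q) * sqrt (energy m (node_density m h x c))"
    and kb: "\<And>c h w. 0 < h \<Longrightarrow> h \<le> 1 \<Longrightarrow> norm w \<le> 1 / h \<Longrightarrow> cmod (node_density m h x c w)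
        \<le> sobolev_weight (- m) w * (P * sqrt (energy m (node_density m h x c)) * sobolev_weight ((real q - 1) / 2) w)"
    using node_density_bounds[OF m q R(1) xR ex un] by metis
  obtain C where C: "C \<ge> 0" "\<And>u g h. spectral_density m u g \<Longrightarrow> (\<forall>w. cnj (g (- w)) = g w) \<Longrightarrow> 0 < h \<Longrightarrow> h \<le> 1 \<Longrightarrow>
     \<bar>L (\<lambda>y. u (h *\<^sub>R y)) - (\<Sum>j\<in>UNIV. a_hat $ j * u (h *\<^sub>R x j))\<bar> \<le>
       C * (low_part q h g + h powr (m - real CARD('d) / 2) * sqrt (energy m g))"
    using stencil_error_dilate[OF m R x L s ex] by blast
  define c where "c h = h powr s *\<^sub>R a h - a_hat" for h
  define k where "k h = node_density m h x (c h)" for h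
  define N where "N h = sqrt (energy m (k h))" for h
  have N0: "N h \<ge> 0" for h by (simp add: N_def)
  have fk: "finite_energy m (k h)" for h unfolding k_def by (rule node_density_finite_energy[OF m])
  have main: "(N h)\<^sup>2 \<le> C * (low_part q h (k h) + h powr \<nu> * N h)"
    if h: "0 < h" "h \<le> 1" for h
  proof -
    obtain u where u: "spectral_density m u (k h)"
      using node_density_spectral[OF m] unfolding k_def by metis
    have us: "u \<in> sobolev_space_on m \<Omega>" using u by (auto simp: sobolev_space_on_def sobolev_space_def)
    have "complex_of_real (nodal_functional (c h) h x u) = complex_of_real (energy m (k h))"
      unfolding node_density_represents[OF m u] energy_eq_inner k_def[symmetric] ..
    then have "(N h)\<^sup>2 = nodal_functional (c h) h x u" by (simp add: N_def del: of_real_eq_iff) (simp only: of_real_eq_iff)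
    also have "\<dots> = h powr s * nodal_functional (a h) h x u - nodal_functional a_hat h x u"
      by (simp add: nodal_functional_def c_def algebra_simps sum_subtractf sum_distrib_left)
    also have "nodal_functional (a h) h x u = L u"
      using optimal_weights_orthogonal[OF m L opt[OF h]] u unfolding k_def by metis
    also have "h powr s * L u = L (\<lambda>y. u (h *\<^sub>R y))"
      using s us h unfolding scaling_order_def by simp
    also have "L (\<lambda>y. u (h *\<^sub>R y)) - nodal_functional a_hat h x u \<le> \<bar>L (\<lambda>y. u (h *\<^sub>R y)) - (\<Sum>j\<in>UNIV. a_hat $ j * u (h *\<^sub>R x j))\<bar>"
      unfolding nodal_functional_def by (rule abs_ge_self)
    also have "\<dots> \<le> C * (low_part q h (k h) + h powr \<nu> * N h)"
      unfolding N_def \<nu>_def using node_density_hermitian unfolding k_def by (intro C(2)[OF u[unfolded k_def] _ h]) blast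
    finally show ?thesis .
  qed
  \<comment> \<open>The smaller of \<nu> and q; the high-frequency term h^\<nu> is absorbed by h^r
    because h \<le> 1.\<close>
  define r where "r = (if \<nu> < real q then \<nu> else real q)"
  obtain D where D: "D \<ge> 0" "\<And>h. 0 < h \<Longrightarrow> h \<le> 1 \<Longrightarrow> low_part q h (k h) \<le> D * h powr r * N h"
  proof (cases "\<nu> < real q")
    case True
    then obtain D where "D \<ge> 0" "\<forall>(g::real^'d \<Rightarrow> complex) h. finite_energy m g \<longrightarrow> 0 < h \<longrightarrow>
        low_part q h g \<le> D * h powr (m - real CARD('d) / 2) * sqrt (energy m g)"
      using low_part_le_energy[OF m q] unfolding \<nu>_def by blast
    then show ?thesis using True fk by (intro that[of D]) (auto simp: r_def \<nu>_def N_def)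
  next
    case False
    then obtain D where D: "D \<ge> 0" "\<And>(g::real^'d \<Rightarrow> complex) P h. g \<in> borel_measurable borel \<Longrightarrow> 0 \<le> P \<Longrightarrow> 0 < h \<Longrightarrow>
       (\<forall>w. norm w \<le> 1 / h \<longrightarrow> cmod (g w) \<le> sobolev_weight (- m) w * (P * sobolev_weight ((real q - 1) / 2) w)) \<Longrightarrow>
       low_part q h g \<le> D * P * h powr real q"
      using low_part_le_powr[of q m, where ?'d = 'd] unfolding \<nu>_def not_less by blast
    show ?thesis
    proof (rule that[of "D * P"])
      show "0 \<le> D * P" using D(1) P by simp
      fix h :: real assume h: "0 < h" "h \<le> 1"
      \<comment> \<open>The pointwise bound on the density is itself proportional to N, so
        \<open>P * N h\<close> takes the role of the constant P in the estimate of the low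
        part.\<close>
      have "low_part q h (k h) \<le> D * (P * N h) * h powr real q"
        using kb[OF h] P N0[of h] h finite_energy_measurable[OF fk[of h]]
        by (intro D(2)) (auto simp: k_def N_def)
      then show "low_part q h (k h) \<le> D * P * h powr r * N h" using False by (simp add: r_def mult_ac)
    qed
  qed
  \<comment> \<open>Every term of the estimate for N^2 contains a factor N, so division by N leaves
    the bound of order h^r.\<close>
  have NB: "N h \<le> C * (D + 1) * h powr r" if h: "0 < h" "h \<le> 1" for h
  proof (cases "N h = 0")
    case True
    then show ?thesis using C(1) D(1) by simp
  next
    case False
    then have N: "N h > 0" using N0[of h] by simp
    have "h powr \<nu> \<le> h powr r" using h by (intro powr_mono') (auto simp: r_def)
    then have "h powr \<nu> * N h \<le> h powr r * N h" using N by (intro mult_right_mono) auto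
    then have "(N h)\<^sup>2 \<le> C * (D * h powr r * N h + h powr r * N h)"
      using D(2)[OF h] by (intro order_trans[OF main[OF h]] mult_left_mono add_mono C(1))
    also have "\<dots> = (C * (D + 1) * h powr r) * N h" by (simp add: algebra_simps)
    finally show ?thesis using N by (simp add: power2_eq_square)
  qed
  have final: "infnorm (h powr s *\<^sub>R a h - a_hat) \<le> K2 * (C * (D + 1)) * h powr (1 - real q + r)" if h: "0 < h" "h \<le> 1" for h
  proof -
    have "infnorm (c h) \<le> norm (c h)" by (rule infnorm_le_norm)
    also have "\<dots> \<le> K2 * h powr (1 - real q) * N h" using cb[OF h, of "c h"] by (simp add: N_def k_def)
    also have "\<dots> \<le> K2 * h powr (1 - real q) * (C * (D + 1) * h powr r)"
      using NB[OF h] K2 by (intro mult_left_mono) auto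
    also have "\<dots> = K2 * (C * (D + 1)) * h powr (1 - real q + r)" by (simp only: powr_add mult_ac)
    finally show ?thesis by (simp add: c_def)
  qed
  show ?thesis
  proof (intro exI[of _ "K2 * (C * (D + 1))"])
    have "\<forall>\<^sub>F h in at_right (0::real). 0 < h \<and> h \<le> 1"
      unfolding eventually_at_right_field by (intro exI[of _ 1]) auto
    then show "\<forall>\<^sub>F h in at_right 0.
           (m - real CARD('d) / 2 < real q \<longrightarrow>
              infnorm ((h powr s) *\<^sub>R a h - a_hat) \<le> K2 * (C * (D + 1)) * h powr (m - real q + 1 - real CARD('d) / 2)) \<and>
           (m - real CARD('d) / 2 \<ge> real q \<longrightarrow>
              infnorm ((h powr s) *\<^sub>R a h - a_hat) \<le> K2 * (C * (D + 1)) * h)"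
    proof (rule eventually_mono, intro conjI impI; elim conjE)
      fix h :: real assume h: "0 < h" "h \<le> 1"
      {
        assume "m - real CARD('d) / 2 < real q"
        then have "1 - real q + r = m - real q + 1 - real CARD('d) / 2" by (simp add: r_def \<nu>_def)
        then show "infnorm ((h powr s) *\<^sub>R a h - a_hat) \<le> K2 * (C * (D + 1)) * h powr (m - real q + 1 - real CARD('d) / 2)"
          using final[OF h] by (simp only:)
      next
        assume "m - real CARD('d) / 2 \<ge> real q"
        then have "1 - real q + r = 1" by (simp add: r_def \<nu>_def)
        then show "infnorm ((h powr s) *\<^sub>R a h - a_hat) \<le> K2 * (C * (D + 1)) * h"
          using final[OF h] h by simp
      }
    qed
  qed
qed

end
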